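(* Let $0<\varepsilon<0.1$ be a fixed constant, let $q\ge q_0(\varepsilon)$ be an integer (with $q_0(\varepsilon)$ sufficiently large), and let $a,b$ be integers with $(ab,q)=1$. Then for every $X\ge q\,\tau^4(q)(\ln q)^{12}$, \[ T_q(X)\ll X\Delta,\qquad \Delta=\frac{(\ln X)^{5/2}}{q^{1/4}}\,\tau(q)+\Bigl(\frac{q}{X}\Bigr)^{1/6}(\ln X)^2(\tau(q))^{2/3}, \] where \[ T_q(X)=T_q(a,b;X)=\sum_{\substack{n\le X\\(n,q)=1}}\Lambda(n)\,e_q(a\overline{n}+bn). \]
   Context: $e_q(u)=e^{2\pi i u/q}$; for $(n,q)=1$, $\overline{n}$ is the inverse of $n$ modulo $q$. $\Lambda$ is the von Mangoldt function and $\tau$ the divisor function. *)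

theory Defs
  imports Complex_Main "HOL-Number_Theory.Number_Theory"
begin

definition e_mod :: "nat \<Rightarrow> int \<Rightarrow> complex" where
  "e_mod q u = exp (2 * of_real pi * \<i> * of_int u / of_nat q)"

definition divisor_tau :: "nat \<Rightarrow> nat" where
  "divisor_tau n = card {d. d dvd n}"

text \<open>
  The representative of the inverse of \<open>n\<close> modulo \<open>q\<close> chosen by \<^const>\<open>modular_inverse\<close> is
  immaterial, since \<^const>\<open>e_mod\<close> is \<open>q\<close>-periodic in its second argument.
\<close>
definition T_sum :: "nat \<Rightarrow> int \<Rightarrow> int \<Rightarrow> real \<Rightarrow> complex" where
  "T_sum q a b X =
     (\<Sum>n | 1 \<le> n \<and> real n \<le> X \<and> coprime n q.
        mangoldt n * e_mod q (a * modular_inverse (int q) (int n) + b * int n))"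

definition Delta :: "nat \<Rightarrow> real \<Rightarrow> real" where
  "Delta q X =
     ln X powr (5/2) / real q powr (1/4) * real (divisor_tau q) +
     (real q / X) powr (1/6) * (ln X)\<^sup>2 * real (divisor_tau q) powr (2/3)"

end

theory Submission
  imports Defs "HOL-Analysis.Analysis" "HOL-Computational_Algebra.Squarefree"
begin

text \<open>
  Vaughan's identity with both cut-offs \<open>U \<approx> (X/q)^(1/2)\<close> splits the sum into type I and
  type II parts. Weil's bound is not needed: everything rests on the number \<open>J\<close> of solutions of
  \<open>x\<^sub>1 + x\<^sub>2 \<equiv> x\<^sub>3 + x\<^sub>4\<close>, \<open>1/x\<^sub>1 + 1/x\<^sub>2 \<equiv> 1/x\<^sub>3 + 1/x\<^sub>4\<close> modulo \<open>q\<close>, which is essentially diagonal for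
  every \<open>q\<close>, because the two congruences force \<open>q\<close> to divide \<open>(x\<^sub>1 + x\<^sub>2)(x\<^sub>3 - x\<^sub>1)(x\<^sub>3 - x\<^sub>2)\<close>.

  \<open>J\<close> is the fourth moment of incomplete Kloosterman sums over both parameters. The
  symmetry \<open>K(u/t, vt) = K(u, v)\<close> turns it into the pointwise bound \<open>K \<lesssim> q^(3/4)\<close>, which suffices for the
  type I sums. In the type II sums one meets \<open>K(a(1/x\<^sub>1 - 1/x\<^sub>2), b(x\<^sub>1 - x\<^sub>2))\<close> on average over \<open>x\<^sub>1, x\<^sub>2\<close>: the
  complete sums depend only on \<open>x\<^sub>1/x\<^sub>2\<close> and are of size \<open>q^(1/2)\<close> in mean square, so that multiplicative
  energy controls them, while for the incomplete sums the fourth moment saves \<open>(q/X)^(1/4)\<close>.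
  Finally, \<open>(q/X)^(1/4)\<close> is absorbed by the second term of \<open>\<Delta>\<close>, because \<open>(X/q)^(1/12) \<ge> \<tau>(q)^(1/3) ln q\<close>, unless
  \<open>X \<ge> q\<^sup>2\<close>, when it is at most \<open>q^(-1/4)\<close>.
\<close>

section \<open>Additive characters and collisions\<close>

text \<open>The cut-off (X/q)^(1/2) balances two costs. Completing one type I sum costs q^(3/4) up
  to logarithms and tau(q), and there are up to U^2 pairs (d, e) in the double sum, so U^2 <= X/q
  keeps the total at X q^(-1/4). In the type II sums the pairs with x1 = x2 show no cancellation;
  they are a proportion of at most about 1/U, that is (q/X)^(1/2), and the square root undoing
  Cauchy-Schwarz turns this into (q/X)^(1/4), which is also what the incomplete sums cost. The
  obstacle for composite q is that a(1/x1 - 1/x2) and b(x1 - x2) may share factors with q, where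
  pointwise bounds degenerate. Moments over all parameters (u, v) contain these degenerate values
  and replace a case distinction by gcds. The price is powers of tau(q): two for the ways of
  distributing q over three factors, and one for q/phi(q). The strong lower bound for X is spent in
  the final comparison with Delta.\<close>

lemma norm_e_mod [simp]: "norm (e_mod q u) = 1"
proof -
  have "2 * of_real pi * \<i> * of_int u / of_nat q = \<i> * complex_of_real (2 * pi * of_int u / of_nat q)"
    by simp
  then show ?thesis
    unfolding e_mod_def by (simp only: norm_exp_i_times)
qed

lemma e_mod_0 [simp]: "e_mod q 0 = 1"
  by (simp add: e_mod_def)

lemma e_mod_add: "e_mod q (u + v) = e_mod q u * e_mod q v"
  by (simp add: e_mod_def algebra_simps add_divide_distrib exp_add)

lemma e_mod_minus: "e_mod q (- u) = cnj (e_mod q u)"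
proof -
  have "e_mod q (- u) * e_mod q u = 1"
    by (simp flip: e_mod_add)
  moreover have "cnj (e_mod q u) * e_mod q u = 1"
    by (metis complex_norm_square mult.commute norm_e_mod of_real_1 power_one)
  ultimately show ?thesis
    by (metis mult_cancel_right mult_zero_right zero_neq_one)
qed

lemma e_mod_diff: "e_mod q (u - v) = e_mod q u * cnj (e_mod q v)"
  using e_mod_add[of q u "- v"] by (simp add: e_mod_minus)

lemma e_mod_power: "e_mod q u ^ k = e_mod q (int k * u)"
  by (induction k) (simp_all add: e_mod_add algebra_simps)

lemma e_mod_eq_1_iff:
  assumes "q > 0"
  shows "e_mod q u = 1 \<longleftrightarrow> int q dvd u"
proof -
  have "2 * of_real pi * \<i> * of_int u / of_nat q = \<i> * complex_of_real (2 * pi * of_int u / of_nat q)"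
    by simp
  then have "e_mod q u = 1 \<longleftrightarrow> (\<exists>n::int. 2 * pi * of_int u / of_nat q = 2 * of_int n * pi)"
    unfolding e_mod_def by (simp only: exp_eq_1) simp
  also have "\<dots> \<longleftrightarrow> (\<exists>n::int. real_of_int u = of_int (n * int q))"
    using assms by (auto simp: field_simps)
  also have "\<dots> \<longleftrightarrow> int q dvd u"
    unfolding of_int_eq_iff by (auto simp: dvd_def mult.commute)
  finally show ?thesis .
qed

lemma e_mod_cong:
  assumes "[u = v] (mod int q)" "q > 0"
  shows "e_mod q u = e_mod q v"
proof -
  have "e_mod q (u - v) = 1"
    using assms by (simp add: e_mod_eq_1_iff cong_iff_dvd_diff)
  then show ?thesis
    by (metis diff_add_cancel e_mod_add mult_1)
qed

lemma sum_e_mod: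
  assumes "q > 0"
  shows "(\<Sum>u<q. e_mod q (int u * t)) = (if int q dvd t then of_nat q else 0)"
proof (cases "int q dvd t")
  case True
  then have "e_mod q (int u * t) = 1" for u
    using assms by (simp add: e_mod_eq_1_iff)
  then show ?thesis using True by simp
next
  case False
  then have "e_mod q t \<noteq> 1"
    using assms by (simp add: e_mod_eq_1_iff)
  then have "(\<Sum>u<q. e_mod q t ^ u) = (e_mod q t ^ q - 1) / (e_mod q t - 1)"
    by (simp add: geometric_sum)
  also have "e_mod q t ^ q = 1"
    using assms by (simp add: e_mod_power e_mod_eq_1_iff)
  finally show ?thesis
    using False by (simp add: e_mod_power)
qed

text \<open>Orthogonality in both frequencies leaves exactly the pairs that agree in both
  coordinates. The index set is arbitrary so that it can consist of pairs (x1, x2): the second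
  moment here is then a fourth moment of Kloosterman sums.\<close>

lemma parseval_e_mod:
  fixes f g :: "'a \<Rightarrow> int"
  assumes "finite \<Omega>" "q > 0"
  shows "(\<Sum>u<q. \<Sum>v<q. (norm (\<Sum>w\<in>\<Omega>. e_mod q (int u * f w + int v * g w)))\<^sup>2)
    = real q ^ 2 * real (card {(w, w') \<in> \<Omega> \<times> \<Omega>. [f w = f w'] (mod int q) \<and> [g w = g w'] (mod int q)})"
proof -
  let ?e = "e_mod q"
  have "complex_of_real (\<Sum>u<q. \<Sum>v<q. (norm (\<Sum>w\<in>\<Omega>. ?e (int u * f w + int v * g w)))\<^sup>2)
    = (\<Sum>u<q. \<Sum>v<q. (\<Sum>w\<in>\<Omega>. ?e (int u * f w + int v * g w)) * cnj (\<Sum>w\<in>\<Omega>. ?e (int u * f w + int v * g w)))"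
    by (simp only: of_real_sum complex_norm_square)
  also have "\<dots> = (\<Sum>u<q. \<Sum>v<q. \<Sum>w\<in>\<Omega>. \<Sum>w'\<in>\<Omega>. ?e (int u * (f w - f w')) * ?e (int v * (g w - g w')))"
    by (simp add: sum_product e_mod_add e_mod_diff right_diff_distrib mult_ac)
  also have "\<dots> = (\<Sum>w\<in>\<Omega>. \<Sum>w'\<in>\<Omega>. \<Sum>u<q. \<Sum>v<q. ?e (int u * (f w - f w')) * ?e (int v * (g w - g w')))"
  proof -
    have "(\<Sum>u<q. \<Sum>v<q. \<Sum>w\<in>\<Omega>. \<Sum>w'\<in>\<Omega>. h u v w w') = (\<Sum>w\<in>\<Omega>. \<Sum>w'\<in>\<Omega>. \<Sum>u<q. \<Sum>v<q. h u v w w')"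
      for h :: "nat \<Rightarrow> nat \<Rightarrow> 'a \<Rightarrow> 'a \<Rightarrow> complex"
    proof -
      have "(\<Sum>u<q. \<Sum>v<q. \<Sum>w\<in>\<Omega>. \<Sum>w'\<in>\<Omega>. h u v w w') = (\<Sum>u<q. \<Sum>w\<in>\<Omega>. \<Sum>v<q. \<Sum>w'\<in>\<Omega>. h u v w w')"
        by (intro sum.cong refl) (rule sum.swap)
      also have "\<dots> = (\<Sum>w\<in>\<Omega>. \<Sum>u<q. \<Sum>w'\<in>\<Omega>. \<Sum>v<q. h u v w w')"
        by (subst sum.swap, intro sum.cong refl, rule sum.swap)
      also have "\<dots> = (\<Sum>w\<in>\<Omega>. \<Sum>w'\<in>\<Omega>. \<Sum>u<q. \<Sum>v<q. h u v w w')"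
        by (intro sum.cong refl, rule sum.swap)
      finally show ?thesis .
    qed
    then show ?thesis .
  qed
  also have "\<dots> = (\<Sum>w\<in>\<Omega>. \<Sum>w'\<in>\<Omega>. (\<Sum>u<q. ?e (int u * (f w - f w'))) * (\<Sum>v<q. ?e (int v * (g w - g w'))))"
    by (simp add: sum_product)
  also have "\<dots> = (\<Sum>w\<in>\<Omega>. \<Sum>w'\<in>\<Omega>. if [f w = f w'] (mod int q) \<and> [g w = g w'] (mod int q) then of_nat q ^ 2 else 0)"
    by (intro sum.cong refl) (auto simp: sum_e_mod assms cong_iff_dvd_diff power2_eq_square)
  also have "\<dots> = (\<Sum>p\<in>\<Omega> \<times> \<Omega>. if [f (fst p) = f (snd p)] (mod int q) \<and> [g (fst p) = g (snd p)] (mod int q) then of_nat q ^ 2 else 0)"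
    by (simp add: sum.cartesian_product split_def)
  also have "\<dots> = of_nat q ^ 2 * of_nat (card {p \<in> \<Omega> \<times> \<Omega>. [f (fst p) = f (snd p)] (mod int q) \<and> [g (fst p) = g (snd p)] (mod int q)})"
    using assms by (simp add: sum.If_cases Int_def)
  also have "{p \<in> \<Omega> \<times> \<Omega>. [f (fst p) = f (snd p)] (mod int q) \<and> [g (fst p) = g (snd p)] (mod int q)}
     = {(w, w') \<in> \<Omega> \<times> \<Omega>. [f w = f w'] (mod int q) \<and> [g w = g w'] (mod int q)}"
    by auto
  finally have "complex_of_real (\<Sum>u<q. \<Sum>v<q. (norm (\<Sum>w\<in>\<Omega>. ?e (int u * f w + int v * g w)))\<^sup>2)
     = complex_of_real (real q ^ 2 * real (card {(w, w') \<in> \<Omega> \<times> \<Omega>. [f w = f w'] (mod int q) \<and> [g w = g w'] (mod int q)}))"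
    by simp
  then show ?thesis
    by (simp only: of_real_eq_iff)
qed

text \<open>Cauchy-Schwarz after grouping by the value of \<open>\<kappa>\<close>: the squared
  multiplicities add up to the number of collisions. When H is a squared Kloosterman sum, the second
  factor is a fourth moment.\<close>

lemma sum_le_sqrt_collisions:
  fixes H :: "'b \<Rightarrow> real"
  assumes "finite \<Omega>" "finite T" "\<kappa> ` \<Omega> \<subseteq> T"
  shows "(\<Sum>w\<in>\<Omega>. H (\<kappa> w)) \<le> sqrt (card {(w, w') \<in> \<Omega> \<times> \<Omega>. \<kappa> w = \<kappa> w'}) * sqrt (\<Sum>t\<in>T. (H t)\<^sup>2)"
proof -
  define \<nu> where "\<nu> t = real (card {w\<in>\<Omega>. \<kappa> w = t})" for t
  have "(\<Sum>w\<in>\<Omega>. H (\<kappa> w)) = (\<Sum>t\<in>T. \<Sum>w\<in>{w\<in>\<Omega>. \<kappa> w = t}. H (\<kappa> w))"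
    using assms by (rule sum.group[symmetric])
  also have "\<dots> = (\<Sum>t\<in>T. \<nu> t * H t)"
    by (intro sum.cong refl) (simp add: \<nu>_def)
  also have "\<dots> \<le> sqrt ((\<Sum>t\<in>T. (\<nu> t)\<^sup>2) * (\<Sum>t\<in>T. (H t)\<^sup>2))"
    by (rule real_le_rsqrt) (rule Cauchy_Schwarz_ineq_sum)
  also have "(\<Sum>t\<in>T. (\<nu> t)\<^sup>2) = real (card {(w, w') \<in> \<Omega> \<times> \<Omega>. \<kappa> w = \<kappa> w'})"
  proof -
    have "(\<Sum>t\<in>T. (\<nu> t)\<^sup>2) = (\<Sum>t\<in>T. \<Sum>w\<in>{w\<in>\<Omega>. \<kappa> w = t}. \<nu> (\<kappa> w))"
      by (intro sum.cong refl) (simp add: \<nu>_def power2_eq_square)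
    also have "\<dots> = (\<Sum>w\<in>\<Omega>. \<nu> (\<kappa> w))"
      using assms by (rule sum.group)
    also have "\<dots> = real (card (SIGMA w:\<Omega>. {w'\<in>\<Omega>. \<kappa> w' = \<kappa> w}))"
      unfolding \<nu>_def using assms(1) by (subst card_SigmaI) auto
    also have "(SIGMA w:\<Omega>. {w'\<in>\<Omega>. \<kappa> w' = \<kappa> w}) = {(w, w') \<in> \<Omega> \<times> \<Omega>. \<kappa> w = \<kappa> w'}"
      by auto
    finally show ?thesis .
  qed
  finally show ?thesis
    by (simp add: real_sqrt_mult)
qed

section \<open>Fourth moments of incomplete Kloosterman sums\<close>

lemma card_le_nested:
  fixes k :: real
  assumes "finite A" "S \<subseteq> A \<times> B" "finite B" "\<And>x. x \<in> A \<Longrightarrow> real (card {y. (x, y) \<in> S}) \<le> k"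
  shows "real (card S) \<le> real (card A) * k"
proof -
  have fin: "finite {y. (x, y) \<in> S}" for x
    by (rule finite_subset[OF _ assms(3)]) (use assms(2) in auto)
  have S: "S = (SIGMA x:A. {y. (x, y) \<in> S})"
    using assms(2) by auto
  have "card S = (\<Sum>x\<in>A. card {y. (x, y) \<in> S})"
    by (subst S, rule card_SigmaI) (use assms(1) fin in auto)
  then have "real (card S) = (\<Sum>x\<in>A. real (card {y. (x, y) \<in> S}))"
    by simp
  also have "\<dots> \<le> (\<Sum>x\<in>A. k)"
    by (intro sum_mono assms(4))
  finally show ?thesis by simp
qed

text \<open>Cut the window into blocks of m consecutive integers. A residue class meets each block
  at most once, so the block number is injective on T.\<close>

lemma card_congruent_le:
  assumes "T \<subseteq> {P<..P + L}" "m \<ge> 1" "\<And>x y. x \<in> T \<Longrightarrow> y \<in> T \<Longrightarrow> int m dvd int x - int y"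
  shows "real (card T) \<le> real L / real m + 1"
proof (cases "L = 0")
  case True
  then show ?thesis using assms(1) by simp
next
  case False
  have "inj_on (\<lambda>x. (x - P - 1) div m) T"
  proof (rule inj_onI)
    fix x y assume xy: "x \<in> T" "y \<in> T" "(x - P - 1) div m = (y - P - 1) div m"
    have "int m dvd int (x - P - 1) - int (y - P - 1)"
    proof -
      have "int (x - P - 1) - int (y - P - 1) = int x - int y"
        using subsetD[OF assms(1) xy(1)] subsetD[OF assms(1) xy(2)] by (simp add: of_nat_diff)
      then show ?thesis using assms(3) xy by simp
    qed
    then have "[x - P - 1 = y - P - 1] (mod m)"
      by (simp add: cong_iff_dvd_diff flip: cong_int_iff)
    then have "x - P - 1 = y - P - 1"
      unfolding Cong.cong_def using xy(3)
      by (rule_tac trans[OF mult_div_mod_eq[symmetric, of _ m] trans[OF _ mult_div_mod_eq[of m]]]) (simp only:)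
    then show "x = y"
      using subsetD[OF assms(1) xy(1)] subsetD[OF assms(1) xy(2)]
      unfolding greaterThanAtMost_iff by linarith
  qed
  moreover have "(\<lambda>x. (x - P - 1) div m) ` T \<subseteq> {..(L - 1) div m}"
  proof (rule image_subsetI)
    fix x assume "x \<in> T"
    then have "x - P - 1 \<le> L - 1"
      using subsetD[OF assms(1), of x] unfolding greaterThanAtMost_iff by linarith
    then show "(x - P - 1) div m \<in> {..(L - 1) div m}"
      by (simp add: div_le_mono)
  qed
  ultimately have "card T \<le> card {..(L - 1) div m}"
    by (rule card_inj_on_le) auto
  then have "card T \<le> (L - 1) div m + 1" by simp
  also have "\<dots> \<le> L div m + 1"
    by (simp add: div_le_mono)
  finally have "real (card T) \<le> real (L div m) + 1"
    by linarith
  then show ?thesis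
    using of_nat_div_le_of_nat[of L m, where ?'a = real] by linarith
qed

lemma sum_periodic_reindex:
  fixes G :: "int \<Rightarrow> 'a::comm_monoid_add"
  assumes "q > 0" "\<And>x y. [x = y] (mod int q) \<Longrightarrow> G x = G y" "coprime c (int q)"
  shows "(\<Sum>v<q. G (c * int v + h)) = (\<Sum>v<q. G (int v))"
proof -
  let ?f = "\<lambda>v. nat ((c * int v + h) mod int q)"
  have "inj_on ?f {..<q}"
  proof (rule inj_onI)
    fix x y assume xy: "x \<in> {..<q}" "y \<in> {..<q}" "?f x = ?f y"
    then have "[c * int x + h = c * int y + h] (mod int q)"
      using assms(1) by (simp add: eq_nat_nat_iff) (simp add: Cong.cong_def)
    then have "[c * int x = c * int y] (mod int q)"
      by (simp only: cong_add_rcancel)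
    then have "[int x = int y] (mod int q)"
      using assms(3) by (simp add: cong_mult_lcancel)
    then show "x = y" using xy by (simp add: cong_int_iff Cong.cong_def)
  qed
  moreover have "?f ` {..<q} \<subseteq> {..<q}"
    using assms(1) by (auto simp: nat_less_iff)
  ultimately have bij: "bij_betw ?f {..<q} {..<q}"
    by (simp add: bij_betw_def endo_inj_surj)
  have "(\<Sum>v<q. G (c * int v + h)) = (\<Sum>v<q. G (int (?f v)))"
    using assms(1) by (intro sum.cong refl assms(2)) (simp add: Cong.cong_def)
  also have "\<dots> = (\<Sum>v<q. G (int v))"
    by (rule sum.reindex_bij_betw[OF bij])
  finally show ?thesis .
qed

section \<open>Incomplete Kloosterman sums to a fixed modulus\<close>

locale kl_modulus =
  fixes q :: nat
  assumes q_gt_1: "q > 1"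
begin

definition iv :: "nat \<Rightarrow> int" where
  "iv n = modular_inverse (int q) (int n)"

definition un :: "nat set \<Rightarrow> nat set" where
  "un A = {n \<in> A. coprime n q}"

text \<open>An incomplete Kloosterman sum in general; for A = {0<..q} it is the classical complete
  sum K(u, v).\<close>

definition kS :: "nat set \<Rightarrow> int \<Rightarrow> int \<Rightarrow> complex" where
  "kS A u v = (\<Sum>n\<in>un A. e_mod q (u * iv n + v * int n))"

definition eqnJ :: "nat \<Rightarrow> nat \<Rightarrow> nat \<Rightarrow> nat \<Rightarrow> bool" where
  "eqnJ x1 x2 x3 x4 \<longleftrightarrow> [iv x1 + iv x2 = iv x3 + iv x4] (mod int q) \<and>
     [int x1 + int x2 = int x3 + int x4] (mod int q)"

text \<open>The additive energy of the points (1/x, x) modulo q. Quadruples are stored as pairs of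
  pairs to match the collision sets of \<open>parseval_e_mod\<close> and
  \<open>sum_le_sqrt_collisions\<close>.\<close>

definition J :: "nat set \<Rightarrow> nat" where
  "J A = card {((x1, x2), (x3, x4)) \<in> (un A \<times> un A) \<times> (un A \<times> un A). eqnJ x1 x2 x3 x4}"

lemma q_pos [simp]: "q > 0" using q_gt_1 by simp

lemma finite_un [simp]: "finite A \<Longrightarrow> finite (un A)"
  by (simp add: un_def)

lemma iv_cong: "coprime n q \<Longrightarrow> [int n * iv n = 1] (mod int q)"
  by (simp add: iv_def cong_modular_inverse1)

lemma iv_cong_unique:
  assumes "coprime n q" "[int n * y = 1] (mod int q)"
  shows "[y = iv n] (mod int q)"
proof -
  have "[int n * y = int n * iv n] (mod int q)"
    using assms iv_cong by (metis cong_sym cong_trans)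
  then show ?thesis
    using assms(1) by (simp add: cong_mult_lcancel)
qed

lemma iv_cong_mult:
  assumes "coprime m q" "coprime n q" "[int m * int n = int k] (mod int q)"
  shows "[iv k = iv m * iv n] (mod int q)"
proof -
  have "coprime k q"
    using assms by (metis cong_imp_coprime coprime_mult_left_iff coprime_int_iff of_nat_mult)
  moreover have "[int k * (iv m * iv n) = 1] (mod int q)"
  proof -
    have "[int k * (iv m * iv n) = (int m * int n) * (iv m * iv n)] (mod int q)"
      using assms(3) by (intro cong_mult cong_refl) (rule cong_sym)
    also have "(int m * int n) * (iv m * iv n) = (int m * iv m) * (int n * iv n)"
      by simp
    also have "[\<dots> = 1 * 1] (mod int q)"
      by (intro cong_mult iv_cong assms)
    finally show ?thesis by simp
  qed
  ultimately show ?thesis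
    using iv_cong_unique cong_sym by blast
qed

lemma iv_cong_cong:
  assumes "coprime m q" "[m = n] (mod q)"
  shows "[iv m = iv n] (mod int q)"
proof -
  have "coprime n q"
    using assms by (metis cong_imp_coprime)
  moreover have "[int n * iv m = int m * iv m] (mod int q)"
    using assms(2) by (intro cong_mult cong_refl) (simp add: cong_int_iff cong_sym_eq)
  then have "[int n * iv m = 1] (mod int q)"
    using iv_cong[OF assms(1)] cong_trans by blast
  ultimately show ?thesis
    by (rule iv_cong_unique)
qed

lemma kS_cong:
  assumes "[u = u'] (mod int q)" "[v = v'] (mod int q)"
  shows "kS A u v = kS A u' v'"
  unfolding kS_def
proof (rule sum.cong[OF refl])
  fix n
  have "[u * iv n + v * int n = u' * iv n + v' * int n] (mod int q)"
    using assms by (intro cong_add cong_scalar_right)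
  then show "e_mod q (u * iv n + v * int n) = e_mod q (u' * iv n + v' * int n)"
    by (rule e_mod_cong) simp
qed

text \<open>The square of \<open>kS\<close> is an exponential sum over pairs, so its fourth power
  falls under \<open>parseval_e_mod\<close>. The shift h disappears on summing v over a full period;
  it is carried along because completing an incomplete sum moves the second argument.\<close>

lemma fourth_moment:
  assumes "finite A"
  shows "(\<Sum>u<q. \<Sum>v<q. norm (kS A (int u) (int v + h)) ^ 4) = real q ^ 2 * real (J A)"
proof -
  have "(\<Sum>v<q. norm (kS A (int u) (int v + h)) ^ 4) = (\<Sum>v<q. norm (kS A (int u) (int v)) ^ 4)" for u
    using sum_periodic_reindex[OF q_pos, of "\<lambda>v. norm (kS A (int u) v) ^ 4" 1 h]
    by (metis (no_types, lifting) cong_refl coprime_1_left kS_cong mult_1 sum.cong)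
  then have "(\<Sum>u<q. \<Sum>v<q. norm (kS A (int u) (int v + h)) ^ 4)
    = (\<Sum>u<q. \<Sum>v<q. norm (kS A (int u) (int v)) ^ 4)"
    by simp
  also have "\<dots> = (\<Sum>u<q. \<Sum>v<q. (norm (\<Sum>w\<in>un A \<times> un A.
      e_mod q (int u * (iv (fst w) + iv (snd w)) + int v * (int (fst w) + int (snd w)))))\<^sup>2)"
  proof (intro sum.cong refl)
    fix u v
    have "(kS A (int u) (int v))\<^sup>2 = (\<Sum>w\<in>un A \<times> un A.
      e_mod q (int u * (iv (fst w) + iv (snd w)) + int v * (int (fst w) + int (snd w))))"
      by (simp add: kS_def power2_eq_square sum_product sum.cartesian_product split_def
          e_mod_add distrib_left mult_ac)
    then show "norm (kS A (int u) (int v)) ^ 4 = (norm (\<Sum>w\<in>un A \<times> un A.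
      e_mod q (int u * (iv (fst w) + iv (snd w)) + int v * (int (fst w) + int (snd w)))))\<^sup>2"
      by (metis norm_power power_mult numeral_Bit0 mult_2)
  qed
  also have "\<dots> = real q ^ 2 * real (J A)"
    unfolding J_def using assms
    by (subst parseval_e_mod) (auto simp: eqnJ_def intro!: arg_cong[where f = card])
  finally show ?thesis .
qed

text \<open>The parameters (a(1/x1 - 1/x2), b(x1 - x2)) are averaged over all pairs (u, v) modulo q,
  weighted by how often they occur. As a and b are units, the collisions of these parameters are
  again counted by \<open>J A\<close>, while the fourth moment contributes
  \<open>J B\<close>.\<close>

lemma sum_kS_sq_le:
  assumes "finite A" "finite B" "coprime a (int q)" "coprime b (int q)"
  shows "(\<Sum>(x1, x2)\<in>un A \<times> un A. (norm (kS B (a * (iv x1 - iv x2)) (b * (int x1 - int x2) + h)))\<^sup>2)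
    \<le> real q * sqrt (real (J A) * real (J B))"
proof -
  define f where "f w = a * (iv (fst w) - iv (snd w))" for w :: "nat \<times> nat"
  define g where "g w = b * (int (fst w) - int (snd w))" for w :: "nat \<times> nat"
  define \<kappa> where "\<kappa> w = (nat (f w mod int q), nat (g w mod int q))" for w
  define H where "H p = (norm (kS B (int (fst p)) (int (snd p) + h)))\<^sup>2" for p
  have "(\<Sum>(x1, x2)\<in>un A \<times> un A. (norm (kS B (a * (iv x1 - iv x2)) (b * (int x1 - int x2) + h)))\<^sup>2)
    = (\<Sum>w\<in>un A \<times> un A. H (\<kappa> w))"
  proof (intro sum.cong refl)
    fix w
    have "kS B (f w) (g w + h) = kS B (int (nat (f w mod int q))) (int (nat (g w mod int q)) + h)"
      by (intro kS_cong cong_add cong_refl) (simp_all add: Cong.cong_def)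
    then show "(case w of (x1, x2) \<Rightarrow> (norm (kS B (a * (iv x1 - iv x2)) (b * (int x1 - int x2) + h)))\<^sup>2) = H (\<kappa> w)"
      by (simp add: H_def \<kappa>_def f_def g_def split_def)
  qed
  also have "\<dots> \<le> sqrt (card {(w, w') \<in> (un A \<times> un A) \<times> (un A \<times> un A). \<kappa> w = \<kappa> w'})
      * sqrt (\<Sum>t\<in>{..<q} \<times> {..<q}. (H t)\<^sup>2)"
    using assms by (intro sum_le_sqrt_collisions) (auto simp: \<kappa>_def nat_less_iff)
  also have "(\<Sum>t\<in>{..<q} \<times> {..<q}. (H t)\<^sup>2) = real q ^ 2 * real (J B)"
    unfolding fourth_moment[OF assms(2), of h, symmetric] H_def
    by (simp add: sum.cartesian_product split_def flip: power_mult)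
  also have "card {(w, w') \<in> (un A \<times> un A) \<times> (un A \<times> un A). \<kappa> w = \<kappa> w'} = J A"
    unfolding J_def
  \<comment> \<open>Exchanging the second entries turns an equality of differences, x1 - x2 = y1 -
    y2, into one of sums, x1 + y2 = y1 + x2.\<close>
  proof (rule bij_betw_same_card[of "\<lambda>((x1, x2), (y1, y2)). ((x1, y2), (y1, x2))"])
    have *: "\<kappa> (x1, x2) = \<kappa> (y1, y2) \<longleftrightarrow> eqnJ x1 y2 y1 x2" for x1 x2 y1 y2
    proof -
      have "\<kappa> (x1, x2) = \<kappa> (y1, y2) \<longleftrightarrow> [f (x1, x2) = f (y1, y2)] (mod int q) \<and> [g (x1, x2) = g (y1, y2)] (mod int q)"
        by (simp add: \<kappa>_def Cong.cong_def eq_nat_nat_iff)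
      also have "\<dots> \<longleftrightarrow> [iv x1 - iv x2 = iv y1 - iv y2] (mod int q) \<and> [int x1 - int x2 = int y1 - int y2] (mod int q)"
        using assms by (simp add: f_def g_def cong_mult_lcancel)
      also have "\<dots> \<longleftrightarrow> eqnJ x1 y2 y1 x2"
        by (simp add: eqnJ_def cong_iff_dvd_diff algebra_simps)
      finally show ?thesis .
    qed
    show "bij_betw (\<lambda>((x1, x2), (y1, y2)). ((x1, y2), (y1, x2)))
     {(w, w') \<in> (un A \<times> un A) \<times> (un A \<times> un A). \<kappa> w = \<kappa> w'}
     {((x1, x2), (x3, x4)) \<in> (un A \<times> un A) \<times> (un A \<times> un A). eqnJ x1 x2 x3 x4}"
      by (rule bij_betwI[where g = "\<lambda>((x1, x2), (y1, y2)). ((x1, y2), (y1, x2))"]) (auto simp: *)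
  qed
  finally show ?thesis
    by (simp add: real_sqrt_mult mult_ac)
qed

text \<open>Put s = x1 + x2. Multiplying the congruence of inverses by x1 x2 x3 x4 gives s x3 x4 = s
  x1 x2 modulo q. With x4 = s - x3 the difference x3 x4 - x1 x2 is -(x3 - x1)(x3 - x2).\<close>

lemma eqnJ_factor:
  assumes "coprime x1 q" "coprime x2 q" "coprime x3 q" "coprime x4 q" "eqnJ x1 x2 x3 x4"
  shows "int q dvd (int x1 + int x2) * (int x3 - int x1) * (int x3 - int x2)"
proof -
  define X1 X2 X3 X4 where "X1 = int x1" "X2 = int x2" "X3 = int x3" "X4 = int x4"
  define Y1 Y2 Y3 Y4 where "Y1 = iv x1" "Y2 = iv x2" "Y3 = iv x3" "Y4 = iv x4"
  note defs = X1_X2_X3_X4_def Y1_Y2_Y3_Y4_def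
  obtain n where n: "X1 + X2 = X3 + X4 + int q * n"
    using assms(5) unfolding eqnJ_def defs by (metis cong_iff_lin cong_sym)
  have "[(Y1 + Y2) * (X1 * X2 * X3 * X4) = (Y3 + Y4) * (X1 * X2 * X3 * X4)] (mod int q)"
    using assms(5) unfolding eqnJ_def defs by (intro cong_mult cong_refl) auto
  moreover have "[(Y1 + Y2) * (X1 * X2 * X3 * X4) = (X1 + X2) * (X3 * X4)] (mod int q)"
  proof -
    have "(Y1 + Y2) * (X1 * X2 * X3 * X4) = (X1 * Y1) * (X2 * X3 * X4) + (X2 * Y2) * (X1 * X3 * X4)"
      by (simp add: algebra_simps)
    also have "[\<dots> = 1 * (X2 * X3 * X4) + 1 * (X1 * X3 * X4)] (mod int q)"
      using iv_cong assms by (intro cong_add cong_mult cong_refl) (simp_all add: defs)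
    finally show ?thesis by (simp add: algebra_simps)
  qed
  moreover have "[(Y3 + Y4) * (X1 * X2 * X3 * X4) = (X3 + X4) * (X1 * X2)] (mod int q)"
  proof -
    have "(Y3 + Y4) * (X1 * X2 * X3 * X4) = (X3 * Y3) * (X1 * X2 * X4) + (X4 * Y4) * (X1 * X2 * X3)"
      by (simp add: algebra_simps)
    also have "[\<dots> = 1 * (X1 * X2 * X4) + 1 * (X1 * X2 * X3)] (mod int q)"
      using iv_cong assms by (intro cong_add cong_mult cong_refl) (simp_all add: defs)
    finally show ?thesis by (simp add: algebra_simps)
  qed
  ultimately have "[(X1 + X2) * (X3 * X4) = (X3 + X4) * (X1 * X2)] (mod int q)"
    by (meson cong_sym cong_trans)
  then obtain l where l: "(X1 + X2) * (X3 * X4) = (X3 + X4) * (X1 * X2) + int q * l"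
    by (metis cong_iff_lin cong_sym)
  have X4: "X4 = X1 + X2 - X3 - int q * n"
    using n by simp
  have "(X1 + X2) * (X3 - X1) * (X3 - X2) + int q * (n * X3 * (X1 + X2) - n * X1 * X2)
    = (X3 + X4) * (X1 * X2) - (X1 + X2) * (X3 * X4)"
    unfolding X4 by (simp add: algebra_simps)
  then have "(X1 + X2) * (X3 - X1) * (X3 - X2) = int q * (n * X1 * X2 - n * X3 * (X1 + X2) - l)"
    unfolding l by (simp add: algebra_simps)
  then show ?thesis
    unfolding defs by simp
qed

end

section \<open>Counting solutions of congruences\<close>

lemma dvd_mult_split:
  fixes a b :: int
  assumes "int n dvd a * b" "n > 0"
  obtains d where "d dvd n" "int d dvd a" "int (n div d) dvd b"
proof -
  obtain u v where uv: "int n = u * v" "u dvd a" "v dvd b"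
    using division_decomp[OF assms(1)] by blast
  have n: "n = nat \<bar>u\<bar> * nat \<bar>v\<bar>"
    using uv(1) by (metis abs_mult abs_of_nat nat_abs_mult_distrib nat_int)
  show ?thesis
  proof (rule that[of "nat \<bar>u\<bar>"])
    show "nat \<bar>u\<bar> dvd n" using n by simp
    show "int (nat \<bar>u\<bar>) dvd a" using uv by simp
    show "int (n div nat \<bar>u\<bar>) dvd b"
    proof -
      have "n div nat \<bar>u\<bar> = nat \<bar>v\<bar>"
        using n assms(2) by (metis mult_eq_0_iff nonzero_mult_div_cancel_left not_gr_zero)
      then show ?thesis using uv by simp
    qed
  qed
qed

section \<open>Harmonic sums and averages of divisors and gcds\<close>

lemma harm_le_1_plus_ln: "n \<ge> 1 \<Longrightarrow> harm n \<le> 1 + ln (real n)"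
proof (induction n rule: nat_induct_at_least)
  case base
  then show ?case by (simp add: harm_def)
next
  case (Suc n)
  have "ln (real n / real (Suc n)) \<le> real n / real (Suc n) - 1"
    using Suc by (intro ln_le_minus_one) auto
  also have "\<dots> = - (1 / real (Suc n))"
    by (simp add: field_simps)
  also have "ln (real n / real (Suc n)) = ln (real n) - ln (real (Suc n))"
    using Suc by (simp add: ln_div)
  finally have "1 / real (Suc n) \<le> ln (real (Suc n)) - ln (real n)"
    by simp
  then show ?case using Suc by (simp add: harm_Suc inverse_eq_divide)
qed

lemma sum_inverse_atMost_le:
  assumes "n \<ge> 1"
  shows "(\<Sum>d\<in>{0<..n}. 1 / real d) \<le> 1 + ln (real n)"
proof -
  have "{0<..n} = {1..n}" by auto
  then show ?thesis
    using harm_le_1_plus_ln[OF assms] by (simp add: harm_def inverse_eq_divide)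
qed

lemma sum_divisor_tau_le:
  assumes "Z \<ge> 1"
  shows "(\<Sum>x\<in>{0<..Z}. real (divisor_tau x)) \<le> real Z * (1 + ln (real Z))"
proof -
  have mult: "real (card {x\<in>{0<..Z}. d dvd x}) \<le> real Z / real d" if "d > 0" for d
  proof -
    have "{x\<in>{0<..Z}. d dvd x} \<subseteq> (\<lambda>k. d * k) ` {0<..Z div d}"
      using that by (auto simp: dvd_def less_eq_div_iff_mult_less_eq mult.commute)
    then have "card {x\<in>{0<..Z}. d dvd x} \<le> Z div d"
      by (metis card_greaterThanAtMost diff_zero finite_greaterThanAtMost surj_card_le)
    then show ?thesis
      using of_nat_div_le_of_nat[of Z d, where ?'a = real] by linarith
  qed
  have "real (divisor_tau x) = (\<Sum>d\<in>{0<..Z}. if d dvd x then 1 else 0)" if "x \<in> {0<..Z}" for x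
  proof -
    have eq: "{d. d dvd x} = {d\<in>{0<..Z}. d dvd x}"
      using that by (auto dest: dvd_imp_le intro: dvd_pos_nat)
    have "real (card {d\<in>{0<..Z}. d dvd x}) = (\<Sum>d\<in>{0<..Z}. if d dvd x then 1 else 0)"
      by (simp add: sum.If_cases Int_def)
    then show ?thesis
      by (simp only: divisor_tau_def eq)
  qed
  then have "(\<Sum>x\<in>{0<..Z}. real (divisor_tau x)) = (\<Sum>x\<in>{0<..Z}. \<Sum>d\<in>{0<..Z}. if d dvd x then 1 else 0)"
    by simp
  also have "\<dots> = (\<Sum>d\<in>{0<..Z}. \<Sum>x\<in>{0<..Z}. if d dvd x then 1 else 0)"
    by (rule sum.swap)
  also have "\<dots> = (\<Sum>d\<in>{0<..Z}. real (card {x\<in>{0<..Z}. d dvd x}))"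
    by (simp add: sum.If_cases Int_def)
  also have "\<dots> \<le> (\<Sum>d\<in>{0<..Z}. real Z / real d)"
    by (intro sum_mono mult) auto
  also have "\<dots> = real Z * (\<Sum>d\<in>{0<..Z}. 1 / real d)"
    by (simp add: sum_distrib_left)
  also have "\<dots> \<le> real Z * (1 + ln (real Z))"
    by (intro mult_left_mono sum_inverse_atMost_le assms) auto
  finally show ?thesis .
qed

text \<open>Bound the gcd by the sum of all common divisors. Each divisor d of x then contributes d
  times the number of its multiples up to x, which is at most x.\<close>

lemma sum_gcd_le:
  assumes "x > 0"
  shows "(\<Sum>y\<in>{0<..x}. real (gcd x y)) \<le> real x * real (divisor_tau x)"
proof -
  have fin: "finite {d. d dvd x}" using assms by simp
  have "real (gcd x y) \<le> (\<Sum>d | d dvd x. if d dvd y then real d else 0)" for y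
    using fin member_le_sum[of "gcd x y" "{d. d dvd x}" "\<lambda>d. if d dvd y then real d else 0"] by simp
  then have "(\<Sum>y\<in>{0<..x}. real (gcd x y)) \<le> (\<Sum>y\<in>{0<..x}. \<Sum>d | d dvd x. if d dvd y then real d else 0)"
    by (intro sum_mono)
  also have "\<dots> = (\<Sum>d | d dvd x. \<Sum>y\<in>{0<..x}. if d dvd y then real d else 0)"
    by (rule sum.swap)
  also have "\<dots> \<le> (\<Sum>d | d dvd x. real x)"
  proof (intro sum_mono)
    fix d assume "d \<in> {d. d dvd x}"
    then have d: "d dvd x" "d > 0" using assms by (auto intro: dvd_pos_nat)
    have "{y\<in>{0<..x}. d dvd y} \<subseteq> (\<lambda>k. d * k) ` {0<..x div d}"
      using d by (auto simp: dvd_def less_eq_div_iff_mult_less_eq mult.commute)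
    then have "card {y\<in>{0<..x}. d dvd y} \<le> x div d"
      by (metis card_greaterThanAtMost diff_zero finite_greaterThanAtMost surj_card_le)
    then have "d * card {y\<in>{0<..x}. d dvd y} \<le> x"
      by (metis d(1) dvd_mult_div_cancel mult_le_mono2)
    then show "(\<Sum>y\<in>{0<..x}. if d dvd y then real d else 0) \<le> real x"
      by (simp add: sum.If_cases Int_def mult.commute flip: of_nat_mult)
  qed
  also have "\<dots> = real x * real (divisor_tau x)"
    by (simp add: divisor_tau_def)
  finally show ?thesis .
qed

text \<open>The ratio gcd/max is the density of the integer points on a line x1 x4 - x2 x3 = const,
  which is how it enters \<open>energy_le\<close>. Splitting by the larger variable reduces the
  double sum to \<open>sum_gcd_le\<close>.\<close>

lemma sum_gcd_div_max_le:
  assumes "Z \<ge> 1"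
  shows "(\<Sum>x\<in>{0<..Z}. \<Sum>y\<in>{0<..Z}. real (gcd x y) / real (max x y)) \<le> 2 * (real Z * (1 + ln (real Z)))"
proof -
  let ?h = "\<lambda>x y. if y \<le> x then real (gcd x y) / real x else 0"
  have "(\<Sum>x\<in>{0<..Z}. \<Sum>y\<in>{0<..Z}. real (gcd x y) / real (max x y))
     \<le> (\<Sum>x\<in>{0<..Z}. \<Sum>y\<in>{0<..Z}. ?h x y + ?h y x)"
    by (intro sum_mono) (auto simp: max_def gcd.commute)
  also have "\<dots> = (\<Sum>x\<in>{0<..Z}. \<Sum>y\<in>{0<..Z}. ?h x y) + (\<Sum>x\<in>{0<..Z}. \<Sum>y\<in>{0<..Z}. ?h y x)"
    by (simp add: sum.distrib)
  also have "(\<Sum>x\<in>{0<..Z}. \<Sum>y\<in>{0<..Z}. ?h y x) = (\<Sum>x\<in>{0<..Z}. \<Sum>y\<in>{0<..Z}. ?h x y)"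
    by (rule sum.swap)
  also have "(\<Sum>x\<in>{0<..Z}. \<Sum>y\<in>{0<..Z}. ?h x y) \<le> (\<Sum>x\<in>{0<..Z}. real (divisor_tau x))"
  proof (intro sum_mono)
    fix x assume x: "x \<in> {0<..Z}"
    have "(\<Sum>y\<in>{0<..Z}. ?h x y) = (\<Sum>y\<in>{0<..x}. real (gcd x y) / real x)"
      using x by (intro sum.mono_neutral_cong_right) auto
    also have "\<dots> = (\<Sum>y\<in>{0<..x}. real (gcd x y)) / real x"
      by (simp add: sum_divide_distrib)
    also have "\<dots> \<le> real x * real (divisor_tau x) / real x"
      using x by (intro divide_right_mono sum_gcd_le) auto
    finally show "(\<Sum>y\<in>{0<..Z}. ?h x y) \<le> real (divisor_tau x)"
      using x by simp
  qed
  finally show ?thesis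
    using sum_divisor_tau_le[OF assms] by linarith
qed

lemma divisor_tau_ge_1: "q > 0 \<Longrightarrow> divisor_tau q \<ge> 1"
  using card_mono[of "{d. d dvd q}" "{1}"] by (simp add: divisor_tau_def)

text \<open>Lets an average over the units, of size \<open>totient q\<close>, be compared with q at
  the cost of one factor tau(q).\<close>

lemma le_divisor_tau_totient: "q \<le> divisor_tau q * totient q"
proof (cases "q = 0")
  case False
  have "q = (\<Sum>d | d dvd q. totient d)"
    by (simp add: totient_divisor_sum)
  also have "\<dots> \<le> (\<Sum>d | d dvd q. totient q)"
    using False by (intro sum_mono totient_dvd_mono) auto
  finally show ?thesis by (simp add: divisor_tau_def)
qed simp

section \<open>Solutions of the two congruences in an interval\<close>

context kl_modulus
begin

text \<open>
  Write \<open>q = d\<^sub>1 d\<^sub>2 d\<^sub>3\<close> with \<open>d\<^sub>1 | x\<^sub>1 + x\<^sub>2\<close>, \<open>d\<^sub>2 | x\<^sub>3 - x\<^sub>1\<close>, \<open>d\<^sub>3 | x\<^sub>3 - x\<^sub>2\<close>. Since \<open>2x\<^sub>3\<close> vanishes modulo \<open>gcd d\<^sub>1 d\<^sub>2 d\<^sub>3\<close>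
  and \<open>x\<^sub>3\<close> is a unit, the three conditions are independent up to a factor \<open>2\<close>.
\<close>
lemma J_le:
  assumes A: "A \<subseteq> {P<..P + L}" and L: "L \<ge> 1"
  shows "real (J A) \<le> 3 * real (divisor_tau q) ^ 2 * (real L ^ 2 * (1 + real L / real q) ^ 2)"
proof -
  \<comment> \<open>The coordinates are ordered as they are counted: x3 is free, x1 is fixed modulo
    lcm(d2, gcd(d1, d3)), x2 modulo lcm(d1, d3), and x4 modulo q.\<close>
  define R where "R d1 d2 = {(x3, x1, x2, x4). x3 \<in> un A \<and> x1 \<in> un A \<and> x2 \<in> un A \<and> x4 \<in> un A \<and>
      int d1 dvd int x1 + int x2 \<and> int d2 dvd int x3 - int x1 \<and> int (q div d1 div d2) dvd int x3 - int x2 \<and>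
      [int x1 + int x2 = int x3 + int x4] (mod int q)}" for d1 d2
  define I where "I = {(d1, d2). d1 dvd q \<and> d2 dvd q div d1}"
  let ?b = "3 * real L * (1 + real L / real q)"
  have finA: "finite A" using A finite_subset by blast
  have unA: "un A \<subseteq> {P<..P + L}" using A by (auto simp: un_def)
  have card_un: "card (un A) \<le> L"
    using card_mono[OF _ unA] by simp
  have R_le: "real (card (R d1 d2)) \<le> real L * (?b * (1 + real L / real q))" if "(d1, d2) \<in> I" for d1 d2
  proof (cases "R d1 d2 = {}")
    case True
    then show ?thesis by simp
  next
    case False
    define d3 where "d3 = q div d1 div d2"
    have q: "q = d1 * d2 * d3"
      using that by (auto simp: I_def d3_def mult.assoc)
    then have pos: "d1 > 0" "d2 > 0" "d3 > 0" using q_pos by (metis mult_is_0 neq0_conv)+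
    define g where "g = gcd d1 d3"
    define l where "l = lcm d2 g"
    define m where "m = lcm d1 d3"
    have pos': "g > 0" "l > 0" "m > 0"
      using pos by (auto simp: g_def l_def m_def lcm_pos_nat)
    obtain x3 x1 x2 x4 where "(x3, x1, x2, x4) \<in> R d1 d2"
      using False by auto
    then have x: "coprime x3 q" "int d1 dvd int x1 + int x2" "int d2 dvd int x3 - int x1" "int d3 dvd int x3 - int x2"
      by (auto simp: R_def un_def d3_def)
    let ?c = "gcd d2 g"
    have "?c dvd 2"
    proof -
      have "?c dvd d1" "?c dvd d2" "?c dvd d3"
        by (auto simp: g_def intro: dvd_trans)
      then have "int ?c dvd int d1" "int ?c dvd int d2" "int ?c dvd int d3"
        by (simp_all only: int_dvd_int_iff)
      then have "int ?c dvd int x1 + int x2" "int ?c dvd int x3 - int x1" "int ?c dvd int x3 - int x2"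
        using x(2-4) dvd_trans by blast+
      then have "int ?c dvd (int x1 + int x2) + (int x3 - int x1) + (int x3 - int x2)"
        by (rule dvd_add[OF dvd_add])
      then have "int ?c dvd int (2 * x3)" by simp
      then have "?c dvd 2 * x3" by (simp only: int_dvd_int_iff)
      moreover have "?c dvd q"
        unfolding q by (meson dvd_mult dvd_mult2 gcd_dvd1)
      then have "coprime ?c x3"
        using x(1) by (metis coprime_commute coprime_divisors dvd_refl)
      ultimately show ?thesis
        by (simp add: coprime_dvd_mult_left_iff)
    qed
    then have c2: "?c \<le> 2" by (simp add: dvd_imp_le)
    \<comment> \<open>Two uses of gcd * lcm = product. After cancelling g, the product l * m equals
      q / \<open>?c\<close>, which is at least q/2.\<close>
    have "l * m * ?c * g = (?c * l) * (g * m)" by simp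
    also have "?c * l = d2 * g" by (simp add: l_def)
    also have "g * m = d1 * d3" by (simp add: g_def m_def)
    finally have "l * m * ?c = q"
      using pos' q by (simp add: mult_ac)
    then have lm: "q \<le> 2 * (l * m)"
      using c2 by (metis mult.commute mult_le_mono2)
    have "real (card (R d1 d2)) \<le> real (card (un A)) * ((real L / real l + 1) * ((real L / real m + 1) * (real L / real q + 1)))"
    proof (rule card_le_nested)
      show "R d1 d2 \<subseteq> un A \<times> (un A \<times> un A \<times> un A)" by (auto simp: R_def)
      show "finite (un A)" "finite (un A \<times> un A \<times> un A)" using finA by auto
      fix x3 assume x3: "x3 \<in> un A"
      \<comment> \<open>The condition modulo g is what remains of the two conditions on x2 when x2
        is eliminated between them.\<close>
      define T1 where "T1 = {x1\<in>un A. int d2 dvd int x3 - int x1 \<and> int g dvd int x1 + int x3}"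
      have "real (card {y. (x3, y) \<in> R d1 d2}) \<le> real (card T1) * ((real L / real m + 1) * (real L / real q + 1))"
      proof (rule card_le_nested)
        show "finite T1" "finite (un A \<times> un A)" using finA by (auto simp: T1_def)
        show "{y. (x3, y) \<in> R d1 d2} \<subseteq> T1 \<times> (un A \<times> un A)"
        proof safe
          fix x1 x2 x4 assume h: "(x3, x1, x2, x4) \<in> R d1 d2"
          have g13: "int g dvd int d1" "int g dvd int d3"
            by (simp_all add: g_def)
          have "int d1 dvd int x1 + int x2" "int d3 dvd int x3 - int x2"
            using h by (simp_all add: R_def d3_def)
          then have "int g dvd int x1 + int x2" "int g dvd int x3 - int x2"
            by (simp_all only: dvd_trans[OF g13(1)] dvd_trans[OF g13(2)])
          then have "int g dvd (int x1 + int x2) + (int x3 - int x2)"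
            by (rule dvd_add)
          then show "x1 \<in> T1" using h by (simp add: R_def T1_def)
        qed (auto simp: R_def)
        fix x1 assume "x1 \<in> T1"
        define T2 where "T2 = {x2\<in>un A. int d1 dvd int x1 + int x2 \<and> int d3 dvd int x3 - int x2}"
        have "real (card {y. (x1, y) \<in> {y. (x3, y) \<in> R d1 d2}}) \<le> real (card T2) * (real L / real q + 1)"
        proof (rule card_le_nested)
          show "finite T2" "finite (un A)" using finA by (auto simp: T2_def)
          show "{y. (x1, y) \<in> {y. (x3, y) \<in> R d1 d2}} \<subseteq> T2 \<times> un A"
            by (auto simp: R_def T2_def d3_def)
          fix x2
          show "real (card {y. (x2, y) \<in> {y. (x1, y) \<in> {y. (x3, y) \<in> R d1 d2}}}) \<le> real L / real q + 1"
          proof (rule card_congruent_le)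
            show "{y. (x2, y) \<in> {y. (x1, y) \<in> {y. (x3, y) \<in> R d1 d2}}} \<subseteq> {P<..P + L}"
              using unA by (auto simp: R_def)
            fix x y assume "x \<in> {y. (x2, y) \<in> {y. (x1, y) \<in> {y. (x3, y) \<in> R d1 d2}}}"
              "y \<in> {y. (x2, y) \<in> {y. (x1, y) \<in> {y. (x3, y) \<in> R d1 d2}}}"
            then have "[int x3 + int x = int x3 + int y] (mod int q)"
              by (auto simp: R_def intro: cong_trans cong_sym)
            then show "int q dvd int x - int y"
              by (simp add: cong_add_lcancel cong_iff_dvd_diff)
          qed (use q_pos in linarith)
        qed
        also have "real (card T2) \<le> real L / real m + 1"
        proof (rule card_congruent_le)
          show "T2 \<subseteq> {P<..P + L}" using unA by (auto simp: T2_def)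
          fix x y assume xy: "x \<in> T2" "y \<in> T2"
          have "int d1 dvd int x1 + int x" "int d1 dvd int x1 + int y"
            "int d3 dvd int x3 - int y" "int d3 dvd int x3 - int x"
            using xy by (simp_all add: T2_def)
          from dvd_diff[OF this(1,2)] dvd_diff[OF this(3,4)] show "int m dvd int x - int y"
            unfolding m_def lcm_int_int_eq[symmetric] by (intro lcm_least) simp_all
        qed (use pos' in linarith)
        finally show "real (card {y. (x1, y) \<in> {y. (x3, y) \<in> R d1 d2}}) \<le> (real L / real m + 1) * (real L / real q + 1)"
          by (simp add: mult_right_mono)
      qed
      also have "real (card T1) \<le> real L / real l + 1"
      proof (rule card_congruent_le)
        show "T1 \<subseteq> {P<..P + L}" using unA by (auto simp: T1_def)
        fix x y assume xy: "x \<in> T1" "y \<in> T1"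
        have "int d2 dvd int x3 - int y" "int d2 dvd int x3 - int x"
          "int g dvd int x + int x3" "int g dvd int y + int x3"
          using xy by (simp_all add: T1_def)
        from dvd_diff[OF this(1,2)] dvd_diff[OF this(3,4)] show "int l dvd int x - int y"
          unfolding l_def lcm_int_int_eq[symmetric] by (intro lcm_least) simp_all
      qed (use pos' in linarith)
      finally show "real (card {y. (x3, y) \<in> R d1 d2})
          \<le> (real L / real l + 1) * ((real L / real m + 1) * (real L / real q + 1))"
        by (simp add: mult_right_mono)
    qed
    also have "\<dots> \<le> real L * (?b * (1 + real L / real q))"
    proof -
      \<comment> \<open>By l * m >= q/2 the product is at most 2 L^2/q + 2 L + 1, and L >= 1 gives 3
        L (1 + L/q). This is the origin of the factor 3 in the result.\<close>
      have "(real L / real l + 1) * (real L / real m + 1) = real L ^ 2 / (real l * real m) + real L / real l + real L / real m + 1"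
        using pos' by (simp add: field_simps power2_eq_square)
      also have "real L ^ 2 / (real l * real m) \<le> 2 * (real L ^ 2 / real q)"
      proof -
        have "real q \<le> 2 * (real l * real m)"
          using lm by (metis of_nat_le_iff of_nat_mult of_nat_numeral)
        then have "real L ^ 2 * real q \<le> real L ^ 2 * (2 * (real l * real m))"
          by (intro mult_left_mono) auto
        then show ?thesis
          using pos' q_pos by (simp add: field_simps)
      qed
      also have "real L / real l \<le> real L"
        using pos' by (simp add: divide_le_eq mult_le_cancel_left1)
      also have "real L / real m \<le> real L"
        using pos' by (simp add: divide_le_eq mult_le_cancel_left1)
      finally have "(real L / real l + 1) * (real L / real m + 1) \<le> 2 * (real L ^ 2 / real q) + real L + real L + 1"
        by simp
      also have "\<dots> \<le> ?b"
      proof -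
        have "?b = 3 * real L + 3 * (real L ^ 2 / real q)"
          by (simp add: algebra_simps power2_eq_square)
        moreover have "real L ^ 2 / real q \<ge> 0" by simp
        ultimately show ?thesis using L by linarith
      qed
      finally have "(real L / real l + 1) * (real L / real m + 1) * (real L / real q + 1) \<le> ?b * (1 + real L / real q)"
        by (subst add.commute[of 1]) (rule mult_right_mono, auto)
      then have "real (card (un A)) * ((real L / real l + 1) * (real L / real m + 1) * (real L / real q + 1))
          \<le> real L * (?b * (1 + real L / real q))"
        by (rule mult_mono[rotated]) (use card_un in simp_all)
      then show ?thesis
        by (simp only: mult.assoc)
    qed
    finally show ?thesis .
  qed
  have finI: "finite I" and cardI: "card I \<le> divisor_tau q ^ 2"
  proof -
    have fin: "finite {d. d dvd q}" by simp
    have sub: "I \<subseteq> {d. d dvd q} \<times> {d. d dvd q}"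
      by (auto simp: I_def) (metis dvd_div_mult_self dvd_mult2)
    show "finite I" using fin sub finite_subset by blast
    show "card I \<le> divisor_tau q ^ 2"
      using card_mono[OF _ sub] fin by (simp add: divisor_tau_def card_cartesian_product power2_eq_square)
  qed
  have "J A \<le> card (\<Union>(d1, d2)\<in>I. R d1 d2)"
    unfolding J_def
  proof (rule card_inj_on_le[of "\<lambda>((x1, x2), (x3, x4)). (x3, x1, x2, x4)"])
    have "R d1 d2 \<subseteq> un A \<times> un A \<times> un A \<times> un A" for d1 d2
      by (auto simp: R_def)
    moreover have "finite (un A \<times> un A \<times> un A \<times> un A)" using finA by auto
    ultimately have "finite (R d1 d2)" for d1 d2
      by (rule finite_subset)
    then show "finite (\<Union>(d1, d2)\<in>I. R d1 d2)" using finI by auto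
    show "(\<lambda>((x1, x2), (x3, x4)). (x3, x1, x2, x4)) `
      {((x1, x2), (x3, x4)) \<in> (un A \<times> un A) \<times> (un A \<times> un A). eqnJ x1 x2 x3 x4} \<subseteq> (\<Union>(d1, d2)\<in>I. R d1 d2)"
    proof clarsimp
      fix x1 x2 x3 x4 assume h: "x1 \<in> un A" "x2 \<in> un A" "x3 \<in> un A" "x4 \<in> un A" "eqnJ x1 x2 x3 x4"
      then have "int q dvd (int x1 + int x2) * ((int x3 - int x1) * (int x3 - int x2))"
        using eqnJ_factor[of x1 x2 x3 x4] by (simp add: un_def mult.assoc)
      then obtain d1 where d1: "d1 dvd q" "int d1 dvd int x1 + int x2"
        "int (q div d1) dvd (int x3 - int x1) * (int x3 - int x2)"
        by (rule dvd_mult_split) simp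
      have "q div d1 > 0"
        using d1(1) q_pos dvd_mult_div_cancel[OF d1(1)] by (metis gr0I mult_0_right less_irrefl)
      with d1(3) obtain d2 where d2: "d2 dvd q div d1" "int d2 dvd int x3 - int x1" "int (q div d1 div d2) dvd int x3 - int x2"
        by (rule dvd_mult_split)
      show "\<exists>d\<in>I. (x3, x1, x2, x4) \<in> (case d of (d1, d2) \<Rightarrow> R d1 d2)"
        using h d1 d2 by (intro bexI[of _ "(d1, d2)"]) (auto simp: R_def I_def eqnJ_def)
    qed
  qed (auto intro!: inj_onI)
  also have "\<dots> \<le> (\<Sum>(d1, d2)\<in>I. card (R d1 d2))"
    using card_UN_le[OF finI, of "\<lambda>(d1, d2). R d1 d2"] by (simp add: split_def)
  finally have "real (J A) \<le> real (\<Sum>(d1, d2)\<in>I. card (R d1 d2))"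
    by (simp only: of_nat_le_iff)
  also have "\<dots> = (\<Sum>(d1, d2)\<in>I. real (card (R d1 d2)))"
    by (simp add: split_def)
  also have "\<dots> \<le> (\<Sum>(d1, d2)\<in>I. real L * (?b * (1 + real L / real q)))"
    using R_le by (intro sum_mono) auto
  also have "\<dots> = real (card I) * (real L * (?b * (1 + real L / real q)))"
    by (simp add: split_def)
  also have "\<dots> \<le> real (divisor_tau q ^ 2) * (real L * (?b * (1 + real L / real q)))"
    using cardI by (intro mult_right_mono) (auto simp only: of_nat_le_iff, simp)
  finally show ?thesis
    by (simp add: power2_eq_square mult_ac)
qed

section \<open>Complete Kloosterman sums\<close>

lemma un_full: "un {0<..q} = totatives q"
  by (auto simp: un_def totatives_def)

lemma bij_betw_mult_totatives:
  assumes "coprime t q"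
  shows "bij_betw (\<lambda>y. y * t mod q) (totatives q) (totatives q)"
proof -
  have "inj_on (\<lambda>y. y * t mod q) (totatives q)"
  proof (rule inj_onI)
    fix x y assume xy: "x \<in> totatives q" "y \<in> totatives q" "x * t mod q = y * t mod q"
    then have "[x = y] (mod q)"
      using assms by (metis Cong.cong_def cong_mult_rcancel_nat)
    moreover have "x < q" "y < q"
      using xy q_gt_1 by (simp_all add: totatives_less)
    ultimately show "x = y" by (simp add: Cong.cong_def)
  qed
  moreover have "(\<lambda>y. y * t mod q) ` totatives q \<subseteq> totatives q"
  proof (rule image_subsetI)
    fix y assume "y \<in> totatives q"
    then have "coprime (y * t mod q) q"
      using assms q_pos by (simp add: totatives_def)
    moreover from this have "y * t mod q \<noteq> 0"
      using q_gt_1 by (metis coprime_0_left_iff nat_dvd_1_iff_1 less_irrefl)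
    ultimately show "y * t mod q \<in> totatives q"
      using q_gt_1 by (simp add: totatives_def)
  qed
  ultimately show ?thesis
    by (simp add: bij_betw_def endo_inj_surj)
qed

text \<open>Multiplication by t permutes the units modulo q. This freedom exists only for complete
  sums, which is why complete and incomplete sums are estimated differently below.\<close>

lemma kS_twist:
  assumes "coprime t q"
  shows "kS {0<..q} (u * iv t) (v * int t) = kS {0<..q} u v"
proof -
  have "kS {0<..q} u v = (\<Sum>y\<in>totatives q. e_mod q (u * iv (y * t mod q) + v * int (y * t mod q)))"
    unfolding kS_def un_full by (rule sum.reindex_bij_betw[OF bij_betw_mult_totatives[OF assms], symmetric])
  also have "\<dots> = (\<Sum>y\<in>totatives q. e_mod q (u * iv t * iv y + v * int t * int y))"
  proof (rule sum.cong[OF refl])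
    fix y assume "y \<in> totatives q"
    then have y: "coprime y q" by (simp add: totatives_def)
    have *: "[int t * int y = int (y * t mod q)] (mod int q)"
      by (simp add: Cong.cong_def zmod_int mult.commute)
    have "[u * iv (y * t mod q) + v * int (y * t mod q) = u * (iv t * iv y) + v * (int t * int y)] (mod int q)"
      using iv_cong_mult[OF assms y *] cong_sym[OF *] by (intro cong_add cong_scalar_left)
    then show "e_mod q (u * iv (y * t mod q) + v * int (y * t mod q)) = e_mod q (u * iv t * iv y + v * int t * int y)"
      unfolding mult.assoc by (rule e_mod_cong) simp
  qed
  finally show ?thesis
    by (simp add: kS_def un_full)
qed

lemma J_full_le: "real (J {0<..q}) \<le> 12 * real (divisor_tau q) ^ 2 * real q ^ 2"
  using J_le[of "{0<..q}" 0 q] q_gt_1 by (simp add: power2_eq_square)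

lemma J_full_div_totient_le:
  "real (J {0<..q}) / real (totient q) \<le> 12 * real (divisor_tau q) ^ 3 * real q"
proof -
  have "real q \<le> real (divisor_tau q) * real (totient q)"
    using le_divisor_tau_totient[of q] by (simp flip: of_nat_mult)
  then have *: "real q * (12 * real (divisor_tau q) ^ 2 * real q)
     \<le> real (divisor_tau q) * real (totient q) * (12 * real (divisor_tau q) ^ 2 * real q)"
    by (rule mult_right_mono) simp
  have "real (J {0<..q}) \<le> real q * (12 * real (divisor_tau q) ^ 2 * real q)"
    using J_full_le by (simp only: power2_eq_square mult_ac)
  also note *
  finally have "real (J {0<..q}) \<le> 12 * real (divisor_tau q) ^ 3 * real q * real (totient q)"
    by (simp only: power2_eq_square power3_eq_cube mult_ac)
  then show ?thesis
    using q_gt_1 by (simp add: divide_le_eq)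
qed

text \<open>Since u is a unit, u/t determines t, so the points (u/t, vt) are distinct for distinct
  units t. The complete fourth moment therefore contains the value |K(u, v)|^4 at least
  \<open>totient q\<close> times.\<close>

lemma kloosterman_le:
  assumes "coprime u (int q)"
  shows "norm (kS {0<..q} u v) ^ 4 \<le> 12 * real (divisor_tau q) ^ 3 * real q ^ 3"
proof -
  define \<kappa> where "\<kappa> t = (nat ((u * iv t) mod int q), nat ((v * int t) mod int q))" for t
  let ?h = "\<lambda>p. norm (kS {0<..q} (int (fst p)) (int (snd p))) ^ 4"
  have h: "?h (\<kappa> t) = norm (kS {0<..q} u v) ^ 4" if "t \<in> totatives q" for t
  proof -
    have "kS {0<..q} (int (fst (\<kappa> t))) (int (snd (\<kappa> t))) = kS {0<..q} (u * iv t) (v * int t)"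
      by (intro kS_cong) (simp_all add: \<kappa>_def Cong.cong_def)
    also have "\<dots> = kS {0<..q} u v"
      using that by (intro kS_twist) (simp add: totatives_def)
    finally show ?thesis by simp
  qed
  have inj: "inj_on \<kappa> (totatives q)"
  proof (rule inj_onI)
    fix s t assume st: "s \<in> totatives q" "t \<in> totatives q" "\<kappa> s = \<kappa> t"
    then have "[u * iv s = u * iv t] (mod int q)"
      by (simp add: \<kappa>_def Cong.cong_def eq_nat_nat_iff)
    then have *: "[iv s = iv t] (mod int q)"
      using assms by (simp add: cong_mult_lcancel)
    have cop: "coprime s q" "coprime t q" using st by (auto simp: totatives_def)
    have "[int s * (int t * iv t) = int s * (int t * iv s)] (mod int q)"
      using * by (intro cong_mult cong_refl) (rule cong_sym)
    also have "int s * (int t * iv s) = int t * (int s * iv s)"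
      by simp
    also have "[int t * (int s * iv s) = int t * 1] (mod int q)"
      by (intro cong_scalar_left iv_cong cop)
    finally have "[int s * (int t * iv t) = int t] (mod int q)"
      by simp
    moreover have "[int s * 1 = int s * (int t * iv t)] (mod int q)"
      by (intro cong_scalar_left cong_sym[OF iv_cong] cop)
    ultimately have "[int s * 1 = int t] (mod int q)"
      by (rule cong_trans[rotated])
    then have "[int s = int t] (mod int q)"
      by simp
    then have "[s = t] (mod q)" by (simp add: cong_int_iff)
    moreover have "s < q" "t < q"
      using st(1,2) q_gt_1 by (simp_all add: totatives_less)
    ultimately show "s = t"
      by (simp add: Cong.cong_def)
  qed
  have "real (totient q) * norm (kS {0<..q} u v) ^ 4 = (\<Sum>t\<in>totatives q. ?h (\<kappa> t))"
    using h by (simp add: totient_def)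
  also have "\<dots> = (\<Sum>p\<in>\<kappa> ` totatives q. ?h p)"
    by (simp add: sum.reindex[OF inj])
  also have "\<dots> \<le> (\<Sum>p\<in>{..<q} \<times> {..<q}. ?h p)"
    by (rule sum_mono2) (auto simp: \<kappa>_def nat_less_iff)
  also have "\<dots> = real q ^ 2 * real (J {0<..q})"
    using fourth_moment[of "{0<..q}" 0] by (simp add: sum.cartesian_product split_def)
  finally have "norm (kS {0<..q} u v) ^ 4 \<le> real q ^ 2 * (real (J {0<..q}) / real (totient q))"
    using q_gt_1 by (simp add: field_simps)
  also have "\<dots> \<le> real q ^ 2 * (12 * real (divisor_tau q) ^ 3 * real q)"
    by (intro mult_left_mono J_full_div_totient_le) simp
  finally show ?thesis
    by (simp add: power2_eq_square power3_eq_cube mult_ac)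
qed

text \<open>
  Averaging over a common factor \<open>t\<close> turns the family indexed by ratios \<open>r\<close> into one indexed by
  pairs of units, to which the fourth moment applies for composite moduli without loss.
\<close>
lemma sum_kS_ratio_le:
  assumes "coprime a (int q)" "coprime b (int q)"
  shows "(\<Sum>r\<in>totatives q. (norm (kS {0<..q} (a * (iv r - 1)) (b * (int r - 1))))\<^sup>2)
    \<le> 12 * real (divisor_tau q) ^ 3 * real q ^ 2"
proof -
  let ?K = "\<lambda>x t. (norm (kS {0<..q} (a * (iv x - iv t)) (b * (int x - int t))))\<^sup>2"
  let ?R = "\<Sum>r\<in>totatives q. (norm (kS {0<..q} (a * (iv r - 1)) (b * (int r - 1))))\<^sup>2"
  have R_eq: "?R = (\<Sum>x\<in>totatives q. ?K x t)" if "t \<in> totatives q" for t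
  proof -
    have t: "coprime t q" using that by (simp add: totatives_def)
    have "(\<Sum>x\<in>totatives q. ?K x t) = (\<Sum>r\<in>totatives q. ?K (r * t mod q) t)"
      by (rule sum.reindex_bij_betw[OF bij_betw_mult_totatives[OF t], symmetric])
    also have "\<dots> = ?R"
    proof (rule sum.cong[OF refl])
      fix r assume "r \<in> totatives q"
      then have r: "coprime r q" by (simp add: totatives_def)
      have *: "[int r * int t = int (r * t mod q)] (mod int q)"
        by (simp add: Cong.cong_def zmod_int)
      have "kS {0<..q} (a * (iv (r * t mod q) - iv t)) (b * (int (r * t mod q) - int t))
        = kS {0<..q} (a * (iv r * iv t - iv t)) (b * (int r * int t - int t))"
        using iv_cong_mult[OF r t *] cong_sym[OF *] by (intro kS_cong cong_scalar_left cong_diff cong_refl)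
      also have "\<dots> = kS {0<..q} (a * (iv r - 1) * iv t) (b * (int r - 1) * int t)"
        by (simp add: algebra_simps)
      also have "\<dots> = kS {0<..q} (a * (iv r - 1)) (b * (int r - 1))"
        by (rule kS_twist[OF t])
      finally show "?K (r * t mod q) t = (norm (kS {0<..q} (a * (iv r - 1)) (b * (int r - 1))))\<^sup>2"
        by simp
    qed
    finally show ?thesis by simp
  qed
  have "real (totient q) * ?R = (\<Sum>t\<in>totatives q. ?R)"
    by (simp add: totient_def)
  also have "\<dots> = (\<Sum>t\<in>totatives q. \<Sum>x\<in>totatives q. ?K x t)"
    by (intro sum.cong refl R_eq)
  also have "\<dots> = (\<Sum>x\<in>totatives q. \<Sum>t\<in>totatives q. ?K x t)"
    by (rule sum.swap)
  also have "\<dots> \<le> real q * sqrt (real (J {0<..q}) * real (J {0<..q}))"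
    using sum_kS_sq_le[of "{0<..q}" "{0<..q}" a b 0] assms
    by (simp add: un_full sum.cartesian_product)
  finally have "?R \<le> real q * (real (J {0<..q}) / real (totient q))"
    using q_gt_1 by (simp add: field_simps)
  also have "\<dots> \<le> real q * (12 * real (divisor_tau q) ^ 3 * real q)"
    by (intro mult_left_mono J_full_div_totient_le) simp
  finally show ?thesis
    by (simp add: power2_eq_square mult_ac)
qed

text \<open>Fix x1, x2 with gcd g and maximum m. The integer x1 x4 - x2 x3 runs through multiples of
  q g, of which there are O(m Z/(q g) + 1) in range. For each value the solutions (x3, x4) lie on a
  line, which carries at most Z g/m + 1 of them. The product is O(Z^2/q + Z g/m), and the last term
  is summed by \<open>sum_gcd_div_max_le\<close>.\<close>

lemma energy_le:
  assumes A: "A \<subseteq> {0<..Z}" and Z: "Z \<ge> 1"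
  shows "real (card {((x1, x2), (x3, x4)) \<in> (un A \<times> un A) \<times> (un A \<times> un A).
      [int x1 * int x4 = int x2 * int x3] (mod int q)})
    \<le> 4 * real Z ^ 4 / real q + 4 * real Z ^ 2 * (1 + ln (real Z))"
proof -
  define E where "E x1 x2 = {(x3, x4) \<in> un A \<times> un A. [int x1 * int x4 = int x2 * int x3] (mod int q)}" for x1 x2
  define G where "G x1 x2 = 4 * real Z ^ 2 / real q + 2 * real Z * (real (gcd x1 x2) / real (max x1 x2))" for x1 x2 :: nat
  have finA: "finite A" using A finite_subset by blast
  have unA: "un A \<subseteq> {0<..Z}" using A by (auto simp: un_def)
  have E_le: "real (card (E x1 x2)) \<le> G x1 x2" if "x1 \<in> un A" "x2 \<in> un A" for x1 x2
  proof -
    have pos: "0 < x1" "0 < x2" "x1 \<le> Z" "x2 \<le> Z" and cop: "coprime x1 q"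
      using that unA by (auto simp: un_def)
    define g where "g = gcd x1 x2"
    \<comment> \<open>This is x1 x4 - x2 x3 shifted by the constant x2 Z, which keeps it a positive
      natural number and leaves differences unchanged.\<close>
    define \<omega> where "\<omega> = (\<lambda>(x3, x4). x1 * x4 + x2 * (Z - x3))"
    have g: "g > 0" "g dvd x1" "g dvd x2" using pos by (auto simp: g_def)
    have \<omega>_int: "int (\<omega> (x3, x4)) = int x1 * int x4 - int x2 * int x3 + int x2 * int Z" if "x3 \<in> un A" for x3 x4
      using that unA by (auto simp: \<omega>_def of_nat_diff algebra_simps)
    have finE: "finite (E x1 x2)"
      by (rule finite_subset[of _ "un A \<times> un A"]) (use finA in \<open>auto simp: E_def\<close>)
    \<comment> \<open>On a fibre x3 is fixed modulo x1/g and x4 modulo x2/g, and either coordinate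
      determines the other. Using the coordinate with the larger modulus puts max x1 x2 in the
      denominator.\<close>
    have fibre: "real (card {p \<in> E x1 x2. \<omega> p = w}) \<le> real Z * real g / real (max x1 x2) + 1" for w
    proof -
      have key: "int x1 * (int x4 - int y4) = int x2 * (int x3 - int y3)"
        if "(x3, x4) \<in> {p \<in> E x1 x2. \<omega> p = w}" "(y3, y4) \<in> {p \<in> E x1 x2. \<omega> p = w}" for x3 x4 y3 y4
      proof -
        have "int (\<omega> (x3, x4)) = int (\<omega> (y3, y4))" "x3 \<in> un A" "y3 \<in> un A"
          using that by (auto simp: E_def)
        then show ?thesis
          by (simp add: \<omega>_int algebra_simps)
      qed
      have cop': "coprime (int (x1 div g)) (int (x2 div g))"
        using g pos by (simp add: g_def div_gcd_coprime)
      have red: "int (x1 div g) * (int x4 - int y4) = int (x2 div g) * (int x3 - int y3)"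
        if "(x3, x4) \<in> {p \<in> E x1 x2. \<omega> p = w}" "(y3, y4) \<in> {p \<in> E x1 x2. \<omega> p = w}" for x3 x4 y3 y4
      proof -
        have "int g * (int (x1 div g) * (int x4 - int y4)) = int g * (int (x2 div g) * (int x3 - int y3))"
          using key[OF that] g by (simp flip: mult.assoc of_nat_mult)
        then show ?thesis using g by simp
      qed
      let ?S = "{p \<in> E x1 x2. \<omega> p = w}"
      have "real (card (fst ` ?S)) \<le> real Z / real (x1 div g) + 1"
      proof (rule card_congruent_le)
        show "fst ` ?S \<subseteq> {0<..0 + Z}" using unA by (auto simp: E_def)
        show "1 \<le> x1 div g" using g pos by (simp add: dvd_imp_le div_greater_zero_iff Suc_le_eq)
        fix x y assume "x \<in> fst ` ?S" "y \<in> fst ` ?S"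
        then obtain x' y' where xy: "(x, x') \<in> ?S" "(y, y') \<in> ?S" by force
        then have "int (x1 div g) dvd int (x2 div g) * (int x - int y)"
          using red[OF xy] by (metis dvd_triv_left)
        then show "int (x1 div g) dvd int x - int y"
          using cop' by (simp add: coprime_dvd_mult_right_iff)
      qed
      moreover have "inj_on fst ?S"
      proof (rule inj_onI)
        fix p p' assume *: "p \<in> ?S" "p' \<in> ?S" "fst p = fst p'"
        have "(fst p, snd p) \<in> ?S" "(fst p', snd p') \<in> ?S"
          using *(1,2) by (simp_all only: prod.collapse)
        from key[OF this] * have "int x1 * (int (snd p) - int (snd p')) = 0" by simp
        then show "p = p'" using * pos by (simp add: prod_eq_iff)
      qed
      ultimately have b1: "real (card ?S) \<le> real Z / real (x1 div g) + 1"
        by (simp add: card_image)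
      have "real (card (snd ` ?S)) \<le> real Z / real (x2 div g) + 1"
      proof (rule card_congruent_le)
        show "snd ` ?S \<subseteq> {0<..0 + Z}" using unA by (auto simp: E_def)
        show "1 \<le> x2 div g" using g pos by (simp add: dvd_imp_le div_greater_zero_iff Suc_le_eq)
        fix x y assume "x \<in> snd ` ?S" "y \<in> snd ` ?S"
        then obtain x' y' where xy: "(x', x) \<in> ?S" "(y', y) \<in> ?S" by force
        then have "int (x2 div g) dvd int (x1 div g) * (int x - int y)"
          using red[OF xy] by (metis dvd_triv_left)
        then show "int (x2 div g) dvd int x - int y"
          using cop' by (simp add: coprime_dvd_mult_right_iff coprime_commute)
      qed
      moreover have "inj_on snd ?S"
      proof (rule inj_onI)
        fix p p' assume *: "p \<in> ?S" "p' \<in> ?S" "snd p = snd p'"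
        have "(fst p, snd p) \<in> ?S" "(fst p', snd p') \<in> ?S"
          using *(1,2) by (simp_all only: prod.collapse)
        from key[OF this] * have "int x2 * (int (fst p) - int (fst p')) = 0" by simp
        then show "p = p'" using * pos by (simp add: prod_eq_iff)
      qed
      ultimately have b2: "real (card ?S) \<le> real Z / real (x2 div g) + 1"
        by (simp add: card_image)
      have "real (x1 div g) = real x1 / real g" "real (x2 div g) = real x2 / real g"
        using g by (simp_all add: real_of_nat_div)
      then show ?thesis
        using b1 b2 by (simp add: max_def split: if_splits)
    qed
    \<comment> \<open>All values are congruent modulo q and modulo g separately; these moduli are
      coprime because g divides the unit x1.\<close>
    have img: "real (card (\<omega> ` E x1 x2)) \<le> real ((x1 + x2) * Z) / real (q * g) + 1"
    proof (rule card_congruent_le)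
      show "\<omega> ` E x1 x2 \<subseteq> {0<..0 + (x1 + x2) * Z}"
      proof (rule image_subsetI, clarify)
        fix x3 x4 assume "(x3, x4) \<in> E x1 x2"
        then have "0 < x4" "x4 \<le> Z" using unA by (auto simp: E_def)
        then have "0 < x1 * x4" "x1 * x4 + x2 * (Z - x3) \<le> x1 * Z + x2 * Z"
          using pos by (auto intro!: add_mono mult_le_mono2)
        then show "\<omega> (x3, x4) \<in> {0<..0 + (x1 + x2) * Z}"
          by (simp add: \<omega>_def add_mult_distrib)
      qed
      show "1 \<le> q * g" using q_pos g by (simp add: Suc_le_eq)
      fix v w assume "v \<in> \<omega> ` E x1 x2" "w \<in> \<omega> ` E x1 x2"
      then obtain x3 x4 y3 y4 where h: "(x3, x4) \<in> E x1 x2" "v = \<omega> (x3, x4)" "(y3, y4) \<in> E x1 x2" "w = \<omega> (y3, y4)"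
        by auto
      have diff: "int v - int w = (int x1 * int x4 - int x2 * int x3) - (int x1 * int y4 - int x2 * int y3)"
        using h by (simp add: \<omega>_int E_def)
      have "int q dvd int v - int w"
        unfolding diff by (rule dvd_diff) (use h in \<open>simp_all add: E_def cong_iff_dvd_diff\<close>)
      moreover have "int g dvd int x1" "int g dvd int x2" using g by simp_all
      then have "int g dvd int v - int w"
        unfolding diff by (intro dvd_diff) auto
      moreover have "coprime (int q) (int g)"
        using cop g(2) by (metis coprime_commute coprime_divisors coprime_int_iff dvd_refl)
      ultimately show "int (q * g) dvd int v - int w"
        by (simp add: divides_mult)
    qed
    let ?m = "max x1 x2"
    have m: "0 < ?m" "?m \<le> Z" "real x1 + real x2 \<le> 2 * real ?m" "g \<le> ?m"
      using pos g by (auto simp: max_def dvd_imp_le)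
    have "real (card (E x1 x2)) = real (card {(w, p). w \<in> \<omega> ` E x1 x2 \<and> p \<in> E x1 x2 \<and> \<omega> p = w})"
      by (intro arg_cong[where f = real] bij_betw_same_card[of "\<lambda>p. (\<omega> p, p)"] bij_betwI[where g = snd]) auto
    also have "\<dots> \<le> real (card (\<omega> ` E x1 x2)) * (real Z * real g / real ?m + 1)"
    proof (rule card_le_nested)
      show "{(w, p). w \<in> \<omega> ` E x1 x2 \<and> p \<in> E x1 x2 \<and> \<omega> p = w} \<subseteq> \<omega> ` E x1 x2 \<times> E x1 x2" by auto
      show "finite (\<omega> ` E x1 x2)" "finite (E x1 x2)" using finE by auto
      fix w assume "w \<in> \<omega> ` E x1 x2"
      then have "{y. (w, y) \<in> {(w, p). w \<in> \<omega> ` E x1 x2 \<and> p \<in> E x1 x2 \<and> \<omega> p = w}} = {p \<in> E x1 x2. \<omega> p = w}"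
        by auto
      then show "real (card {y. (w, y) \<in> {(w, p). w \<in> \<omega> ` E x1 x2 \<and> p \<in> E x1 x2 \<and> \<omega> p = w}})
          \<le> real Z * real g / real ?m + 1"
        using fibre[of w] by simp
    qed
    also have "\<dots> \<le> (2 * real ?m * real Z / (real q * real g) + 1) * (real Z * real g / real ?m + 1)"
    proof (rule mult_right_mono)
      have "real ((x1 + x2) * Z) / real (q * g) \<le> 2 * real ?m * real Z / (real q * real g)"
        using m(3) by (auto intro!: divide_right_mono mult_right_mono)
      then show "real (card (\<omega> ` E x1 x2)) \<le> 2 * real ?m * real Z / (real q * real g) + 1"
        using img by linarith
    qed simp
    also have "\<dots> = 2 * real Z ^ 2 / real q + 2 * real Z / real q * (real ?m / real g) + real Z * real g / real ?m + 1"
    proof -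
      have "(2 * M * z / (Q * G) + 1) * (z * G / M + 1) = 2 * z ^ 2 / Q + 2 * z / Q * (M / G) + z * G / M + 1"
        if "M > 0" "G > 0" "Q > 0" for M G Q z :: real
        using that by (simp add: field_simps power2_eq_square)
      from this[of "real ?m"] show ?thesis using m(1) g(1) q_pos by simp
    qed
    also have "2 * real Z / real q * (real ?m / real g) \<le> 2 * real Z ^ 2 / real q"
    proof -
      have "real ?m / real g \<le> real ?m"
        using g(1) by (simp add: divide_le_eq mult_le_cancel_left1)
      then have "real ?m / real g \<le> real Z" using m(2) by linarith
      then have "2 * real Z / real q * (real ?m / real g) \<le> 2 * real Z / real q * real Z"
        by (rule mult_left_mono) simp
      then show ?thesis by (simp add: power2_eq_square)
    qed
    \<comment> \<open>The leftover 1 is absorbed because the maximum is at most Z; this gives the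
      factor 2 in front of the second term of G.\<close>
    also have "(1::real) \<le> real Z * real g / real ?m"
    proof -
      have "real ?m * 1 \<le> real Z * real g"
        using m(2) g(1) by (intro mult_mono) auto
      then show ?thesis using m(1) by (simp add: le_divide_eq)
    qed
    finally show ?thesis
      by (simp add: G_def g_def mult.assoc)
  qed
  have "{((x1, x2), (x3, x4)) \<in> (un A \<times> un A) \<times> (un A \<times> un A).
      [int x1 * int x4 = int x2 * int x3] (mod int q)} = (SIGMA p:un A \<times> un A. E (fst p) (snd p))"
    by (auto simp: E_def)
  also have "real (card \<dots>) = (\<Sum>p\<in>un A \<times> un A. real (card (E (fst p) (snd p))))"
  proof -
    have "finite (E x1 x2)" for x1 x2
      by (rule finite_subset[of _ "un A \<times> un A"]) (use finA in \<open>auto simp: E_def\<close>)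
    then show ?thesis using finA by (subst card_SigmaI) auto
  qed
  also have "\<dots> \<le> (\<Sum>p\<in>un A \<times> un A. G (fst p) (snd p))"
    by (intro sum_mono E_le) auto
  also have "\<dots> \<le> (\<Sum>p\<in>{0<..Z} \<times> {0<..Z}. G (fst p) (snd p))"
    using unA by (intro sum_mono2) (auto simp: G_def)
  also have "\<dots> = (\<Sum>x\<in>{0<..Z}. \<Sum>y\<in>{0<..Z}. G x y)"
    by (simp add: sum.cartesian_product split_def)
  also have "\<dots> = 4 * real Z ^ 4 / real q + 2 * real Z * (\<Sum>x\<in>{0<..Z}. \<Sum>y\<in>{0<..Z}. real (gcd x y) / real (max x y))"
    by (simp add: G_def sum.distrib sum_distrib_left power2_eq_square numeral_eq_Suc)
  also have "\<dots> \<le> 4 * real Z ^ 4 / real q + 2 * real Z * (2 * (real Z * (1 + ln (real Z))))"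
    by (intro add_mono mult_left_mono sum_gcd_div_max_le Z) auto
  finally show ?thesis
    by (simp add: power2_eq_square mult_ac)
qed

text \<open>Cauchy-Schwarz separates how often a ratio x1/x2 occurs, which is the energy, from the
  size of the sum attached to it. Up to logarithms and tau(q) the bound is Z^2 q^(1/2) + Z q:
  square-root size on average, plus the diagonal x1 = x2, where the sum is phi(q).\<close>

lemma sum_kS_complete_le:
  assumes "coprime a (int q)" "coprime b (int q)" and A: "A \<subseteq> {0<..Z}" and Z: "Z \<ge> 1"
  shows "(\<Sum>(x1, x2)\<in>un A \<times> un A. norm (kS {0<..q} (a * (iv x1 - iv x2)) (b * (int x1 - int x2))))
    \<le> sqrt (4 * real Z ^ 4 / real q + 4 * real Z ^ 2 * (1 + ln (real Z)))
      * sqrt (12 * real (divisor_tau q) ^ 3 * real q ^ 2)"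
proof -
  define \<kappa> where "\<kappa> = (\<lambda>(x1, x2). nat ((int x1 * iv x2) mod int q))"
  define H where "H r = norm (kS {0<..q} (a * (iv r - 1)) (b * (int r - 1)))" for r
  have finA: "finite (un A)" using A finite_subset by (metis finite_greaterThanAtMost finite_un)
  have cop: "coprime x q" if "x \<in> un A" for x using that by (simp add: un_def)
  have \<kappa>_cong: "[int x1 = int (\<kappa> (x1, x2)) * int x2] (mod int q)"
    and \<kappa>_cop: "coprime (\<kappa> (x1, x2)) q" if "x1 \<in> un A" "x2 \<in> un A" for x1 x2
  proof -
    have "[int (\<kappa> (x1, x2)) * int x2 = (int x1 * iv x2) * int x2] (mod int q)"
      by (intro cong_scalar_right) (simp add: \<kappa>_def Cong.cong_def)
    also have "(int x1 * iv x2) * int x2 = int x1 * (int x2 * iv x2)" by simp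
    also have "[\<dots> = int x1 * 1] (mod int q)"
      by (intro cong_scalar_left iv_cong cop that)
    finally show *: "[int x1 = int (\<kappa> (x1, x2)) * int x2] (mod int q)"
      by (simp add: cong_sym)
    have "coprime (int x1) (int q)" using cop that by simp
    then have "coprime (int (\<kappa> (x1, x2)) * int x2) (int q)"
      using cong_imp_coprime[OF *] by simp
    then show "coprime (\<kappa> (x1, x2)) q" by simp
  qed
  have tot: "\<kappa> p \<in> totatives q" if "p \<in> un A \<times> un A" for p
  proof -
    obtain x1 x2 where p: "p = (x1, x2)" "x1 \<in> un A" "x2 \<in> un A" using \<open>p \<in> un A \<times> un A\<close> by (rule SigmaE)
    have "\<kappa> p \<noteq> 0" using \<kappa>_cop p q_gt_1 by (metis coprime_0_left_iff nat_dvd_1_iff_1 less_irrefl)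
    moreover have "\<kappa> p < q" by (simp add: \<kappa>_def split_def nat_less_iff)
    ultimately show ?thesis using \<kappa>_cop p by (simp add: totatives_def)
  qed
  have "(\<Sum>(x1, x2)\<in>un A \<times> un A. norm (kS {0<..q} (a * (iv x1 - iv x2)) (b * (int x1 - int x2))))
    = (\<Sum>p\<in>un A \<times> un A. H (\<kappa> p))"
  proof (rule sum.cong[OF refl], clarify)
    fix x1 x2 assume x: "x1 \<in> un A" "x2 \<in> un A"
    let ?r = "\<kappa> (x1, x2)"
    have "[iv x1 = iv ?r * iv x2] (mod int q)"
      using iv_cong_mult[OF \<kappa>_cop[OF x] cop[OF x(2)] cong_sym[OF \<kappa>_cong[OF x]]] .
    then have "kS {0<..q} (a * (iv x1 - iv x2)) (b * (int x1 - int x2))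
      = kS {0<..q} (a * (iv ?r * iv x2 - iv x2)) (b * (int ?r * int x2 - int x2))"
      using \<kappa>_cong[OF x] by (intro kS_cong cong_scalar_left cong_diff cong_refl)
    also have "\<dots> = kS {0<..q} (a * (iv ?r - 1) * iv x2) (b * (int ?r - 1) * int x2)"
      by (simp add: algebra_simps)
    also have "\<dots> = kS {0<..q} (a * (iv ?r - 1)) (b * (int ?r - 1))"
      by (rule kS_twist[OF cop[OF x(2)]])
    finally show "norm (kS {0<..q} (a * (iv x1 - iv x2)) (b * (int x1 - int x2))) = H (\<kappa> (x1, x2))"
      by (simp add: H_def)
  qed
  also have "\<dots> \<le> sqrt (card {(w, w') \<in> (un A \<times> un A) \<times> (un A \<times> un A). \<kappa> w = \<kappa> w'})
      * sqrt (\<Sum>t\<in>totatives q. (H t)\<^sup>2)"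
    using finA tot by (intro sum_le_sqrt_collisions) auto
  also have "\<dots> \<le> sqrt (4 * real Z ^ 4 / real q + 4 * real Z ^ 2 * (1 + ln (real Z)))
      * sqrt (12 * real (divisor_tau q) ^ 3 * real q ^ 2)"
  proof (intro mult_mono real_sqrt_le_mono)
    let ?E = "{((x1, x2), (x3, x4)) \<in> (un A \<times> un A) \<times> (un A \<times> un A). [int x1 * int x4 = int x2 * int x3] (mod int q)}"
    have "{(w, w') \<in> (un A \<times> un A) \<times> (un A \<times> un A). \<kappa> w = \<kappa> w'} \<subseteq> ?E"
    proof clarsimp
      fix x1 x2 x3 x4 assume x: "x1 \<in> un A" "x2 \<in> un A" "x3 \<in> un A" "x4 \<in> un A" "\<kappa> (x1, x2) = \<kappa> (x3, x4)"
      have "[int x1 * int x4 = int (\<kappa> (x1, x2)) * int x2 * int x4] (mod int q)"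
        using x by (intro cong_scalar_right \<kappa>_cong)
      also have "int (\<kappa> (x1, x2)) * int x2 * int x4 = int x2 * (int (\<kappa> (x3, x4)) * int x4)"
        using x by simp
      also have "[\<dots> = int x2 * int x3] (mod int q)"
        using x by (intro cong_scalar_left cong_sym[OF \<kappa>_cong])
      finally show "[int x1 * int x4 = int x2 * int x3] (mod int q)" .
    qed
    moreover have "finite ?E"
      by (rule finite_subset[of _ "(un A \<times> un A) \<times> (un A \<times> un A)"]) (use finA in auto)
    ultimately have "card {(w, w') \<in> (un A \<times> un A) \<times> (un A \<times> un A). \<kappa> w = \<kappa> w'} \<le> card ?E"
      by (intro card_mono)
    then show "real (card {(w, w') \<in> (un A \<times> un A) \<times> (un A \<times> un A). \<kappa> w = \<kappa> w'})
        \<le> 4 * real Z ^ 4 / real q + 4 * real Z ^ 2 * (1 + ln (real Z))"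
      using energy_le[OF A Z] by linarith
    show "(\<Sum>t\<in>totatives q. (H t)\<^sup>2) \<le> 12 * real (divisor_tau q) ^ 3 * real q ^ 2"
      unfolding H_def using assms by (intro sum_kS_ratio_le)
  qed (use Z in \<open>auto intro!: sum_nonneg add_nonneg_nonneg mult_nonneg_nonneg\<close>)
  finally show ?thesis .
qed

end

section \<open>Completion and bilinear sums\<close>

text \<open>A weakening of Jordan's inequality, which has 2t on the right. With x = pi t <= 2 the
  cubic Taylor error x^3/6 is at most 2x/3, and the remaining x/3 exceeds t because pi > 3.\<close>

lemma sin_pi_mult_ge:
  assumes "0 \<le> t" "t \<le> 1 / 2"
  shows "sin (pi * t) \<ge> t"
proof -
  let ?x = "pi * t"
  have x: "0 \<le> ?x" "?x \<le> 2"
    using assms pi_less_4 mult_mono[of pi 4 t "1/2"] by auto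
  have "\<bar>sin ?x - (\<Sum>m<3. sin_coeff m * ?x ^ m)\<bar> \<le> inverse (fact 3) * \<bar>?x\<bar> ^ 3"
    by (rule Maclaurin_sin_bound)
  then have "\<bar>sin ?x - ?x\<bar> \<le> ?x ^ 3 / 6"
    using x by (simp add: sin_coeff_def eval_nat_numeral)
  then have "sin ?x \<ge> ?x - ?x ^ 3 / 6"
    by linarith
  moreover have "?x ^ 3 / 6 \<le> 2 / 3 * ?x"
  proof -
    have "?x ^ 2 \<le> 2 ^ 2" using x by (intro power_mono) auto
    then have "?x * ?x ^ 2 \<le> ?x * 4" using x by (intro mult_left_mono) auto
    then show ?thesis by (simp add: power3_eq_cube power2_eq_square mult_ac)
  qed
  moreover have "1 / 3 * ?x \<ge> t"
    using assms pi_gt3 mult_right_mono[of 3 pi t] by simp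
  ultimately show ?thesis by linarith
qed

lemma norm_e_mod_minus_1_ge:
  assumes "h < q"
  shows "norm (e_mod q (int h) - 1) \<ge> 2 * real (min h (q - h)) / real q"
proof -
  have q: "real q > 0" using assms by simp
  have "2 * of_real pi * \<i> * of_int (int h) / of_nat q = \<i> * complex_of_real (2 * pi * real h / real q)"
    by simp
  then have "norm (e_mod q (int h) - 1) = 2 * \<bar>sin (2 * pi * real h / real q / 2)\<bar>"
    unfolding e_mod_def by (simp only: dist_exp_i_1)
  also have "2 * pi * real h / real q / 2 = pi * (real h / real q)" by simp
  finally have eq: "norm (e_mod q (int h) - 1) = 2 * \<bar>sin (pi * (real h / real q))\<bar>" .
  show ?thesis
  proof (cases "2 * h \<le> q")
    case True
    then have "sin (pi * (real h / real q)) \<ge> real h / real q"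
      using q by (intro sin_pi_mult_ge) (auto simp: field_simps)
    moreover have "min h (q - h) = h" using True by simp
    ultimately show ?thesis unfolding eq by simp
  next
    case False
    then have "sin (pi * (real (q - h) / real q)) \<ge> real (q - h) / real q"
      using q by (intro sin_pi_mult_ge) (auto simp: field_simps)
    moreover have "pi * (real (q - h) / real q) = pi - pi * (real h / real q)"
      using assms q by (simp add: of_nat_diff field_simps)
    moreover have "min h (q - h) = q - h" using False by simp
    ultimately show ?thesis unfolding eq by simp
  qed
qed

text \<open>The Dirichlet kernel at frequency h/q divided by q: the minimum of h and q - h is q
  times the distance from h/q to the nearest integer.\<close>

definition dirichlet_bound :: "nat \<Rightarrow> nat \<Rightarrow> real" where
  "dirichlet_bound q h = (if h = 0 then 1 else 1 / real (min h (q - h)))"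

lemma norm_sum_e_mod_le:
  assumes "h < q" "r \<le> q"
  shows "norm (\<Sum>j\<in>{P<..P + r}. e_mod q (- (int h * int j))) \<le> real q * dirichlet_bound q h"
proof (cases "h = 0")
  case True
  then show ?thesis using assms by (simp add: dirichlet_bound_def)
next
  case False
  let ?z = "e_mod q (- int h)"
  have norm1: "norm (?z - 1) = norm (e_mod q (int h) - 1)"
    by (metis complex_cnj_diff complex_cnj_one complex_mod_cnj e_mod_minus)
  have m: "min h (q - h) > 0" using assms False by simp
  have ge: "norm (?z - 1) \<ge> 2 * real (min h (q - h)) / real q"
    unfolding norm1 by (rule norm_e_mod_minus_1_ge) fact
  moreover have "2 * real (min h (q - h)) / real q > 0" using m assms by simp
  ultimately have ne: "?z \<noteq> 1" by auto
  have "(\<Sum>j\<in>{P<..P + r}. e_mod q (- (int h * int j))) = (\<Sum>i<r. e_mod q (- (int h * int (P + 1 + i))))"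
    by (rule sum.reindex_bij_witness[of _ "\<lambda>i. P + 1 + i" "\<lambda>j. j - (P + 1)"]) auto
  also have "\<dots> = (\<Sum>i<r. ?z ^ (P + 1) * ?z ^ i)"
  proof (rule sum.cong[OF refl])
    fix i
    have "- (int h * int (P + 1 + i)) = int (P + 1) * - int h + int i * - int h"
      by (simp add: algebra_simps)
    then show "e_mod q (- (int h * int (P + 1 + i))) = ?z ^ (P + 1) * ?z ^ i"
      by (simp only: e_mod_power e_mod_add)
  qed
  also have "\<dots> = ?z ^ (P + 1) * (\<Sum>i<r. ?z ^ i)"
    by (simp add: sum_distrib_left)
  also have "(\<Sum>i<r. ?z ^ i) = (?z ^ r - 1) / (?z - 1)"
    by (rule geometric_sum[OF ne])
  finally have "norm (\<Sum>j\<in>{P<..P + r}. e_mod q (- (int h * int j))) = norm (?z ^ r - 1) / norm (?z - 1)"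
    by (simp add: norm_mult norm_power norm_divide)
  also have "\<dots> \<le> 2 / (2 * real (min h (q - h)) / real q)"
  proof (rule frac_le)
    show "norm (?z ^ r - 1) \<le> 2"
      using norm_triangle_ineq4[of "?z ^ r" 1] by (simp add: norm_power)
  qed (use m assms ge in auto)
  finally show ?thesis
    using False m by (simp add: dirichlet_bound_def)
qed

lemma sum_dirichlet_bound_le:
  assumes "q > 1"
  shows "(\<Sum>h<q. dirichlet_bound q h) \<le> 3 + 2 * ln (real q)"
proof -
  have "(\<Sum>h<q. dirichlet_bound q h) = dirichlet_bound q 0 + (\<Sum>h\<in>{0<..<q}. dirichlet_bound q h)"
  proof -
    have "{..<q} = insert 0 {0<..<q}" using assms by auto
    then show ?thesis by simp
  qed
  also have "\<dots> \<le> 1 + (\<Sum>h\<in>{0<..<q}. 1 / real h + 1 / real (q - h))"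
    by (intro add_mono sum_mono) (auto simp: dirichlet_bound_def min_def)
  also have "(\<Sum>h\<in>{0<..<q}. 1 / real h + 1 / real (q - h)) = (\<Sum>h\<in>{0<..<q}. 1 / real h) + (\<Sum>h\<in>{0<..<q}. 1 / real (q - h))"
    by (rule sum.distrib)
  also have "(\<Sum>h\<in>{0<..<q}. 1 / real (q - h)) = (\<Sum>h\<in>{0<..<q}. 1 / real h)"
    by (rule sum.reindex_bij_witness[of _ "\<lambda>h. q - h" "\<lambda>h. q - h"]) auto
  also have "(\<Sum>h\<in>{0<..<q}. 1 / real h) \<le> (\<Sum>h\<in>{0<..q}. 1 / real h)"
    by (rule sum_mono2) auto
  finally have "(\<Sum>h<q. dirichlet_bound q h) \<le> 1 + ((\<Sum>h\<in>{0<..q}. 1 / real h) + (\<Sum>h\<in>{0<..q}. 1 / real h))"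
    by simp
  also have "\<dots> \<le> 1 + ((1 + ln (real q)) + (1 + ln (real q)))"
    using assms by (intro add_mono sum_inverse_atMost_le order_refl) auto
  finally show ?thesis by simp
qed

section \<open>Full periods and completion\<close>

lemma sum_periodic_window:
  fixes G :: "nat \<Rightarrow> 'a::ab_group_add"
  assumes "\<And>n. G (n + q) = G n"
  shows "(\<Sum>n\<in>{P<..P + q}. G n) = (\<Sum>n\<in>{0<..q}. G n)"
proof (induction P)
  case (Suc P)
  have "(\<Sum>n\<in>{P<..Suc (P + q)}. G n) = (\<Sum>n\<in>{P<..P + q}. G n) + G (Suc P + q)"
  proof -
    have "{P<..Suc (P + q)} = insert (Suc P + q) {P<..P + q}" by auto
    then show ?thesis by (simp add: add.commute)
  qed
  moreover have "(\<Sum>n\<in>{P<..Suc (P + q)}. G n) = (\<Sum>n\<in>{Suc P<..Suc P + q}. G n) + G (Suc P)"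
  proof -
    have "{P<..Suc (P + q)} = insert (Suc P) {Suc P<..Suc P + q}" by auto
    then show ?thesis by (simp add: add.commute)
  qed
  ultimately show ?case using Suc assms[of "Suc P"] by simp
qed simp

lemma sum_periodic_windows:
  fixes G :: "nat \<Rightarrow> 'a::comm_ring_1"
  assumes "\<And>n. G (n + q) = G n"
  shows "(\<Sum>n\<in>{P<..P + (k * q + r)}. G n) = of_nat k * (\<Sum>n\<in>{0<..q}. G n) + (\<Sum>n\<in>{P<..P + r}. G n)"
proof (induction k)
  case (Suc k)
  have "{P<..P + (Suc k * q + r)} = {P<..P + q} \<union> {P + q<..P + q + (k * q + r)}" by auto
  then have "(\<Sum>n\<in>{P<..P + (Suc k * q + r)}. G n)
    = (\<Sum>n\<in>{P<..P + q}. G n) + (\<Sum>n\<in>{P + q<..P + q + (k * q + r)}. G n)"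
    by (simp add: sum.union_disjoint)
  also have "(\<Sum>n\<in>{P<..P + q}. G n) = (\<Sum>n\<in>{0<..q}. G n)"
    using assms by (rule sum_periodic_window)
  also have "(\<Sum>n\<in>{P + q<..P + q + (k * q + r)}. G n) = (\<Sum>n\<in>{P<..P + (k * q + r)}. G (n + q))"
    by (rule sum.reindex_bij_witness[of _ "\<lambda>n. n + q" "\<lambda>n. n - q"]) auto
  finally show ?case
    using Suc assms by (simp add: algebra_simps)
qed simp

context kl_modulus
begin

text \<open>The summand is extended by zero to non-units. It stays q-periodic, sums run over plain
  intervals, and Vaughan's identity applies to it without coprimality conditions.\<close>

definition kT :: "int \<Rightarrow> int \<Rightarrow> nat \<Rightarrow> complex" where
  "kT u v n = (if coprime n q then e_mod q (u * iv n + v * int n) else 0)"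

lemma kS_eq_sum_kT: "finite A \<Longrightarrow> kS A u v = (\<Sum>n\<in>A. kT u v n)"
  unfolding kS_def un_def kT_def by (simp add: sum.inter_filter)

lemma kT_periodic: "kT u v (n + q) = kT u v n"
proof -
  have cop: "coprime (n + q) q \<longleftrightarrow> coprime n q"
    unfolding coprime_iff_gcd_eq_1 by simp
  show ?thesis
  proof (cases "coprime n q")
    case True
    have "[iv n = iv (n + q)] (mod int q)"
      by (rule iv_cong_cong[OF True]) (simp add: Cong.cong_def)
    then have "[u * iv (n + q) + v * int (n + q) = u * iv n + v * int n] (mod int q)"
      by (intro cong_add cong_scalar_left) (simp_all add: cong_sym, simp add: Cong.cong_def)
    then show ?thesis
      using True cop e_mod_cong[OF _ q_pos] by (simp add: kT_def)
  qed (use cop in \<open>simp add: kT_def\<close>)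
qed

lemma kS_window: "kS {P<..P + q} u v = kS {0<..q} u v"
  by (simp add: kS_eq_sum_kT sum_periodic_window kT_periodic)

text \<open>Membership in the shorter window is detected by additive characters modulo q. The target
  is a window of any length L <= q and not only a full period: in the type II sums r varies with
  (x1, x2), and a common short window makes a moment bound available that is smaller than the
  complete one.\<close>

lemma kS_completion:
  assumes "r \<le> L" "L \<le> q"
  shows "norm (kS {P<..P + r} u v) \<le> (\<Sum>h<q. dirichlet_bound q h * norm (kS {P<..P + L} u (v + int h)))"
proof -
  define c where "c h = (\<Sum>j\<in>{P<..P + r}. e_mod q (- (int h * int j)))" for h
  have "(\<Sum>h<q. c h * kS {P<..P + L} u (v + int h)) = of_nat q * kS {P<..P + r} u v"
  proof -
    have "(\<Sum>h<q. c h * kS {P<..P + L} u (v + int h))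
      = (\<Sum>h<q. \<Sum>n\<in>un {P<..P + L}. \<Sum>j\<in>{P<..P + r}.
          e_mod q (u * iv n + v * int n) * e_mod q (int h * (int n - int j)))"
      unfolding c_def kS_def sum_product
      by (subst (2) sum.swap, intro sum.cong refl)
         (simp add: e_mod_add[symmetric] algebra_simps)
    also have "\<dots> = (\<Sum>n\<in>un {P<..P + L}. \<Sum>j\<in>{P<..P + r}. \<Sum>h<q.
          e_mod q (u * iv n + v * int n) * e_mod q (int h * (int n - int j)))"
      by (rule trans[OF sum.swap], rule sum.cong[OF refl], rule sum.swap)
    also have "\<dots> = (\<Sum>n\<in>un {P<..P + L}. e_mod q (u * iv n + v * int n) * (\<Sum>j\<in>{P<..P + r}. if j = n then of_nat q else 0))"
    proof (intro sum.cong refl)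
      fix n assume n: "n \<in> un {P<..P + L}"
      have "(\<Sum>h<q. e_mod q (int h * (int n - int j))) = (if j = n then of_nat q else 0)" if "j \<in> {P<..P + r}" for j
      proof -
        \<comment> \<open>Both points lie in one window of length L <= q, so congruence modulo q is
          equality.\<close>
        have "\<bar>int n - int j\<bar> < int q" using n that assms by (auto simp: un_def)
        then have "int q dvd int n - int j \<longleftrightarrow> j = n"
          using zdvd_not_zless[of "\<bar>int n - int j\<bar>" "int q"] by (cases "j = n") auto
        then show ?thesis by (simp add: sum_e_mod)
      qed
      then show "(\<Sum>j\<in>{P<..P + r}. \<Sum>h<q. e_mod q (u * iv n + v * int n) * e_mod q (int h * (int n - int j)))
        = e_mod q (u * iv n + v * int n) * (\<Sum>j\<in>{P<..P + r}. if j = n then of_nat q else 0)"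
        by (simp add: sum_distrib_left[symmetric])
    qed
    also have "\<dots> = (\<Sum>n\<in>un {P<..P + L}. if n \<in> {P<..P + r} then of_nat q * e_mod q (u * iv n + v * int n) else 0)"
      by (intro sum.cong refl) (simp add: sum.delta)
    also have "\<dots> = (\<Sum>n\<in>un {P<..P + r}. of_nat q * e_mod q (u * iv n + v * int n))"
      by (rule sum.mono_neutral_cong_right) (use assms in \<open>auto simp: un_def\<close>)
    finally show ?thesis by (simp add: kS_def sum_distrib_left)
  qed
  then have "real q * norm (kS {P<..P + r} u v) = norm (\<Sum>h<q. c h * kS {P<..P + L} u (v + int h))"
    by (simp add: norm_mult)
  also have "\<dots> \<le> (\<Sum>h<q. norm (c h) * norm (kS {P<..P + L} u (v + int h)))"
    by (rule order_trans[OF norm_sum]) (simp add: norm_mult)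
  also have "\<dots> \<le> (\<Sum>h<q. real q * dirichlet_bound q h * norm (kS {P<..P + L} u (v + int h)))"
    unfolding c_def using assms by (intro sum_mono mult_right_mono norm_sum_e_mod_le) auto
  also have "\<dots> = real q * (\<Sum>h<q. dirichlet_bound q h * norm (kS {P<..P + L} u (v + int h)))"
    by (simp add: sum_distrib_left mult.assoc)
  finally show ?thesis by simp
qed

text \<open>The n div q full periods each reproduce the complete sum; only the remainder of length n
  mod q is completed.\<close>

lemma kS_incomplete:
  assumes "n mod q \<le> L" "L \<le> q"
  shows "norm (kS {P<..P + n} u v) \<le> real n / real q * norm (kS {0<..q} u v)
    + (\<Sum>h<q. dirichlet_bound q h * norm (kS {P<..P + L} u (v + int h)))"
proof -
  have "kS {P<..P + n} u v = kS {P<..P + (n div q * q + n mod q)} u v"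
    by simp
  also have "\<dots> = of_nat (n div q) * kS {0<..q} u v + kS {P<..P + n mod q} u v"
    unfolding kS_eq_sum_kT[OF finite_greaterThanAtMost] by (rule sum_periodic_windows) (rule kT_periodic)
  finally have "norm (kS {P<..P + n} u v) \<le> real (n div q) * norm (kS {0<..q} u v) + norm (kS {P<..P + n mod q} u v)"
    by (metis norm_mult norm_of_nat norm_triangle_ineq)
  also have "\<dots> \<le> real n / real q * norm (kS {0<..q} u v)
    + (\<Sum>h<q. dirichlet_bound q h * norm (kS {P<..P + L} u (v + int h)))"
    using of_nat_div_le_of_nat[of n q, where ?'a = real] assms
    by (intro add_mono mult_right_mono kS_completion) auto
  finally show ?thesis .
qed

lemma norm_kloosterman_le:
  assumes "coprime u (int q)"
  shows "norm (kS {0<..q} u v) \<le> 2 * real (divisor_tau q) * real q powr (3 / 4)"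
proof -
  have tau: "real (divisor_tau q) \<ge> 1"
    using divisor_tau_ge_1[OF q_pos] by simp
  have "norm (kS {0<..q} u v) ^ 4 \<le> 12 * real (divisor_tau q) ^ 3 * real q ^ 3"
    by (rule kloosterman_le) fact
  also have "\<dots> \<le> 16 * real (divisor_tau q) ^ 4 * real q ^ 3"
  proof (rule mult_right_mono)
    have "12 * real (divisor_tau q) ^ 3 \<le> (16 * real (divisor_tau q)) * real (divisor_tau q) ^ 3"
      using tau by (intro mult_right_mono) auto
    then show "12 * real (divisor_tau q) ^ 3 \<le> 16 * real (divisor_tau q) ^ 4"
      by (simp add: eval_nat_numeral mult_ac)
  qed simp
  also have "\<dots> = (2 * real (divisor_tau q) * real q powr (3 / 4)) ^ 4"
    by (simp add: power_mult_distrib powr_power)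
  finally show ?thesis
    by (rule power_le_imp_le_base[of _ 3, simplified]) simp
qed

section \<open>Type I and type II sums\<close>

lemma kT_mult:
  assumes "coprime m q"
  shows "kT u v (m * k) = kT (u * iv m) (v * int m) k"
proof (cases "coprime k q")
  case True
  have "[iv (m * k) = iv m * iv k] (mod int q)"
    by (rule iv_cong_mult[OF assms True]) simp
  then have "[u * iv (m * k) + v * int (m * k) = u * (iv m * iv k) + v * (int m * int k)] (mod int q)"
    by (intro cong_add cong_scalar_left) simp_all
  then show ?thesis
    using True assms e_mod_cong[OF _ q_pos] by (simp add: kT_def mult.assoc)
qed (simp add: kT_def)

text \<open>Replacing k by m k changes (a, b) into (a/m, b m). Completion moves only the second
  parameter and a/m remains a unit, so \<open>norm_kloosterman_le\<close> covers every
  frequency.\<close>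

lemma type_I_bound:
  assumes "coprime a (int q)"
  shows "norm (\<Sum>k\<in>{P<..P + n}. kT a b (m * k))
    \<le> (real n / real q + (3 + 2 * ln (real q))) * (2 * real (divisor_tau q) * real q powr (3 / 4))"
proof (cases "coprime m q")
  case True
  let ?u = "a * iv m" and ?v = "b * int m"
  let ?B = "2 * real (divisor_tau q) * real q powr (3 / 4)"
  have u: "coprime ?u (int q)"
    using assms True by (simp add: iv_def)
  have "(\<Sum>k\<in>{P<..P + n}. kT a b (m * k)) = kS {P<..P + n} ?u ?v"
    by (simp add: kS_eq_sum_kT kT_mult[OF True])
  also have "norm \<dots> \<le> real n / real q * norm (kS {0<..q} ?u ?v)
    + (\<Sum>h<q. dirichlet_bound q h * norm (kS {P<..P + q} ?u (?v + int h)))"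
    by (rule kS_incomplete) (simp_all add: less_imp_le)
  also have "\<dots> \<le> real n / real q * ?B + (\<Sum>h<q. dirichlet_bound q h * ?B)"
    unfolding kS_window
    by (intro add_mono mult_left_mono sum_mono norm_kloosterman_le u) (auto simp: dirichlet_bound_def)
  also have "\<dots> = (real n / real q + (\<Sum>h<q. dirichlet_bound q h)) * ?B"
    by (simp add: sum_distrib_right distrib_right)
  also have "\<dots> \<le> (real n / real q + (3 + 2 * ln (real q))) * ?B"
    by (intro mult_right_mono add_left_mono sum_dirichlet_bound_le q_gt_1) simp
  finally show ?thesis .
next
  case False
  then have "kT a b (m * k) = 0" for k by (simp add: kT_def)
  then show ?thesis using q_gt_1 by (simp add: add_nonneg_nonneg)
qed

text \<open>The lengths depend on the pair because the cut-offs of a hyperbola do. Full periods lead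
  to \<open>sum_kS_complete_le\<close>. The remainders are completed to one common window, where
  Cauchy-Schwarz passes from first to second moments and \<open>sum_kS_sq_le\<close>
  applies.\<close>

lemma sum_kS_incomplete_le:
  assumes "coprime a (int q)" "coprime b (int q)" and A: "A \<subseteq> {0<..Z}" and Z: "Z \<ge> 1"
    and N: "N \<ge> 1" "real Z \<le> 2 * real N" and n: "\<And>x y. n x y \<le> N"
  shows "(\<Sum>(x1, x2)\<in>un A \<times> un A. norm (kS {P<..P + n x1 x2} (a * (iv x1 - iv x2)) (b * (int x1 - int x2))))
    \<le> real N / real q * (sqrt (4 * real Z ^ 4 / real q + 4 * real Z ^ 2 * (1 + ln (real Z)))
          * sqrt (12 * real (divisor_tau q) ^ 3 * real q ^ 2))
      + (3 + 2 * ln (real q)) * (real Z * (real (divisor_tau q) * sqrt (18 * real q * real Z * real N)))"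
    (is "_ \<le> real N / real q * ?W + _ * ?V")
proof -
  \<comment> \<open>A remainder is at most N and at most q. Respecting both keeps \<open>J\<close>
    of the window of order L^2, up to the divisor factor.\<close>
  define L where "L = min N q"
  let ?u = "\<lambda>p. a * (iv (fst p) - iv (snd p))"
  let ?v = "\<lambda>p. b * (int (fst p) - int (snd p))"
  let ?U = "un A \<times> un A"
  have finA: "finite A" using A finite_subset by blast
  have card_un: "card (un A) \<le> Z"
    using card_mono[of "{0<..Z}" "un A"] A by (auto simp: un_def)
  have L: "L \<le> q" "L \<ge> 1" using N q_gt_1 by (auto simp: L_def)
  have V: "(\<Sum>p\<in>?U. norm (kS {P<..P + L} (?u p) (?v p + int h))) \<le> ?V" for h
  proof -
    have "(\<Sum>p\<in>?U. norm (kS {P<..P + L} (?u p) (?v p + int h)) * 1)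
      \<le> sqrt ((\<Sum>p\<in>?U. (norm (kS {P<..P + L} (?u p) (?v p + int h)))\<^sup>2) * (\<Sum>p\<in>?U. 1\<^sup>2))"
      by (rule real_le_rsqrt) (rule Cauchy_Schwarz_ineq_sum)
    also have "\<dots> \<le> sqrt ((real q * sqrt (real (J A) * real (J {P<..P + L}))) * (real Z)\<^sup>2)"
    proof (intro real_sqrt_le_mono mult_mono)
      show "(\<Sum>p\<in>?U. (norm (kS {P<..P + L} (?u p) (?v p + int h)))\<^sup>2) \<le> real q * sqrt (real (J A) * real (J {P<..P + L}))"
        using sum_kS_sq_le[of A "{P<..P + L}" a b "int h"] finA assms(1,2) by (simp add: split_def)
      have "card (un A) * card (un A) \<le> Z * Z" using card_un by (rule mult_le_mono) fact
      then show "(\<Sum>p\<in>?U. 1\<^sup>2) \<le> (real Z)\<^sup>2"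
        by (simp add: card_cartesian_product power2_eq_square flip: of_nat_mult)
    qed (auto intro: sum_nonneg)
    also have "sqrt (real (J A) * real (J {P<..P + L})) \<le> real (divisor_tau q) ^ 2 * (18 * real Z * real N)"
    proof (rule real_le_lsqrt)
      have "real (J A) * real (J {P<..P + L})
        \<le> (3 * real (divisor_tau q) ^ 2 * (real Z ^ 2 * (1 + real Z / real q) ^ 2))
          * (3 * real (divisor_tau q) ^ 2 * (real L ^ 2 * (1 + real L / real q) ^ 2))"
        using J_le[of A 0 Z] J_le[OF order_refl, of L P] A Z L by (intro mult_mono) auto
      also have "(1 + real L / real q) ^ 2 \<le> 2 ^ 2"
        using L q_pos by (intro power_mono) auto
      finally have "real (J A) * real (J {P<..P + L})
        \<le> (3 * real (divisor_tau q) ^ 2 * (real Z ^ 2 * (1 + real Z / real q) ^ 2))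
          * (3 * real (divisor_tau q) ^ 2 * (real L ^ 2 * 2 ^ 2))"
        by (simp add: mult_left_mono)
      also have "\<dots> = (real (divisor_tau q) ^ 2 * (6 * real Z * (real L * (1 + real Z / real q)))) ^ 2"
      proof -
        have "(3 * t * (z ^ 2 * x ^ 2)) * (3 * t * (l ^ 2 * 2 ^ 2)) = (t * (6 * z * (l * x))) ^ 2" for t z x l :: real
          by (simp add: power2_eq_square)
        then show ?thesis .
      qed
      also have "\<dots> \<le> (real (divisor_tau q) ^ 2 * (6 * real Z * (3 * real N))) ^ 2"
      proof (intro power_mono mult_left_mono)
        \<comment> \<open>The constants 3 * 3 * 2^2 give 6^2 under the root, and L (1 + Z/q) <= N +
          Z <= 3 N by Z <= 2 N, hence 18 = 6 * 3. This is where x has to be the shorter variable up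
          to a factor 2.\<close>
        have "real L * (1 + real Z / real q) = real L + real L / real q * real Z"
          by (simp add: algebra_simps)
        also have "\<dots> \<le> real N + 1 * real Z"
          using L q_pos by (intro add_mono mult_right_mono) (auto simp: L_def)
        finally show "real L * (1 + real Z / real q) \<le> 3 * real N"
          using N by linarith
      qed auto
      finally show "real (J A) * real (J {P<..P + L}) \<le> (real (divisor_tau q) ^ 2 * (18 * real Z * real N))\<^sup>2"
        by (simp add: mult_ac)
    qed auto
    also have "sqrt (real q * (real (divisor_tau q) ^ 2 * (18 * real Z * real N)) * (real Z)\<^sup>2)
      = ?V"
    proof -
      have "real q * (real (divisor_tau q) ^ 2 * (18 * real Z * real N)) * (real Z)\<^sup>2
        = (real Z * real (divisor_tau q))\<^sup>2 * (18 * real q * real Z * real N)"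
        by (simp add: power_mult_distrib mult_ac)
      then show ?thesis by (simp add: real_sqrt_mult)
    qed
    finally show ?thesis by (simp add: mult_left_mono mult_right_mono)
  qed
  have "(\<Sum>(x1, x2)\<in>un A \<times> un A. norm (kS {P<..P + n x1 x2} (a * (iv x1 - iv x2)) (b * (int x1 - int x2))))
    = (\<Sum>p\<in>?U. norm (kS {P<..P + n (fst p) (snd p)} (?u p) (?v p)))"
    by (simp add: split_def)
  also have "\<dots> \<le> (\<Sum>p\<in>?U. real N / real q * norm (kS {0<..q} (?u p) (?v p))
      + (\<Sum>h<q. dirichlet_bound q h * norm (kS {P<..P + L} (?u p) (?v p + int h))))"
  proof (rule sum_mono)
    fix p
    let ?n = "n (fst p) (snd p)"
    have "?n mod q \<le> L"
      using order_trans[OF mod_less_eq_dividend n] less_imp_le[OF mod_less_divisor[OF q_pos]]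
      by (simp add: L_def)
    then have "norm (kS {P<..P + ?n} (?u p) (?v p)) \<le> real ?n / real q * norm (kS {0<..q} (?u p) (?v p))
      + (\<Sum>h<q. dirichlet_bound q h * norm (kS {P<..P + L} (?u p) (?v p + int h)))"
      using L by (intro kS_incomplete)
    also have "real ?n / real q * norm (kS {0<..q} (?u p) (?v p)) \<le> real N / real q * norm (kS {0<..q} (?u p) (?v p))"
      using n by (intro mult_right_mono divide_right_mono) auto
    finally show "norm (kS {P<..P + ?n} (?u p) (?v p)) \<le> real N / real q * norm (kS {0<..q} (?u p) (?v p))
      + (\<Sum>h<q. dirichlet_bound q h * norm (kS {P<..P + L} (?u p) (?v p + int h)))"
      by simp
  qed
  also have "\<dots> = real N / real q * (\<Sum>p\<in>?U. norm (kS {0<..q} (?u p) (?v p)))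
      + (\<Sum>h<q. dirichlet_bound q h * (\<Sum>p\<in>?U. norm (kS {P<..P + L} (?u p) (?v p + int h))))"
    by (simp add: sum.distrib sum_distrib_left sum.swap[of _ ?U])
  also have "\<dots> \<le> real N / real q * ?W + (\<Sum>h<q. dirichlet_bound q h * ?V)"
  proof (intro add_mono mult_left_mono sum_mono V)
    show "(\<Sum>p\<in>?U. norm (kS {0<..q} (?u p) (?v p))) \<le> ?W"
      using sum_kS_complete_le[OF assms(1,2) A Z] by (simp add: split_def)
  qed (auto simp: dirichlet_bound_def)
  also have "\<dots> = real N / real q * ?W + (\<Sum>h<q. dirichlet_bound q h) * ?V"
    by (simp only: sum_distrib_right)
  also have "\<dots> \<le> real N / real q * ?W + (3 + 2 * ln (real q)) * ?V"
    by (intro add_left_mono mult_right_mono sum_dirichlet_bound_le q_gt_1) simp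
  finally show ?thesis .
qed

text \<open>Cauchy-Schwarz in y removes \<beta>. Opening the square, the sum over y for a pair (x1,
  x2) is an incomplete Kloosterman sum with parameters a(1/x1 - 1/x2) and b(x1 - x2), whose length
  is cut by both B x1 and B x2.\<close>

lemma type_II_bound:
  fixes \<alpha> \<beta> :: "nat \<Rightarrow> complex"
  assumes "coprime a (int q)" "coprime b (int q)" and A: "A \<subseteq> {0<..Z}" and Z: "Z \<ge> 1"
    and N: "N \<ge> 1" "real Z \<le> 2 * real N" and B: "\<And>x. x \<in> A \<Longrightarrow> B x \<le> P + N"
    and \<alpha>: "\<And>x. x \<in> A \<Longrightarrow> norm (\<alpha> x) \<le> \<alpha>0" and \<beta>: "\<And>y. y \<in> {P<..P + N} \<Longrightarrow> norm (\<beta> y) \<le> \<beta>0"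
    and nonneg: "\<alpha>0 \<ge> 0" "\<beta>0 \<ge> 0"
  shows "(norm (\<Sum>x\<in>A. \<Sum>y\<in>{P<..B x}. \<alpha> x * \<beta> y * kT a b (x * y)))\<^sup>2
    \<le> \<beta>0\<^sup>2 * real N * (\<alpha>0\<^sup>2 * (real N / real q * (sqrt (4 * real Z ^ 4 / real q + 4 * real Z ^ 2 * (1 + ln (real Z)))
          * sqrt (12 * real (divisor_tau q) ^ 3 * real q ^ 2))
      + (3 + 2 * ln (real q)) * (real Z * (real (divisor_tau q) * sqrt (18 * real q * real Z * real N)))))"
    (is "_ \<le> \<beta>0\<^sup>2 * real N * (\<alpha>0\<^sup>2 * ?M)")
proof -
  let ?Y = "{P<..P + N}"
  \<comment> \<open>The cut-off y <= B x is moved into the coefficient, so that y runs over one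
    fixed interval before Cauchy-Schwarz is applied.\<close>
  define t where "t x y = (if y \<le> B x then \<alpha> x * kT a b (x * y) else 0)" for x y
  define g where "g y = (\<Sum>x\<in>A. t x y)" for y
  have finA: "finite A" using A finite_subset by blast
  have "(\<Sum>x\<in>A. \<Sum>y\<in>{P<..B x}. \<alpha> x * \<beta> y * kT a b (x * y)) = (\<Sum>x\<in>A. \<Sum>y\<in>?Y. \<beta> y * t x y)"
  proof (rule sum.cong[OF refl])
    fix x assume "x \<in> A"
    then show "(\<Sum>y\<in>{P<..B x}. \<alpha> x * \<beta> y * kT a b (x * y)) = (\<Sum>y\<in>?Y. \<beta> y * t x y)"
      using B[of x] by (intro sum.mono_neutral_cong_left) (auto simp: t_def)
  qed
  also have "\<dots> = (\<Sum>y\<in>?Y. \<beta> y * g y)"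
    unfolding g_def sum_distrib_left by (rule sum.swap)
  finally have "norm (\<Sum>x\<in>A. \<Sum>y\<in>{P<..B x}. \<alpha> x * \<beta> y * kT a b (x * y)) \<le> (\<Sum>y\<in>?Y. norm (\<beta> y) * norm (g y))"
    by (metis (no_types, lifting) norm_mult norm_sum sum.cong)
  then have "(norm (\<Sum>x\<in>A. \<Sum>y\<in>{P<..B x}. \<alpha> x * \<beta> y * kT a b (x * y)))\<^sup>2 \<le> (\<Sum>y\<in>?Y. norm (\<beta> y) * norm (g y))\<^sup>2"
    by (intro power_mono) auto
  also have "\<dots> \<le> (\<Sum>y\<in>?Y. (norm (\<beta> y))\<^sup>2) * (\<Sum>y\<in>?Y. (norm (g y))\<^sup>2)"
    by (rule Cauchy_Schwarz_ineq_sum)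
  also have "\<dots> \<le> (\<beta>0\<^sup>2 * real N) * (\<alpha>0\<^sup>2 * ?M)"
  proof (rule mult_mono)
    have "(\<Sum>y\<in>?Y. (norm (\<beta> y))\<^sup>2) \<le> (\<Sum>y\<in>?Y. \<beta>0\<^sup>2)"
      by (intro sum_mono power_mono \<beta>) auto
    then show "(\<Sum>y\<in>?Y. (norm (\<beta> y))\<^sup>2) \<le> \<beta>0\<^sup>2 * real N"
      by (simp add: mult.commute)
    have "complex_of_real (\<Sum>y\<in>?Y. (norm (g y))\<^sup>2) = (\<Sum>y\<in>?Y. g y * cnj (g y))"
      by (simp only: of_real_sum complex_norm_square)
    also have "\<dots> = (\<Sum>y\<in>?Y. \<Sum>x1\<in>A. \<Sum>x2\<in>A. t x1 y * cnj (t x2 y))"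
      by (simp add: g_def sum_product)
    also have "\<dots> = (\<Sum>x1\<in>A. \<Sum>x2\<in>A. \<Sum>y\<in>?Y. t x1 y * cnj (t x2 y))"
      by (rule trans[OF sum.swap], rule sum.cong[OF refl], rule sum.swap)
    also have "\<dots> = (\<Sum>p\<in>A \<times> A. \<Sum>y\<in>?Y. t (fst p) y * cnj (t (snd p) y))"
      by (subst sum.cartesian_product) (simp add: split_def)
    also have "\<dots> = (\<Sum>p\<in>un A \<times> un A. \<Sum>y\<in>?Y. t (fst p) y * cnj (t (snd p) y))"
    proof (rule sum.mono_neutral_right)
      have zero: "t x y = 0" if "x \<notin> un A" "x \<in> A" for x y
        using that by (simp add: t_def kT_def un_def)
      show "\<forall>p\<in>A \<times> A - un A \<times> un A. (\<Sum>y\<in>?Y. t (fst p) y * cnj (t (snd p) y)) = 0"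
      proof
        fix p assume "p \<in> A \<times> A - un A \<times> un A"
        then have "fst p \<in> A" "snd p \<in> A" "fst p \<notin> un A \<or> snd p \<notin> un A"
          by (auto simp: mem_Times_iff)
        then show "(\<Sum>y\<in>?Y. t (fst p) y * cnj (t (snd p) y)) = 0"
          using zero by auto
      qed
    qed (use finA in \<open>auto simp: un_def\<close>)
    finally have "(\<Sum>y\<in>?Y. (norm (g y))\<^sup>2) = norm (\<Sum>p\<in>un A \<times> un A. \<Sum>y\<in>?Y. t (fst p) y * cnj (t (snd p) y))"
      by (metis (no_types, lifting) abs_of_nonneg norm_of_real sum_nonneg zero_le_power2)
    also have "\<dots> \<le> (\<Sum>p\<in>un A \<times> un A. norm (\<Sum>y\<in>?Y. t (fst p) y * cnj (t (snd p) y)))"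
      by (rule norm_sum)
    also have "\<dots> \<le> (\<Sum>p\<in>un A \<times> un A. \<alpha>0\<^sup>2 * norm (kS {P<..P + (min N (min (B (fst p)) (B (snd p)) - P))}
        (a * (iv (fst p) - iv (snd p))) (b * (int (fst p) - int (snd p)))))"
    proof (rule sum_mono, clarify)
      fix x1 x2 assume x: "x1 \<in> un A" "x2 \<in> un A"
      then have cop: "coprime x1 q" "coprime x2 q" and xA: "x1 \<in> A" "x2 \<in> A" by (auto simp: un_def)
      let ?I = "{P<..P + (min N (min (B x1) (B x2) - P))}"
      have "(\<Sum>y\<in>?Y. t x1 y * cnj (t x2 y)) = (\<Sum>y\<in>?I. \<alpha> x1 * cnj (\<alpha> x2) * kT (a * (iv x1 - iv x2)) (b * (int x1 - int x2)) y)"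
      proof (rule sum.mono_neutral_cong_right)
        show "\<forall>y\<in>?Y - ?I. t x1 y * cnj (t x2 y) = 0" by (auto simp: t_def)
        fix y assume "y \<in> ?I"
        then have "y \<le> B x1" "y \<le> B x2" by auto
        then show "t x1 y * cnj (t x2 y) = \<alpha> x1 * cnj (\<alpha> x2) * kT (a * (iv x1 - iv x2)) (b * (int x1 - int x2)) y"
          unfolding t_def kT_mult[OF cop(1)] kT_mult[OF cop(2)]
          by (auto simp: kT_def e_mod_minus[symmetric] e_mod_add[symmetric] algebra_simps)
      qed auto
      also have "\<dots> = \<alpha> x1 * cnj (\<alpha> x2) * kS ?I (a * (iv x1 - iv x2)) (b * (int x1 - int x2))"
        by (simp add: kS_eq_sum_kT sum_distrib_left)
      finally have "norm (\<Sum>y\<in>?Y. t x1 y * cnj (t x2 y))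
        = norm (\<alpha> x1) * norm (\<alpha> x2) * norm (kS ?I (a * (iv x1 - iv x2)) (b * (int x1 - int x2)))"
        by (simp add: norm_mult)
      also have "\<dots> \<le> \<alpha>0 * \<alpha>0 * norm (kS ?I (a * (iv x1 - iv x2)) (b * (int x1 - int x2)))"
        using xA nonneg by (intro mult_right_mono mult_mono \<alpha>) auto
      finally show "norm (\<Sum>y\<in>?Y. t (fst (x1, x2)) y * cnj (t (snd (x1, x2)) y))
        \<le> \<alpha>0\<^sup>2 * norm (kS {P<..P + (min N (min (B (fst (x1, x2))) (B (snd (x1, x2))) - P))}
        (a * (iv (fst (x1, x2)) - iv (snd (x1, x2)))) (b * (int (fst (x1, x2)) - int (snd (x1, x2)))))"
        by (simp add: power2_eq_square)
    qed
    also have "\<dots> \<le> \<alpha>0\<^sup>2 * ?M"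
      using mult_left_mono[OF sum_kS_incomplete_le[OF assms(1,2) A Z N, of "\<lambda>x y. min N (min (B x) (B y) - P)" P], of "\<alpha>0\<^sup>2"]
      by (simp add: split_def sum_distrib_left)
    finally show "(\<Sum>y\<in>?Y. (norm (g y))\<^sup>2) \<le> \<alpha>0\<^sup>2 * ?M" .
  qed (auto intro: sum_nonneg)
  finally show ?thesis .
qed

end

section \<open>Vaughan's identity\<close>

definition mu :: "nat \<Rightarrow> real" where
  "mu n = (if squarefree n then (-1) ^ card (prime_factors n) else 0)"

lemma abs_mu_le: "\<bar>mu n\<bar> \<le> 1"
  by (simp add: mu_def power_abs)

lemma mu_prime_mult:
  assumes "prime p" "\<not> p dvd d" "d > 0"
  shows "mu (p * d) = - mu d"
proof -
  have cop: "coprime p d"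
    using assms by (simp add: prime_imp_coprime)
  have "prime_factors (p * d) = insert p (prime_factors d)"
    using assms by (simp add: prime_factors_product prime_prime_factors)
  moreover have "p \<notin> prime_factors d"
    using assms by auto
  moreover have "squarefree (p * d) \<longleftrightarrow> squarefree d"
    using assms cop squarefree_mult_coprime[OF cop] squarefree_prime[of p] squarefree_mono[of d "p * d"] by auto
  ultimately show ?thesis
    by (simp add: mu_def)
qed

text \<open>Choose a prime p dividing n. Divisors divisible by p^2 contribute 0, and the others
  cancel in pairs d, p d with d prime to p.\<close>

lemma sum_mu:
  assumes "n > 0"
  shows "(\<Sum>d | d dvd n. mu d) = (if n = 1 then 1 else 0)"
proof (cases "n = 1")
  case True
  then show ?thesis by (simp add: mu_def)
next
  case False
  then obtain p where p: "prime p" "p dvd n" using prime_factor_nat by blast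
  have p0: "p > 0" using p by (simp add: prime_gt_0_nat)
  let ?S = "{d. d dvd n}"
  have fin: "finite ?S" using assms by simp
  have "(\<Sum>d\<in>?S. mu d) = (\<Sum>d\<in>{d\<in>?S. p dvd d}. mu d) + (\<Sum>d\<in>{d\<in>?S. \<not> p dvd d}. mu d)"
    using fin by (subst sum.union_disjoint[symmetric]) (auto intro!: sum.cong)
  also have "(\<Sum>d\<in>{d\<in>?S. p dvd d}. mu d) = (\<Sum>d\<in>{d\<in>?S. p dvd d \<and> \<not> p dvd d div p}. mu d)"
  proof (rule sum.mono_neutral_right)
    show "\<forall>d\<in>{d\<in>?S. p dvd d} - {d\<in>?S. p dvd d \<and> \<not> p dvd d div p}. mu d = 0"
    proof
      fix d assume "d \<in> {d\<in>?S. p dvd d} - {d\<in>?S. p dvd d \<and> \<not> p dvd d div p}"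
      then have "p ^ 2 dvd d"
        using p0 by (auto simp: power2_eq_square elim!: dvdE)
      moreover have "\<not> is_unit p" using p(1) not_prime_unit by blast
      ultimately have "\<not> squarefree d" by (auto simp: squarefree_def)
      then show "mu d = 0" by (simp add: mu_def)
    qed
  qed (use fin in auto)
  also have "\<dots> = (\<Sum>d\<in>{d\<in>?S. \<not> p dvd d}. mu (p * d))"
  proof (rule sum.reindex_bij_witness[of _ "\<lambda>d. p * d" "\<lambda>d. d div p"])
    fix d assume d: "d \<in> {d\<in>?S. p dvd d \<and> \<not> p dvd d div p}"
    then have "d div p dvd d" by (metis (lifting) dvd_div_mult_self dvd_triv_left mem_Collect_eq)
    with d show "p * (d div p) = d" "d div p \<in> {d\<in>?S. \<not> p dvd d}" "mu (p * (d div p)) = mu d"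
      using p0 by (auto intro: dvd_trans)
  next
    fix d assume d: "d \<in> {d\<in>?S. \<not> p dvd d}"
    then have "p * d dvd n"
      using p by (intro divides_mult) (auto simp: prime_imp_coprime)
    moreover show "p * d div p = d" using p by (simp add: prime_gt_0_nat)
    ultimately show "p * d \<in> {d\<in>?S. p dvd d \<and> \<not> p dvd d div p}"
      using d by simp
  qed
  also have "\<dots> = (\<Sum>d\<in>{d\<in>?S. \<not> p dvd d}. - mu d)"
    using assms p by (intro sum.cong refl mu_prime_mult) (auto intro: dvd_pos_nat)
  finally show ?thesis using False by (simp add: sum_negf)
qed

lemma sum_divisor_pairs:
  "(\<Sum>n\<in>{0<..N}. \<Sum>d | d dvd n. g d (n div d)) = (\<Sum>d\<in>{0<..N}. \<Sum>k\<in>{0<..N div d}. g d k)"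
  for g :: "nat \<Rightarrow> nat \<Rightarrow> 'a::comm_monoid_add"
proof -
  have "(\<Sum>n\<in>{0<..N}. \<Sum>d | d dvd n. g d (n div d)) = (\<Sum>(n, d)\<in>(SIGMA n:{0<..N}. {d. d dvd n}). g d (n div d))"
    by (rule sum.Sigma) auto
  also have "\<dots> = (\<Sum>(d, k)\<in>(SIGMA d:{0<..N}. {0<..N div d}). g d k)"
  proof (rule sum.reindex_bij_witness[of _ "\<lambda>(d, k). (d * k, d)" "\<lambda>(n, d). (d, n div d)"], goal_cases)
    case (1 p)
    then show ?case by auto
  next
    case (2 p)
    then obtain n d where p: "p = (n, d)" "0 < n" "n \<le> N" "d dvd n" by auto
    then obtain k where "n = d * k" by (elim dvdE)
    with p show ?case
      by (auto simp: less_eq_div_iff_mult_less_eq mult.commute intro: order_trans[of d "d * k" N])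
  next
    case (3 p)
    then show ?case by auto
  next
    case (4 p)
    then show ?case
      by (auto simp: less_eq_div_iff_mult_less_eq mult.commute)
  qed auto
  also have "\<dots> = (\<Sum>d\<in>{0<..N}. \<Sum>k\<in>{0<..N div d}. g d k)"
    by (rule sum.Sigma[symmetric]) auto
  finally show ?thesis .
qed

lemma moebius_inversion:
  fixes f :: "nat \<Rightarrow> real"
  assumes "n > 0"
  shows "(\<Sum>d | d dvd n. mu d * (\<Sum>e | e dvd n div d. f e)) = f n"
proof -
  have fin: "finite {d. d dvd n}" using assms by simp
  have "(\<Sum>d | d dvd n. mu d * (\<Sum>e | e dvd n div d. f e))
    = (\<Sum>d | d dvd n. \<Sum>e | e dvd n. if d * e dvd n then mu d * f e else 0)"
  proof (rule sum.cong[OF refl])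
    fix d assume d: "d \<in> {d. d dvd n}"
    have "d \<noteq> 0" using d assms by auto
    then have "e dvd n div d \<longleftrightarrow> d * e dvd n" for e
      using d dvd_div_iff_mult[of d n e] by (simp add: mult.commute)
    then have "{e. e dvd n div d} = {e \<in> {e. e dvd n}. d * e dvd n}"
      by (auto dest: dvd_mult_left dvd_mult_right)
    then show "mu d * (\<Sum>e | e dvd n div d. f e) = (\<Sum>e | e dvd n. if d * e dvd n then mu d * f e else 0)"
      using sum.inter_filter[OF fin, of "\<lambda>e. mu d * f e" "\<lambda>e. d * e dvd n"]
      by (simp only: sum_distrib_left)
  qed
  also have "\<dots> = (\<Sum>e | e dvd n. \<Sum>d | d dvd n. if d * e dvd n then mu d * f e else 0)"
    by (rule sum.swap)
  also have "\<dots> = (\<Sum>e | e dvd n. f e * (\<Sum>d | d dvd n div e. mu d))"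
  proof (rule sum.cong[OF refl])
    fix e assume e: "e \<in> {e. e dvd n}"
    have "e \<noteq> 0" using e assms by auto
    then have "d dvd n div e \<longleftrightarrow> d * e dvd n" for d
      using e dvd_div_iff_mult[of e n d] by (simp add: mult.commute)
    then have "{d. d dvd n div e} = {d \<in> {d. d dvd n}. d * e dvd n}"
      by (auto dest: dvd_mult_left dvd_mult_right)
    then show "(\<Sum>d | d dvd n. if d * e dvd n then mu d * f e else 0) = f e * (\<Sum>d | d dvd n div e. mu d)"
      using sum.inter_filter[OF fin, of "\<lambda>d. mu d * f e" "\<lambda>d. d * e dvd n"]
      by (simp only: sum_distrib_left mult.commute[of "f e"])
  qed
  also have "\<dots> = (\<Sum>e | e dvd n. if e = n then f n else 0)"
  proof (rule sum.cong[OF refl])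
    fix e assume "e \<in> {e. e dvd n}"
    then have "n div e > 0" "n div e = 1 \<longleftrightarrow> e = n"
      using assms by (auto elim!: dvdE)
    then show "f e * (\<Sum>d | d dvd n div e. mu d) = (if e = n then f n else 0)"
      by (simp add: sum_mu)
  qed
  also have "\<dots> = f n" using fin by simp
  finally show ?thesis .
qed

text \<open>Together with \<open>mangoldt_high\<close> this splits the convolution 1 * Lambda = ln
  according to the cut-off V. The high part vanishes up to V and lies between 0 and ln, so it serves
  as a type II coefficient.\<close>

definition mangoldt_low :: "nat \<Rightarrow> nat \<Rightarrow> real" where
  "mangoldt_low V k = (\<Sum>e | e dvd k. if e \<le> V then mangoldt e else 0)"

definition mangoldt_high :: "nat \<Rightarrow> nat \<Rightarrow> real" where
  "mangoldt_high V k = (\<Sum>e | e dvd k. if e \<le> V then 0 else mangoldt e)"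

lemma mangoldt_low_high:
  assumes "k > 0"
  shows "mangoldt_low V k + mangoldt_high V k = ln (real k)"
proof -
  have "mangoldt_low V k + mangoldt_high V k = (\<Sum>e | e dvd k. mangoldt e)"
    unfolding mangoldt_low_def mangoldt_high_def sum.distrib[symmetric] by (intro sum.cong) auto
  then show ?thesis using mangoldt_sum[of k, where ?'a = real] assms by simp
qed

lemma mangoldt_high_bounds:
  assumes "k > 0"
  shows "0 \<le> mangoldt_high V k" "mangoldt_high V k \<le> ln (real k)"
proof -
  have "0 \<le> mangoldt_low V k"
    unfolding mangoldt_low_def by (intro sum_nonneg) (auto simp: mangoldt_nonneg)
  then show "mangoldt_high V k \<le> ln (real k)"
    using mangoldt_low_high[OF assms, of V] by linarith
  show "0 \<le> mangoldt_high V k"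
    unfolding mangoldt_high_def by (intro sum_nonneg) (auto simp: mangoldt_nonneg)
qed

lemma mangoldt_high_eq_0:
  assumes "k > 0" "k \<le> V"
  shows "mangoldt_high V k = 0"
  unfolding mangoldt_high_def using assms by (intro sum.neutral) (auto dest: dvd_imp_le)

text \<open>Moebius inversion gives mu * \<open>mangoldt_high V\<close> = Lambda beyond V. For d <=
  U the high part is rewritten as ln minus the low part, which produces the two type I terms; the
  divisors d > U are left as the type II term.\<close>

lemma vaughan_pointwise:
  assumes "n > 0"
  shows "mangoldt n = (if n \<le> V then mangoldt n else 0)
    + (\<Sum>d | d dvd n. (if d \<le> U then mu d * ln (real (n div d)) else 0))
    - (\<Sum>d | d dvd n. (if d \<le> U then mu d * mangoldt_low V (n div d) else 0))
    + (\<Sum>d | d dvd n. (if d \<le> U then 0 else mu d * mangoldt_high V (n div d)))"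
proof -
  have "(\<Sum>d | d dvd n. mu d * mangoldt_high V (n div d)) = (if n \<le> V then 0 else mangoldt n)"
    unfolding mangoldt_high_def by (rule moebius_inversion) fact
  moreover have "(\<Sum>d | d dvd n. mu d * mangoldt_high V (n div d))
    = (\<Sum>d | d dvd n. (if d \<le> U then mu d * ln (real (n div d)) else 0)
       - (if d \<le> U then mu d * mangoldt_low V (n div d) else 0)
       + (if d \<le> U then 0 else mu d * mangoldt_high V (n div d)))"
  proof (rule sum.cong[OF refl])
    fix d assume "d \<in> {d. d dvd n}"
    then have "n div d > 0" using assms by (auto elim!: dvdE)
    from mangoldt_low_high[OF this, of V]
    have "mangoldt_high V (n div d) = ln (real (n div d)) - mangoldt_low V (n div d)" by simp
    then show "mu d * mangoldt_high V (n div d)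
      = (if d \<le> U then mu d * ln (real (n div d)) else 0)
       - (if d \<le> U then mu d * mangoldt_low V (n div d) else 0)
       + (if d \<le> U then 0 else mu d * mangoldt_high V (n div d))"
      by (simp add: right_diff_distrib)
  qed
  ultimately show ?thesis
    by (cases "n \<le> V") (simp_all add: sum.distrib sum_subtractf algebra_simps)
qed

lemma sum_mangoldt_low:
  fixes G :: "nat \<Rightarrow> complex"
  shows "(\<Sum>k\<in>{0<..M}. mangoldt_low V k * G k)
    = (\<Sum>e\<in>{0<..M}. if e \<le> V then mangoldt e * (\<Sum>l\<in>{0<..M div e}. G (e * l)) else 0)"
proof -
  have "(\<Sum>k\<in>{0<..M}. mangoldt_low V k * G k)
    = (\<Sum>k\<in>{0<..M}. \<Sum>e | e dvd k. (if e \<le> V then mangoldt e * G (e * (k div e)) else 0))"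
    by (intro sum.cong refl)
       (auto simp: mangoldt_low_def sum_distrib_right intro!: sum.cong)
  also have "\<dots> = (\<Sum>e\<in>{0<..M}. \<Sum>l\<in>{0<..M div e}. (if e \<le> V then mangoldt e * G (e * l) else 0))"
    by (rule sum_divisor_pairs)
  also have "\<dots> = (\<Sum>e\<in>{0<..M}. if e \<le> V then mangoldt e * (\<Sum>l\<in>{0<..M div e}. G (e * l)) else 0)"
    by (intro sum.cong refl) (simp add: sum_distrib_left)
  finally show ?thesis .
qed

lemma vaughan_sum:
  fixes F :: "nat \<Rightarrow> complex"
  assumes "U \<le> N" "V \<le> N"
  shows "(\<Sum>n\<in>{0<..N}. mangoldt n * F n)
    = (\<Sum>n\<in>{0<..V}. mangoldt n * F n)
      + (\<Sum>d\<in>{0<..U}. mu d * (\<Sum>k\<in>{0<..N div d}. ln (real k) * F (d * k)))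
      - (\<Sum>d\<in>{0<..U}. mu d * (\<Sum>e\<in>{0<..N div d}. if e \<le> V then
            mangoldt e * (\<Sum>l\<in>{0<..N div d div e}. F (d * (e * l))) else 0))
      + (\<Sum>d\<in>{U<..N}. \<Sum>k\<in>{V<..N div d}. mu d * mangoldt_high V k * F (d * k))"
proof -
  let ?g1 = "\<lambda>d k. (if d \<le> U then mu d * ln (real k) else 0) * F (d * k)"
  let ?g2 = "\<lambda>d k. (if d \<le> U then mu d * mangoldt_low V k else 0) * F (d * k)"
  let ?g3 = "\<lambda>d k. (if d \<le> U then 0 else mu d * mangoldt_high V k) * F (d * k)"
  let ?P = "\<lambda>g. \<Sum>n\<in>{0<..N}. \<Sum>d | d dvd n. g d (n div d)"
  have "(\<Sum>n\<in>{0<..N}. mangoldt n * F n)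
    = (\<Sum>n\<in>{0<..N}. (if n \<le> V then mangoldt n * F n else 0) + (\<Sum>d | d dvd n. ?g1 d (n div d))
       - (\<Sum>d | d dvd n. ?g2 d (n div d)) + (\<Sum>d | d dvd n. ?g3 d (n div d)))"
  proof (rule sum.cong[OF refl])
    fix n assume n: "n \<in> {0<..N}"
    have *: "(\<Sum>d | d dvd n. complex_of_real (h d) * F (d * (n div d))) = of_real (\<Sum>d | d dvd n. h d) * F n" for h
      by (simp add: sum_distrib_right)
    have "mangoldt n * F n = complex_of_real (mangoldt n) * F n"
      by simp
    also have "complex_of_real (mangoldt n) = complex_of_real ((if n \<le> V then mangoldt n else 0)
      + (\<Sum>d | d dvd n. (if d \<le> U then mu d * ln (real (n div d)) else 0))
      - (\<Sum>d | d dvd n. (if d \<le> U then mu d * mangoldt_low V (n div d) else 0))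
      + (\<Sum>d | d dvd n. (if d \<le> U then 0 else mu d * mangoldt_high V (n div d))))"
      using vaughan_pointwise[of n V U] n by (simp only: greaterThanAtMost_iff)
    finally show "mangoldt n * F n = (if n \<le> V then mangoldt n * F n else 0) + (\<Sum>d | d dvd n. ?g1 d (n div d))
       - (\<Sum>d | d dvd n. ?g2 d (n div d)) + (\<Sum>d | d dvd n. ?g3 d (n div d))"
      unfolding * by (simp add: algebra_simps)
  qed
  also have "\<dots> = (\<Sum>n\<in>{0<..N}. if n \<le> V then mangoldt n * F n else 0) + ?P ?g1 - ?P ?g2 + ?P ?g3"
    by (simp only: sum.distrib sum_subtractf)
  also have "(\<Sum>n\<in>{0<..N}. if n \<le> V then mangoldt n * F n else 0) = (\<Sum>n\<in>{0<..V}. mangoldt n * F n)"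
    using assms by (intro sum.mono_neutral_cong_right) auto
  also have "?P ?g1 = (\<Sum>d\<in>{0<..U}. mu d * (\<Sum>k\<in>{0<..N div d}. ln (real k) * F (d * k)))"
    unfolding sum_divisor_pairs[of ?g1 N] sum_distrib_left
    using assms by (intro sum.mono_neutral_cong_right) (auto simp: mult.assoc)
  also have "?P ?g2 = (\<Sum>d\<in>{0<..U}. mu d * (\<Sum>k\<in>{0<..N div d}. mangoldt_low V k * F (d * k)))"
    unfolding sum_divisor_pairs[of ?g2 N] sum_distrib_left
    using assms by (intro sum.mono_neutral_cong_right) (auto simp: mult.assoc)
  also have "\<dots> = (\<Sum>d\<in>{0<..U}. mu d * (\<Sum>e\<in>{0<..N div d}. if e \<le> V then
            mangoldt e * (\<Sum>l\<in>{0<..N div d div e}. F (d * (e * l))) else 0))"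
    by (simp only: sum_mangoldt_low)
  also have "?P ?g3 = (\<Sum>d\<in>{U<..N}. \<Sum>k\<in>{V<..N div d}. mu d * mangoldt_high V k * F (d * k))"
    unfolding sum_divisor_pairs[of ?g3 N]
  proof (rule sum.mono_neutral_cong_right)
    fix d assume "d \<in> {U<..N}"
    then show "(\<Sum>k\<in>{0<..N div d}. ?g3 d k) = (\<Sum>k\<in>{V<..N div d}. mu d * mangoldt_high V k * F (d * k))"
      by (intro sum.mono_neutral_cong_right) (auto simp: mangoldt_high_eq_0)
  qed auto
  finally show ?thesis .
qed

text \<open>A Mertens-type upper bound: 1/e is at most 2/V times the integer part of V/e, and the
  sum of Lambda(e) times that integer part is ln(V!), at most V ln V.\<close>

lemma sum_mangoldt_div_le:
  assumes "V \<ge> 1"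
  shows "(\<Sum>e\<in>{0<..V}. mangoldt e / real e) \<le> 2 * ln (real V)"
proof -
  have "(\<Sum>e\<in>{0<..V}. mangoldt e / real e) \<le> (\<Sum>e\<in>{0<..V}. 2 / real V * (mangoldt e * real (V div e)))"
  proof (rule sum_mono)
    fix e assume e: "e \<in> {0<..V}"
    then have "V div e \<ge> 1" by (simp add: Suc_le_eq div_greater_zero_iff)
    moreover have "V = e * (V div e) + V mod e" "V mod e < e" using e by simp_all
    ultimately have "V \<le> 2 * (e * (V div e))"
      using e by (metis add_le_mono less_imp_le mult_2 mult_le_mono2 nat_mult_1_right order_refl order_trans)
    then have "real V \<le> 2 * (real e * real (V div e))"
      by (metis of_nat_le_iff of_nat_mult of_nat_numeral)
    then have "1 / real e \<le> 2 / real V * real (V div e)"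
      using e by (simp add: field_simps)
    then have "mangoldt e * (1 / real e) \<le> mangoldt e * (2 / real V * real (V div e))"
      by (rule mult_left_mono) (rule mangoldt_nonneg)
    then show "mangoldt e / real e \<le> 2 / real V * (mangoldt e * real (V div e))"
      by (simp add: mult_ac)
  qed
  also have "\<dots> = 2 / real V * (\<Sum>e\<in>{0<..V}. \<Sum>k\<in>{0<..V div e}. mangoldt e)"
    by (simp add: sum_distrib_left mult.commute)
  also have "(\<Sum>e\<in>{0<..V}. \<Sum>k\<in>{0<..V div e}. mangoldt e) = (\<Sum>n\<in>{0<..V}. \<Sum>e | e dvd n. mangoldt e)"
    by (rule sum_divisor_pairs[symmetric])
  also have "\<dots> = (\<Sum>n\<in>{0<..V}. ln (real n))"
    by (intro sum.cong refl) (simp add: mangoldt_sum[where ?'a = real, simplified])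
  also have "2 / real V * (\<Sum>n\<in>{0<..V}. ln (real n)) \<le> 2 / real V * (\<Sum>n\<in>{0<..V}. ln (real V))"
    by (intro mult_left_mono sum_mono) auto
  also have "\<dots> = 2 * ln (real V)"
    using assms by simp
  finally show ?thesis .
qed

text \<open>Partial summation with ln k written as a sum of increments over j < k. It leads to the
  tails k > j with nonnegative weights of total ln M.\<close>

lemma norm_sum_ln_le:
  fixes G :: "nat \<Rightarrow> complex"
  assumes "M \<ge> 1" "\<And>j. norm (\<Sum>k\<in>{j<..M}. G k) \<le> K"
  shows "norm (\<Sum>k\<in>{0<..M}. ln (real k) * G k) \<le> ln (real M) * K"
proof -
  define w where "w j = ln (real (Suc j)) - ln (real j)" for j
  have w: "(\<Sum>j\<in>{1..<k}. w j) = ln (real k)" if "k \<ge> 1" for k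
    unfolding w_def using sum_Suc_diff'[of 1 k "\<lambda>j. ln (real j)"] that by simp
  have "(\<Sum>k\<in>{0<..M}. ln (real k) * G k) = (\<Sum>k\<in>{0<..M}. \<Sum>j\<in>{1..<M}. if j < k then w j * G k else 0)"
  proof (rule sum.cong[OF refl])
    fix k assume k: "k \<in> {0<..M}"
    have "ln (real k) * G k = (\<Sum>j\<in>{1..<k}. w j * G k)"
      using w[of k] k by (simp add: sum_distrib_right[symmetric] flip: of_real_sum)
    also have "\<dots> = (\<Sum>j\<in>{1..<M}. if j < k then w j * G k else 0)"
      using k by (intro sum.mono_neutral_cong_left) auto
    finally show "ln (real k) * G k = (\<Sum>j\<in>{1..<M}. if j < k then w j * G k else 0)" .
  qed
  also have "\<dots> = (\<Sum>j\<in>{1..<M}. \<Sum>k\<in>{0<..M}. if j < k then w j * G k else 0)"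
    by (rule sum.swap)
  also have "\<dots> = (\<Sum>j\<in>{1..<M}. w j * (\<Sum>k\<in>{j<..M}. G k))"
    unfolding sum_distrib_left by (intro sum.cong refl sum.mono_neutral_cong_right) auto
  also have "norm \<dots> \<le> (\<Sum>j\<in>{1..<M}. w j * K)"
  proof (rule sum_norm_le)
    fix j assume "j \<in> {1..<M}"
    then have "w j \<ge> 0" by (simp add: w_def)
    then show "norm (w j * (\<Sum>k\<in>{j<..M}. G k)) \<le> w j * K"
      using assms(2)[of j] by (simp add: norm_mult mult_left_mono)
  qed
  also have "\<dots> = ln (real M) * K"
    using w[OF assms(1)] by (simp add: sum_distrib_right[symmetric])
  finally show ?thesis .
qed

section \<open>The sum over primes\<close>

text \<open>Here n and z are the lengths of the two variables, t = tau(q) and l = ln X. The generic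
  pairs, the coincidences of ratios, and the incomplete sums contribute (n z)^2/sqrt Q, (n z)^2/z
  and (n z) sqrt(Q n z), up to t and l. By n z <= 2 X and the bound for 1/z these become X^2/sqrt Q,
  once, and X^2 sqrt(Q/X), twice.\<close>

lemma type_II_numeric:
  fixes n z Q t l X :: real
  assumes pos: "n \<ge> 0" "z \<ge> 1" "Q > 0" "X > 0" "t \<ge> 1" "l \<ge> 1"
    and nz: "n * z \<le> 2 * X" and z: "1 / z \<le> 2 * sqrt (Q / X)" "1 + ln z \<le> 3 * l" and Q: "3 + 2 * ln Q \<le> 5 * l"
  shows "n * (n / Q * (sqrt (4 * z ^ 4 / Q + 4 * z ^ 2 * (1 + ln z)) * sqrt (12 * t ^ 3 * Q ^ 2))
      + (3 + 2 * ln Q) * (z * (t * sqrt (18 * Q * z * n))))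
    \<le> 200 * (t * X)\<^sup>2 * l * (1 / sqrt Q + sqrt (Q / X))"
proof -
  have sl: "sqrt l \<le> l" "sqrt l \<ge> 0"
    using pos by (auto intro!: real_le_lsqrt simp: power2_eq_square)
  have nz2: "(n * z)\<^sup>2 \<le> 4 * X\<^sup>2"
    using power_mono[OF nz, of 2] pos by (simp add: power_mult_distrib)
  have s1: "sqrt (4 * z ^ 4 / Q + 4 * z ^ 2 * (1 + ln z)) \<le> 2 * z\<^sup>2 / sqrt Q + 4 * z * sqrt l"
  proof -
    have "sqrt (4 * z ^ 4 / Q + 4 * z ^ 2 * (1 + ln z)) \<le> sqrt ((2 * z\<^sup>2)\<^sup>2 / Q + (4 * z)\<^sup>2 * l)"
    proof (rule real_sqrt_le_mono, rule add_mono)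
      have "4 * z\<^sup>2 * (1 + ln z) \<le> 4 * z\<^sup>2 * (3 * l)"
        using z by (intro mult_left_mono) auto
      also have "\<dots> \<le> (4 * z)\<^sup>2 * l"
        using pos by (simp add: power_mult_distrib)
      finally show "4 * z\<^sup>2 * (1 + ln z) \<le> (4 * z)\<^sup>2 * l" .
    qed (simp add: power_mult_distrib flip: power_mult)
    also have "\<dots> \<le> sqrt ((2 * z\<^sup>2)\<^sup>2 / Q) + sqrt ((4 * z)\<^sup>2 * l)"
      using pos by (intro sqrt_add_le_add_sqrt) auto
    also have "\<dots> = 2 * z\<^sup>2 / sqrt Q + 4 * z * sqrt l"
    proof -
      have "sqrt (v\<^sup>2 / Q) + sqrt (w\<^sup>2 * l) = v / sqrt Q + w * sqrt l" if "v \<ge> 0" "w \<ge> 0" for v w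
        using that by (simp add: real_sqrt_divide real_sqrt_mult)
      from this[of "2 * z\<^sup>2" "4 * z"] show ?thesis using pos by simp
    qed
    finally show ?thesis .
  qed
  have s2: "sqrt (12 * t ^ 3 * Q ^ 2) \<le> 4 * t\<^sup>2 * Q"
  proof (rule real_le_lsqrt)
    have "12 * t ^ 3 * Q\<^sup>2 \<le> (16 * t) * t ^ 3 * Q\<^sup>2"
      using pos by (intro mult_right_mono) auto
    then show "12 * t ^ 3 * Q ^ 2 \<le> (4 * t\<^sup>2 * Q)\<^sup>2"
      by (simp add: power2_eq_square power3_eq_cube mult_ac)
  qed (use pos in auto)
  have "n * (n / Q * (sqrt (4 * z ^ 4 / Q + 4 * z ^ 2 * (1 + ln z)) * sqrt (12 * t ^ 3 * Q ^ 2)))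
    \<le> n * (n / Q * ((2 * z\<^sup>2 / sqrt Q + 4 * z * sqrt l) * (4 * t\<^sup>2 * Q)))"
    using pos z by (intro mult_left_mono mult_mono s1 s2) (auto intro!: add_nonneg_nonneg)
  also have "\<dots> = 8 * t\<^sup>2 * (n * z)\<^sup>2 * (1 / sqrt Q) + 16 * t\<^sup>2 * (n * z)\<^sup>2 * (1 / z) * sqrt l"
    using pos by (simp add: field_simps power2_eq_square)
  also have "\<dots> \<le> 8 * t\<^sup>2 * (4 * X\<^sup>2) * (1 / sqrt Q) + 16 * t\<^sup>2 * (4 * X\<^sup>2) * (2 * sqrt (Q / X)) * l"
    using pos nz2 z sl by (intro add_mono mult_mono) auto
  finally have first: "n * (n / Q * (sqrt (4 * z ^ 4 / Q + 4 * z ^ 2 * (1 + ln z)) * sqrt (12 * t ^ 3 * Q ^ 2)))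
    \<le> 32 * (t * X)\<^sup>2 * (1 / sqrt Q) + 128 * (t * X)\<^sup>2 * sqrt (Q / X) * l"
    by (simp add: power_mult_distrib mult_ac)
  have s4: "sqrt (18 * Q * z * n) \<le> 6 * (X * sqrt (Q / X))"
  proof (rule real_le_lsqrt)
    have "(sqrt (Q / X))\<^sup>2 = Q / X"
      using pos by simp
    then have "(6 * (X * sqrt (Q / X)))\<^sup>2 = 18 * Q * (2 * X)"
      using pos by (simp only: power_mult_distrib) (simp add: power2_eq_square)
    moreover have "18 * Q * (n * z) \<le> 18 * Q * (2 * X)"
      using pos nz by (intro mult_left_mono) auto
    ultimately show "18 * Q * z * n \<le> (6 * (X * sqrt (Q / X)))\<^sup>2"
      by (simp add: mult_ac)
  qed (use pos in auto)
  have "n * ((3 + 2 * ln Q) * (z * (t * sqrt (18 * Q * z * n)))) = (3 + 2 * ln Q) * ((n * z) * (t * sqrt (18 * Q * z * n)))"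
    by simp
  also have "\<dots> \<le> (5 * l) * ((2 * X) * (t * (6 * (X * sqrt (Q / X)))))"
  proof (rule mult_mono)
    show "n * z * (t * sqrt (18 * Q * z * n)) \<le> 2 * X * (t * (6 * (X * sqrt (Q / X))))"
      by (rule mult_mono[OF nz mult_left_mono[OF s4]]) (use pos in auto)
  qed (use pos Q in auto)
  also have "\<dots> = 60 * (t * 1) * X\<^sup>2 * sqrt (Q / X) * l"
    by (simp add: power2_eq_square)
  also have "\<dots> \<le> 60 * (t * t) * X\<^sup>2 * sqrt (Q / X) * l"
    using pos by (intro mult_right_mono mult_left_mono) auto
  finally have second: "n * ((3 + 2 * ln Q) * (z * (t * sqrt (18 * Q * z * n)))) \<le> 60 * (t * X)\<^sup>2 * sqrt (Q / X) * l"
    by (simp add: power2_eq_square mult_ac)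
  \<comment> \<open>The coefficients 32 and 128 + 60 of the two kinds of terms are both rounded up
    to 200.\<close>
  have "32 * (t * X)\<^sup>2 * (1 / sqrt Q) * 1 \<le> 200 * (t * X)\<^sup>2 * (1 / sqrt Q) * l"
    using pos by (intro mult_mono) auto
  moreover have "(128 + 60) * ((t * X)\<^sup>2 * sqrt (Q / X) * l) \<le> 200 * ((t * X)\<^sup>2 * sqrt (Q / X) * l)"
    using pos by (intro mult_right_mono) auto
  ultimately show ?thesis
    using first second by (simp add: algebra_simps)
qed

lemma sum_dyadic:
  fixes g :: "nat \<Rightarrow> 'a::comm_monoid_add"
  shows "(\<Sum>d\<in>{U<..2 ^ I * U}. g d) = (\<Sum>i<I. \<Sum>d\<in>{2 ^ i * U<..2 * (2 ^ i * U)}. g d)"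
proof (induction I)
  case (Suc I)
  have "{U<..2 ^ Suc I * U} = {U<..2 ^ I * U} \<union> {2 ^ I * U<..2 * (2 ^ I * U)}"
  proof -
    have "U \<le> 2 ^ I * U" "2 ^ I * U \<le> 2 * (2 ^ I * U)" by simp_all
    from ivl_disj_un_two(6)[OF this] show ?thesis by (simp add: mult.assoc)
  qed
  then have "(\<Sum>d\<in>{U<..2 ^ Suc I * U}. g d) = (\<Sum>d\<in>{U<..2 ^ I * U}. g d) + (\<Sum>d\<in>{2 ^ I * U<..2 * (2 ^ I * U)}. g d)"
    by (simp add: sum.union_disjoint)
  then show ?case using Suc by simp
qed simp

section \<open>Dyadic blocks and the assembly of the estimates\<close>

context kl_modulus
begin

text \<open>This is q^(-1/4) + (q/X)^(1/4): the two terms in the bracket of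
  \<open>type_II_numeric\<close>, each after taking a square root.\<close>

abbreviation saving :: "real \<Rightarrow> real" where
  "saving X \<equiv> sqrt (1 / sqrt (real q)) + sqrt (sqrt (real q / X))"

text \<open>Only the product ca * cb enters, so that either of \<open>mu\<close>, bounded by 1, and
  \<open>mangoldt_high\<close>, bounded by ln X, may be the coefficient of the shorter variable
  x.\<close>

lemma type_II_block:
  fixes \<alpha> \<beta> :: "nat \<Rightarrow> complex"
  assumes "coprime a (int q)" "coprime b (int q)" and A: "A \<subseteq> {0<..Z}" and Z: "Z \<ge> 1"
    and N: "N \<ge> 1" "Z \<le> 2 * N" and B: "\<And>x. x \<in> A \<Longrightarrow> B x \<le> P + N"
    and \<alpha>: "\<And>x. x \<in> A \<Longrightarrow> norm (\<alpha> x) \<le> ca" and \<beta>: "\<And>y. y \<in> {P<..P + N} \<Longrightarrow> norm (\<beta> y) \<le> cb"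
    and nonneg: "ca \<ge> 0" "cb \<ge> 0" "ca * cb \<le> l" "l \<ge> 1" "X > 0"
    and nz: "real (N * Z) \<le> 2 * X" and z: "1 / real Z \<le> 2 * sqrt (real q / X)" "1 + ln (real Z) \<le> 3 * l"
    and q: "3 + 2 * ln (real q) \<le> 5 * l"
  shows "norm (\<Sum>x\<in>A. \<Sum>y\<in>{P<..B x}. \<alpha> x * \<beta> y * kT a b (x * y))
    \<le> 15 * (l * sqrt l * real (divisor_tau q) * X * saving X)"
    (is "norm ?S \<le> _")
proof -
  define A' where "A' = sqrt (1 / sqrt (real q))"
  define B' where "B' = sqrt (sqrt (real q / X))"
  let ?t = "real (divisor_tau q)"
  have t: "?t \<ge> 1" using divisor_tau_ge_1[OF q_pos] by simp
  have AB: "A' \<ge> 0" "B' \<ge> 0" "A'\<^sup>2 = 1 / sqrt (real q)" "B'\<^sup>2 = sqrt (real q / X)"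
    using nonneg by (simp_all add: A'_def B'_def)
  have "(norm ?S)\<^sup>2 \<le> cb\<^sup>2 * real N * (ca\<^sup>2 * (real N / real q * (sqrt (4 * real Z ^ 4 / real q + 4 * real Z ^ 2 * (1 + ln (real Z)))
          * sqrt (12 * ?t ^ 3 * real q ^ 2))
      + (3 + 2 * ln (real q)) * (real Z * (?t * sqrt (18 * real q * real Z * real N)))))"
    using N by (intro type_II_bound assms) auto
  also have "\<dots> = (ca * cb)\<^sup>2 * (real N * (real N / real q * (sqrt (4 * real Z ^ 4 / real q + 4 * real Z ^ 2 * (1 + ln (real Z)))
          * sqrt (12 * ?t ^ 3 * real q ^ 2))
      + (3 + 2 * ln (real q)) * (real Z * (?t * sqrt (18 * real q * real Z * real N)))))"
    by (simp only: power_mult_distrib mult_ac)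
  also have "\<dots> \<le> (ca * cb)\<^sup>2 * (200 * (?t * X)\<^sup>2 * l * (1 / sqrt (real q) + sqrt (real q / X)))"
    using assms t Z by (intro mult_left_mono type_II_numeric) auto
  \<comment> \<open>The constant is raised from 200 to 225 = 15^2 and the bracket to (A' + B')^2, so
    that the right-hand side is a perfect square.\<close>
  also have "\<dots> \<le> l\<^sup>2 * (225 * (?t * X)\<^sup>2 * l * (A' + B')\<^sup>2)"
  proof (intro mult_mono power_mono)
    have "(A' + B')\<^sup>2 = A'\<^sup>2 + B'\<^sup>2 + 2 * (A' * B')" by (simp add: power2_sum)
    then show "1 / sqrt (real q) + sqrt (real q / X) \<le> (A' + B')\<^sup>2"
      using AB by simp
  qed (use nonneg t AB in auto)
  also have "\<dots> = (15 * (l * sqrt l * ?t * X * (A' + B')))\<^sup>2"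
    using nonneg by (simp add: power_mult_distrib)
  finally show ?thesis
    unfolding A'_def[symmetric] B'_def[symmetric]
    by (rule power2_le_imp_le) (use nonneg t AB in auto)
qed

text \<open>For d in (D, 2D] the other variable is at most Y = N div D, and the block is empty if Y
  <= U. Otherwise the shorter variable takes the role of x: d if D <= Y, and k if not. In both cases
  it has range at least U, which bounds the proportion of diagonal pairs.\<close>

lemma dyadic_block_le:
  assumes "coprime a (int q)" "coprime b (int q)"
    and U: "U \<ge> 1" "1 / real U \<le> 2 * sqrt (real q / X)" and D: "U \<le> D" and N: "N \<ge> 1" "real N \<le> X"
    and l: "ln X \<ge> 1" "3 + 2 * ln (real q) \<le> 5 * ln X"
  shows "norm (\<Sum>d\<in>{D<..2 * D}. \<Sum>k\<in>{U<..N div d}. mu d * mangoldt_high U k * kT a b (d * k))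
    \<le> 15 * (ln X * sqrt (ln X) * real (divisor_tau q) * X * saving X)"
proof -
  define Y where "Y = N div D"
  \<comment> \<open>The window {U<..U + Y} may extend beyond N; setting the coefficient to 0 there
    keeps the bound ln X valid on all of it.\<close>
  define \<beta> where "\<beta> k = complex_of_real (if k \<le> N then mangoldt_high U k else 0)" for k
  have X: "X > 0" "X \<ge> 1" using N by linarith+
  have Dpos: "D > 0" using U D by simp
  have DY: "D * Y \<le> N" unfolding Y_def by (rule times_div_less_eq_dividend)
  have divY: "N div d \<le> Y" if "d > D" for d
    unfolding Y_def using that Dpos by (intro div_le_mono2) auto
  have YN: "Y \<le> N" by (simp add: Y_def)
  have lnN: "ln (real k) \<le> ln X" if "k > 0" "k \<le> N" for k
    using that N X by simp
  have \<beta>_le: "norm (\<beta> k) \<le> ln X" if "k > 0" for k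
    using mangoldt_high_bounds[OF that, of U] lnN[OF that] l unfolding \<beta>_def by auto
  have mu_le: "norm (complex_of_real (mu d)) \<le> 1" for d
    using abs_mu_le by simp
  show ?thesis
  proof (cases "Y \<le> U")
    case True
    have "(\<Sum>d\<in>{D<..2 * D}. \<Sum>k\<in>{U<..N div d}. mu d * mangoldt_high U k * kT a b (d * k)) = 0"
    proof (rule sum.neutral, rule ballI)
      fix d assume "d \<in> {D<..2 * D}"
      then have "N div d \<le> U" using divY[of d] True by simp
      then show "(\<Sum>k\<in>{U<..N div d}. mu d * mangoldt_high U k * kT a b (d * k)) = 0" by simp
    qed
    then show ?thesis using X l by (auto intro!: mult_nonneg_nonneg add_nonneg_nonneg)
  next
    case False
    show ?thesis
    proof (cases "D \<le> Y")
      case True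
      have "(\<Sum>d\<in>{D<..2 * D}. \<Sum>k\<in>{U<..N div d}. mu d * mangoldt_high U k * kT a b (d * k))
        = (\<Sum>d\<in>{D<..2 * D}. \<Sum>k\<in>{U<..N div d}. complex_of_real (mu d) * \<beta> k * kT a b (d * k))"
      proof (intro sum.cong refl)
        fix d k assume "d \<in> {D<..2 * D}" "k \<in> {U<..N div d}"
        then have "k \<le> N" using divY[of d] YN by auto
        then show "mu d * mangoldt_high U k * kT a b (d * k)
          = complex_of_real (mu d) * \<beta> k * kT a b (d * k)"
          by (simp add: \<beta>_def)
      qed
      also have "norm \<dots> \<le> 15 * (ln X * sqrt (ln X) * real (divisor_tau q) * X * saving X)"
      proof (rule type_II_block[where Z = "2 * D" and N = Y and ca = 1 and cb = "ln X"])
        show "N div d \<le> U + Y" if "d \<in> {D<..2 * D}" for d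
          using divY[of d] that by simp
        show "norm (\<beta> y) \<le> ln X" if "y \<in> {U<..U + Y}" for y
          using that \<beta>_le by simp
        have "Y * (2 * D) \<le> 2 * N" using DY by (simp add: mult_ac)
        then have "real (Y * (2 * D)) \<le> real (2 * N)" by (simp only: of_nat_le_iff)
        also have "\<dots> \<le> 2 * X" using N by simp
        finally show "real (Y * (2 * D)) \<le> 2 * X" .
        have "1 / real (2 * D) \<le> 1 / real U"
          using U D by (intro divide_left_mono) auto
        then show "1 / real (2 * D) \<le> 2 * sqrt (real q / X)" using U by linarith
        have "D \<le> N" using True YN by simp
        then have "real (2 * D) \<le> 2 * X" using N by simp
        then have "ln (real (2 * D)) \<le> ln (2 * X)" using Dpos by simp
        also have "\<dots> = ln 2 + ln X" using X by (simp add: ln_mult)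
        also have "ln (2::real) \<le> 1" using ln_le_minus_one[of 2] by simp
        finally show "1 + ln (real (2 * D)) \<le> 3 * ln X" using l by linarith
      qed (use assms X Dpos True False mu_le in auto)
      finally show ?thesis .
    next
      case False': False
      have "(\<Sum>d\<in>{D<..2 * D}. \<Sum>k\<in>{U<..N div d}. mu d * mangoldt_high U k * kT a b (d * k))
        = (\<Sum>d\<in>{D<..2 * D}. \<Sum>k\<in>{U<..Y}. if d * k \<le> N then \<beta> k * complex_of_real (mu d) * kT a b (k * d) else 0)"
      proof (rule sum.cong[OF refl])
        fix d assume d: "d \<in> {D<..2 * D}"
        then have iff: "d * k \<le> N \<longleftrightarrow> k \<le> N div d" for k
          by (simp add: less_eq_div_iff_mult_less_eq mult.commute)
        show "(\<Sum>k\<in>{U<..N div d}. mu d * mangoldt_high U k * kT a b (d * k))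
          = (\<Sum>k\<in>{U<..Y}. if d * k \<le> N then \<beta> k * complex_of_real (mu d) * kT a b (k * d) else 0)"
          unfolding iff using divY[of d] d YN
          by (intro sum.mono_neutral_cong_left) (auto simp: \<beta>_def mult_ac)
      qed
      also have "\<dots> = (\<Sum>k\<in>{U<..Y}. \<Sum>d\<in>{D<..2 * D}. if d * k \<le> N then \<beta> k * complex_of_real (mu d) * kT a b (k * d) else 0)"
        by (rule sum.swap)
      also have "\<dots> = (\<Sum>k\<in>{U<..Y}. \<Sum>d\<in>{D<..min (2 * D) (N div k)}. \<beta> k * complex_of_real (mu d) * kT a b (k * d))"
      proof (rule sum.cong[OF refl])
        fix k assume k: "k \<in> {U<..Y}"
        then have iff: "d * k \<le> N \<longleftrightarrow> d \<le> N div k" for d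
          by (simp add: less_eq_div_iff_mult_less_eq)
        show "(\<Sum>d\<in>{D<..2 * D}. if d * k \<le> N then \<beta> k * complex_of_real (mu d) * kT a b (k * d) else 0)
          = (\<Sum>d\<in>{D<..min (2 * D) (N div k)}. \<beta> k * complex_of_real (mu d) * kT a b (k * d))"
          unfolding iff by (intro sum.mono_neutral_cong_right) auto
      qed
      also have "norm \<dots> \<le> 15 * (ln X * sqrt (ln X) * real (divisor_tau q) * X * saving X)"
      proof (rule type_II_block[where Z = Y and N = D and ca = "ln X" and cb = 1])
        show "norm (\<beta> y) \<le> ln X" if "y \<in> {U<..Y}" for y
          using that \<beta>_le by simp
        have "real (D * Y) \<le> real N" using DY by (simp only: of_nat_le_iff)
        then show "real (D * Y) \<le> 2 * X" using N X by linarith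
        have "1 / real Y \<le> 1 / real U"
          using U False by (intro divide_left_mono) auto
        then show "1 / real Y \<le> 2 * sqrt (real q / X)" using U by linarith
        have "ln (real Y) \<le> ln X" using False YN by (intro lnN) auto
        then show "1 + ln (real Y) \<le> 3 * ln X" using l by linarith
      qed (use assms X Dpos False False' mu_le in auto)
      finally show ?thesis .
    qed
  qed
qed

lemma type_II_total:
  assumes "coprime a (int q)" "coprime b (int q)"
    and U: "U \<ge> 1" "1 / real U \<le> 2 * sqrt (real q / X)" and N: "N \<ge> 1" "real N \<le> X"
    and l: "ln X \<ge> 1" "3 + 2 * ln (real q) \<le> 5 * ln X"
  shows "norm (\<Sum>d\<in>{U<..N}. \<Sum>k\<in>{U<..N div d}. mu d * mangoldt_high U k * kT a b (d * k))
    \<le> 45 * ((ln X)\<^sup>2 * sqrt (ln X) * real (divisor_tau q) * X * saving X)"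
proof -
  define I where "I = nat \<lceil>log 2 (real N)\<rceil>"
  let ?g = "\<lambda>d. \<Sum>k\<in>{U<..N div d}. mu d * mangoldt_high U k * kT a b (d * k)"
  let ?E = "15 * (ln X * sqrt (ln X) * real (divisor_tau q) * X * saving X)"
  have X: "X > 0" "X \<ge> 1" using N by linarith+
  have E: "?E \<ge> 0" using X l by (auto intro!: mult_nonneg_nonneg add_nonneg_nonneg)
  have log_nonneg: "log 2 (real N) \<ge> 0" using N by simp
  have I_ge: "N \<le> 2 ^ I * U"
  proof -
    have "real N = 2 powr log 2 (real N)" using N by simp
    also have "\<dots> \<le> 2 powr real I" unfolding I_def by (intro powr_mono) linarith+
    also have "\<dots> = real (2 ^ I)" by (simp add: powr_realpow)
    finally have "N \<le> 2 ^ I" by (simp only: of_nat_le_iff)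
    also have "\<dots> \<le> 2 ^ I * U" using U by simp
    finally show ?thesis .
  qed
  have I_le: "real I \<le> 3 * ln X"
  proof -
    have "real I \<le> log 2 (real N) + 1" unfolding I_def using log_nonneg by linarith
    also have "log 2 (real N) = ln (real N) / ln 2" by (simp add: log_def)
    \<comment> \<open>From ln 2 >= 2/3 the number of blocks is at most (3/2) ln X + 1, and ln X >= 1
      makes this at most 3 ln X.\<close>
    also have "\<dots> \<le> ln X / (2 / 3)"
      using N l ln2_ge_two_thirds by (intro frac_le) auto
    finally show ?thesis using l by simp
  qed
  \<comment> \<open>The last block may reach beyond N, where N div d = 0 makes the inner sums
    empty.\<close>
  have "(\<Sum>d\<in>{U<..N}. ?g d) = (\<Sum>d\<in>{U<..2 ^ I * U}. ?g d)"
    using I_ge by (intro sum.mono_neutral_left) auto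
  also have "\<dots> = (\<Sum>i<I. \<Sum>d\<in>{2 ^ i * U<..2 * (2 ^ i * U)}. ?g d)"
    by (rule sum_dyadic)
  also have "norm \<dots> \<le> (\<Sum>i<I. ?E)"
    using assms by (intro sum_norm_le dyadic_block_le) auto
  also have "\<dots> = real I * ?E" by simp
  also have "\<dots> \<le> 3 * ln X * ?E"
    using I_le E by (rule mult_right_mono)
  finally show ?thesis by (simp add: power2_eq_square mult_ac)
qed

text \<open>An inner sum of length n costs n/q + 5 ln X times K = 2 tau(q) q^(3/4). The first part
  adds up to X/q times sums of 1/d and Lambda(e)/e. The second is paid at most U^2 times with weight
  Lambda(e), which U^2 <= X/q makes comparable. The constants are 14 = 2 (2 + 5) and 18 = 2 (4 +
  5).\<close>

lemma type_I_total:
  assumes "coprime a (int q)" and U: "U \<ge> 1" "real U ^ 2 \<le> X / real q" and N: "N \<ge> 1" "real N \<le> X" "U \<le> N"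
    and l: "ln X \<ge> 1" "3 + 2 * ln (real q) \<le> 5 * ln X"
  shows "norm (\<Sum>d\<in>{0<..U}. mu d * (\<Sum>k\<in>{0<..N div d}. ln (real k) * kT a b (d * k)))
      \<le> 14 * ((ln X)\<^sup>2 * (X / real q) * (real (divisor_tau q) * real q powr (3 / 4)))" (is ?th1)
    and "norm (\<Sum>d\<in>{0<..U}. mu d * (\<Sum>e\<in>{0<..N div d}. if e \<le> U then
            mangoldt e * (\<Sum>l\<in>{0<..N div d div e}. kT a b (d * (e * l))) else 0))
      \<le> 18 * ((ln X)\<^sup>2 * (X / real q) * (real (divisor_tau q) * real q powr (3 / 4)))" (is ?th2)
proof -
  let ?K = "2 * real (divisor_tau q) * real q powr (3 / 4)"
  let ?l = "ln X"
  define R where "R = X / real q"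
  have X: "X > 0" "X \<ge> 1" using N by linarith+
  have R: "R \<ge> 0" "real U ^ 2 \<le> R" using X U by (simp_all add: R_def)
  have "real U * 1 \<le> real U * real U" using U by (intro mult_left_mono) auto
  then have UR: "real U \<le> R" using R by (simp add: power2_eq_square)
  have lnU: "ln (real U) \<le> ?l" "ln (real U) \<ge> 0" using U N X by auto
  have inc: "norm (\<Sum>k\<in>{P<..P + n}. kT a b (m * k)) \<le> (y / real q + 5 * ?l) * ?K" if "real n \<le> y" for P n m y
  proof -
    have "norm (\<Sum>k\<in>{P<..P + n}. kT a b (m * k)) \<le> (real n / real q + (3 + 2 * ln (real q))) * ?K"
      by (rule type_I_bound) fact
    also have "\<dots> \<le> (y / real q + 5 * ?l) * ?K"
      using l that by (intro mult_right_mono add_mono divide_right_mono) auto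
    finally show ?thesis .
  qed
  have inv: "(\<Sum>d\<in>{0<..U}. 1 / real d) \<le> 2 * ?l"
    using sum_inverse_atMost_le[OF U(1)] lnU l by linarith
  have "norm (\<Sum>d\<in>{0<..U}. mu d * (\<Sum>k\<in>{0<..N div d}. ln (real k) * kT a b (d * k)))
    \<le> (\<Sum>d\<in>{0<..U}. ?l * ((X / real d / real q + 5 * ?l) * ?K))"
  proof (rule sum_norm_le)
    fix d assume d: "d \<in> {0<..U}"
    have M: "N div d \<ge> 1" using d N by (simp add: Suc_le_eq div_greater_zero_iff)
    have Md: "real (N div d) \<le> X / real d"
    proof -
      have "real (N div d) \<le> real N / real d" by (rule of_nat_div_le_of_nat)
      also have "\<dots> \<le> X / real d" using N by (intro divide_right_mono) auto
      finally show ?thesis .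
    qed
    have "norm (\<Sum>k\<in>{0<..N div d}. ln (real k) * kT a b (d * k)) \<le> ln (real (N div d)) * ((X / real d / real q + 5 * ?l) * ?K)"
    proof (rule norm_sum_ln_le[OF M])
      fix j
      have "{j<..N div d} = {j<..j + (N div d - j)}" by auto
      moreover have "real (N div d - j) \<le> X / real d" using Md by linarith
      ultimately show "norm (\<Sum>k\<in>{j<..N div d}. kT a b (d * k)) \<le> (X / real d / real q + 5 * ?l) * ?K"
        using inc[of "N div d - j" "X / real d" d j] by simp
    qed
    also have "\<dots> \<le> ?l * ((X / real d / real q + 5 * ?l) * ?K)"
    proof (rule mult_right_mono)
      have "real (N div d) \<le> X" using N by (meson div_le_dividend of_nat_le_iff order_trans)
      then show "ln (real (N div d)) \<le> ?l" using M X by simp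
    qed (use X l in \<open>auto intro!: mult_nonneg_nonneg add_nonneg_nonneg\<close>)
    finally show "norm (mu d * (\<Sum>k\<in>{0<..N div d}. ln (real k) * kT a b (d * k))) \<le> ?l * ((X / real d / real q + 5 * ?l) * ?K)"
      using mult_mono[OF abs_mu_le[of d], of "norm (\<Sum>k\<in>{0<..N div d}. ln (real k) * kT a b (d * k))"]
      by (simp add: norm_mult)
  qed
  also have "\<dots> = ?l * ?K * (R * (\<Sum>d\<in>{0<..U}. 1 / real d) + 5 * ?l * real U)"
    by (simp add: R_def sum_distrib_left sum.distrib algebra_simps)
  also have "\<dots> \<le> ?l * ?K * (R * (2 * ?l) + 5 * ?l * R)"
    using inv UR R l by (intro mult_left_mono add_mono) auto
  also have "\<dots> = 14 * (?l\<^sup>2 * R * (real (divisor_tau q) * real q powr (3 / 4)))"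
    by (simp add: power2_eq_square algebra_simps)
  finally show ?th1 unfolding R_def .
  have mang: "(\<Sum>e\<in>{0<..U}. mangoldt e / real e) \<le> 2 * ?l"
    using sum_mangoldt_div_le[OF U(1)] lnU by linarith
  have mangU: "(\<Sum>e\<in>{0<..U}. mangoldt e) \<le> real U * ?l"
  proof -
    have "(\<Sum>e\<in>{0<..U}. mangoldt e) \<le> (\<Sum>e\<in>{0<..U}. ?l)"
    proof (rule sum_mono)
      fix e assume e: "e \<in> {0<..U}"
      then have "mangoldt e \<le> ln (real e)" by (intro mangoldt_le) auto
      also have "\<dots> \<le> ln (real U)" using e by simp
      finally show "mangoldt e \<le> ?l" using lnU by linarith
    qed
    then show ?thesis by simp
  qed
  have "norm (\<Sum>d\<in>{0<..U}. mu d * (\<Sum>e\<in>{0<..N div d}. if e \<le> U then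
            mangoldt e * (\<Sum>l\<in>{0<..N div d div e}. kT a b (d * (e * l))) else 0))
    \<le> (\<Sum>d\<in>{0<..U}. \<Sum>e\<in>{0<..U}. mangoldt e * ((X / real d / real e / real q + 5 * ?l) * ?K))"
  proof (rule sum_norm_le)
    fix d assume d: "d \<in> {0<..U}"
    let ?s = "\<lambda>e. mangoldt e * (\<Sum>l\<in>{0<..N div d div e}. kT a b (d * (e * l)))"
    have "norm (\<Sum>e\<in>{0<..N div d}. if e \<le> U then ?s e else 0) = norm (\<Sum>e\<in>{0<..U}. ?s e)"
    proof (rule arg_cong[where f = norm])
      have "(\<Sum>e\<in>{0<..N div d}. if e \<le> U then ?s e else 0) = (\<Sum>e\<in>{0<..min U (N div d)}. ?s e)"
        by (intro sum.mono_neutral_cong_right) auto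
      also have "\<dots> = (\<Sum>e\<in>{0<..U}. ?s e)"
        by (intro sum.mono_neutral_left) auto
      finally show "(\<Sum>e\<in>{0<..N div d}. if e \<le> U then ?s e else 0) = (\<Sum>e\<in>{0<..U}. ?s e)" .
    qed
    also have "\<dots> \<le> (\<Sum>e\<in>{0<..U}. mangoldt e * ((X / real d / real e / real q + 5 * ?l) * ?K))"
    proof (rule sum_norm_le)
      fix e assume e: "e \<in> {0<..U}"
      have "real (N div d div e) \<le> X / real d / real e"
      proof -
        have "real (N div d div e) \<le> real (N div d) / real e" by (rule of_nat_div_le_of_nat)
        also have "\<dots> \<le> real N / real d / real e"
          by (intro divide_right_mono of_nat_div_le_of_nat) auto
        also have "\<dots> \<le> X / real d / real e" using N by (intro divide_right_mono) auto
        finally show ?thesis .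
      qed
      from inc[OF this, of "d * e" 0]
      show "norm (?s e) \<le> mangoldt e * ((X / real d / real e / real q + 5 * ?l) * ?K)"
        by (simp add: norm_mult mult.assoc mult_left_mono mangoldt_nonneg)
    qed
    finally have "norm (\<Sum>e\<in>{0<..N div d}. if e \<le> U then ?s e else 0)
      \<le> (\<Sum>e\<in>{0<..U}. mangoldt e * ((X / real d / real e / real q + 5 * ?l) * ?K))" .
    then show "norm (mu d * (\<Sum>e\<in>{0<..N div d}. if e \<le> U then ?s e else 0))
      \<le> (\<Sum>e\<in>{0<..U}. mangoldt e * ((X / real d / real e / real q + 5 * ?l) * ?K))"
      using mult_mono[OF abs_mu_le[of d], of "norm (\<Sum>e\<in>{0<..N div d}. if e \<le> U then ?s e else 0)"]
      by (simp add: norm_mult)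
  qed
  also have "\<dots> = ?K * (R * ((\<Sum>d\<in>{0<..U}. 1 / real d) * (\<Sum>e\<in>{0<..U}. mangoldt e / real e))
      + 5 * ?l * (real U * (\<Sum>e\<in>{0<..U}. mangoldt e)))"
  proof -
    have "(\<Sum>d\<in>{0<..U}. \<Sum>e\<in>{0<..U}. mangoldt e * ((X / real d / real e / real q + 5 * ?l) * ?K))
      = (\<Sum>d\<in>{0<..U}. \<Sum>e\<in>{0<..U}. ?K * R * (1 / real d * (mangoldt e / real e)) + ?K * (5 * ?l) * mangoldt e)"
      by (intro sum.cong refl) (simp add: R_def algebra_simps)
    also have "\<dots> = ?K * R * (\<Sum>d\<in>{0<..U}. \<Sum>e\<in>{0<..U}. 1 / real d * (mangoldt e / real e))
      + ?K * (5 * ?l) * (\<Sum>d\<in>{0<..U}. \<Sum>e\<in>{0<..U}. mangoldt e)"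
      by (simp only: sum.distrib sum_distrib_left)
    also have "(\<Sum>d\<in>{0<..U}. \<Sum>e\<in>{0<..U}. 1 / real d * (mangoldt e / real e))
      = (\<Sum>d\<in>{0<..U}. 1 / real d) * (\<Sum>e\<in>{0<..U}. mangoldt e / real e)"
      by (simp only: sum_product)
    finally show ?thesis by (simp add: algebra_simps)
  qed
  also have "\<dots> \<le> ?K * (R * ((2 * ?l) * (2 * ?l)) + 5 * ?l * (real U * (real U * ?l)))"
    using inv mang mangU R l
    by (intro mult_left_mono add_mono mult_mono) (auto intro!: sum_nonneg simp: mangoldt_nonneg)
  also have "\<dots> = ?K * (R * ((2 * ?l) * (2 * ?l)) + 5 * ?l\<^sup>2 * real U ^ 2)"
    by (simp add: power2_eq_square)
  also have "\<dots> \<le> ?K * (R * ((2 * ?l) * (2 * ?l)) + 5 * ?l\<^sup>2 * R)"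
    using R by (intro mult_left_mono add_left_mono) auto
  also have "\<dots> = 18 * (?l\<^sup>2 * R * (real (divisor_tau q) * real q powr (3 / 4)))"
    by (simp add: power2_eq_square algebra_simps)
  finally show ?th2 unfolding R_def .
qed

lemma sum_mangoldt_kT_le:
  assumes "coprime a (int q)" "coprime b (int q)" "q \<ge> 3" "X \<ge> real q"
  shows "norm (\<Sum>n\<in>{0<..nat \<lfloor>X\<rfloor>}. mangoldt n * kT a b n)
    \<le> 80 * ((ln X)\<^sup>2 * sqrt (ln X) * real (divisor_tau q) * X * saving X)"
proof -
  define N where "N = nat \<lfloor>X\<rfloor>"
  \<comment> \<open>Since X >= q the root is at least 1, so U >= 1 and rounding down loses at most a
    factor 2.\<close>
  define U where "U = nat \<lfloor>sqrt (X / real q)\<rfloor>"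
  let ?l = "ln X" and ?t = "real (divisor_tau q)"
  define A where "A = sqrt (1 / sqrt (real q))"
  define R where "R = X / real q"
  have X: "X \<ge> 3" using assms by linarith
  have R: "R \<ge> 1" using assms q_pos by (simp add: R_def)
  have t: "?t \<ge> 1" using divisor_tau_ge_1[OF q_pos] by simp
  have lq: "ln (real q) \<ge> 1"
  proof -
    have "exp 1 \<le> real q" using exp_le assms(3) by linarith
    then show ?thesis using q_pos by (simp add: ln_ge_iff)
  qed
  have ll: "ln (real q) \<le> ?l" using assms q_pos by simp
  have l: "?l \<ge> 1" "3 + 2 * ln (real q) \<le> 5 * ?l" using lq ll by linarith+
  have N: "N \<ge> 1" "real N \<le> X" unfolding N_def using X by linarith+
  have sR: "sqrt R \<ge> 1" using R by simp
  have U: "U \<ge> 1" "real U \<le> sqrt R" "sqrt R < real U + 1"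
    unfolding U_def using sR unfolding R_def by linarith+
  have U2: "real U ^ 2 \<le> R"
    using power_mono[OF U(2), of 2] R by simp
  have RX: "R \<le> X" using assms q_gt_1 X by (simp add: R_def divide_le_eq mult_le_cancel_left1)
  have "real U * 1 \<le> real U * real U" using U by (intro mult_left_mono) auto
  then have UR: "real U \<le> R" using U2 by (simp add: power2_eq_square)
  have UN: "U \<le> N"
    unfolding N_def using UR RX by (simp add: le_nat_floor)
  have U_inv: "1 / real U \<le> 2 * sqrt (real q / X)"
  proof -
    have "sqrt R \<le> 2 * real U" using U by linarith
    moreover have "real U > 0" "sqrt R > 0" using U(1) sR by linarith+
    ultimately have "1 / real U \<le> 2 / sqrt R" by (simp add: divide_simps)
    also have "\<dots> = 2 * sqrt (real q / X)" by (simp add: R_def real_sqrt_divide)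
    finally show ?thesis .
  qed
  have A_powr: "A = real q powr (- (1 / 4))"
  proof -
    have "A = ((1 / real q) powr (1 / 2)) powr (1 / 2)"
      unfolding A_def by (simp add: powr_half_sqrt real_sqrt_divide)
    also have "\<dots> = (1 / real q) powr (1 / 4)" by (simp add: powr_powr)
    also have "\<dots> = real q powr (- (1 / 4))" by (simp add: powr_minus powr_divide inverse_eq_divide)
    finally show ?thesis .
  qed
  have A: "X / real q * real q powr (3 / 4) = X * A"
  proof -
    have "real q powr (3 / 4) = real q * real q powr (- (1 / 4))"
      using q_pos powr_add[of "real q" 1 "- (1 / 4)"] by simp
    then show ?thesis using q_pos by (simp add: A_powr)
  qed
  have A1: "A \<ge> 0" "1 / real q \<le> A"
  proof -
    show "A \<ge> 0" by (simp add: A_def)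
    have "real q powr (- 1) \<le> real q powr (- (1 / 4))"
      using q_gt_1 by (intro powr_mono) auto
    moreover have "real q powr (- 1) = 1 / real q"
      by (simp add: powr_minus_divide)
    ultimately show "1 / real q \<le> A"
      by (simp only: A_powr)
  qed
  let ?M = "?l\<^sup>2 * sqrt ?l * ?t * X"
  have M: "?l * R \<le> ?M * A" "?l\<^sup>2 * (X / real q) * (?t * real q powr (3 / 4)) \<le> ?M * A"
  proof -
    have "1 * ?t * (X * A) \<le> sqrt ?l * ?t * (X * A)"
      using l t X A1 by (intro mult_right_mono) auto
    then have "?l\<^sup>2 * (1 * ?t * (X * A)) \<le> ?l\<^sup>2 * (sqrt ?l * ?t * (X * A))"
      by (rule mult_left_mono) simp
    moreover have "?l\<^sup>2 * (X / real q) * (?t * real q powr (3 / 4)) = ?l\<^sup>2 * (1 * ?t * (X * A))"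
      unfolding A[symmetric] by (simp only: mult_ac mult_1)
    ultimately show "?l\<^sup>2 * (X / real q) * (?t * real q powr (3 / 4)) \<le> ?M * A"
      by (simp only: mult_ac)
    have "?l * 1 \<le> ?l * ?l"
      using l by (intro mult_left_mono) auto
    moreover have "1 * 1 \<le> sqrt ?l * ?t"
      using l t by (intro mult_mono) auto
    moreover have "X * (1 / real q) \<le> X * A"
      using A1 X by (intro mult_left_mono) auto
    ultimately have "(?l * 1) * ((1 * 1) * (X * (1 / real q))) \<le> (?l * ?l) * ((sqrt ?l * ?t) * (X * A))"
      using l t X A1 by (intro mult_mono[of _ "?l * ?l"] mult_mono[of "1 * 1"]) auto
    then show "?l * R \<le> ?M * A"
      by (simp add: R_def power2_eq_square mult_ac)
  qed
  have T0: "norm (\<Sum>n\<in>{0<..U}. mangoldt n * kT a b n) \<le> ?M * A"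
  proof -
    have "norm (\<Sum>n\<in>{0<..U}. mangoldt n * kT a b n) \<le> (\<Sum>n\<in>{0<..U}. ?l)"
    proof (rule sum_norm_le)
      fix n assume n: "n \<in> {0<..U}"
      then have "mangoldt n \<le> ln (real n)" by (intro mangoldt_le) auto
      also have "\<dots> \<le> ?l" using n UR RX X by simp
      finally have "mangoldt n * norm (kT a b n) \<le> ?l * 1"
        using l by (intro mult_mono) (auto simp: kT_def)
      then show "norm (mangoldt n * kT a b n) \<le> ?l" by (simp add: norm_mult)
    qed
    also have "\<dots> = ?l * real U" by simp
    also have "\<dots> \<le> ?l * R" using UR l by (intro mult_left_mono) auto
    finally show ?thesis using M(1) by linarith
  qed
  note T12 = type_I_total[OF assms(1) U(1) _ N UN l, of b]
  note T3 = type_II_total[OF assms(1,2) U(1) U_inv N l]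
  \<comment> \<open>The initial segment and the two type I terms are measured by A = q^(-1/4), which
    is one summand of \<open>saving X\<close>. So the total constant is 1 + 14 + 18 + 45 =
    78.\<close>
  have "norm (\<Sum>n\<in>{0<..N}. mangoldt n * kT a b n)
    \<le> ?M * A + 14 * (?M * A) + 18 * (?M * A) + 45 * (?M * saving X)"
    unfolding vaughan_sum[OF UN UN]
    using T0 T12 T3 M(2) U2 unfolding R_def
    by (intro order_trans[OF norm_triangle_ineq] order_trans[OF norm_triangle_ineq4] add_mono) auto
  also have "\<dots> = 33 * (?M * A) + 45 * (?M * saving X)"
    by simp
  also have "\<dots> \<le> 33 * (?M * saving X) + 45 * (?M * saving X)"
    using X l by (intro add_mono mult_left_mono) (auto simp: A_def)
  also have "\<dots> \<le> 80 * (?M * saving X)"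
    using X l by (simp add: mult_nonneg_nonneg add_nonneg_nonneg)
  finally show ?thesis unfolding N_def .
qed

end

theorem theorem2p1:
  shows "\<exists>C::real. C > 0 \<and>
    (\<forall>\<epsilon>::real. 0 < \<epsilon> \<and> \<epsilon> < 1/10 \<longrightarrow>
      (\<exists>q\<^sub>0::nat. \<forall>q\<ge>q\<^sub>0. \<forall>a b :: int. coprime (a * b) (int q) \<longrightarrow>
        (\<forall>X::real. X \<ge> real q * real (divisor_tau q) ^ 4 * ln (real q) ^ 12 \<longrightarrow>
          norm (T_sum q a b X) \<le> C * (X * Delta q X))))"
\<comment> \<open>The constant is twice the 80 of \<open>sum_mangoldt_kT_le\<close>, the factor 2
  coming from the comparison with \<open>Delta\<close>. Requiring q >= 3 ensures ln q >= 1,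
  uniformly in \<epsilon>.\<close>
proof (intro exI[of _ "160::real"] conjI allI impI exI[of _ "3::nat"])
  fix \<epsilon> X :: real and q :: nat and a b :: int
  assume q3: "q \<ge> 3" and cop: "coprime (a * b) (int q)"
    and X: "X \<ge> real q * real (divisor_tau q) ^ 4 * ln (real q) ^ 12"
  interpret kl_modulus q by unfold_locales (use q3 in simp)
  define Q t l where "Q = real q" and "t = real (divisor_tau q)" and "l = ln X"
  have Q: "Q \<ge> 3" using q3 by (simp add: Q_def)
  have t: "t \<ge> 1" using divisor_tau_ge_1[OF q_pos] by (simp add: t_def)
  have lQ: "ln Q \<ge> 1"
  proof -
    have "exp 1 \<le> Q" using exp_le Q by linarith
    then show ?thesis using Q by (simp add: ln_ge_iff)
  qed
  have XQ: "X \<ge> Q"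
  proof -
    have "Q * 1 * 1 \<le> Q * t ^ 4 * ln Q ^ 12"
      using Q t lQ by (intro mult_mono) auto
    then show ?thesis using X unfolding Q_def t_def by linarith
  qed
  have l: "l \<ge> ln Q" using XQ Q by (simp add: l_def)
  have Xpos: "X > 0" using XQ Q by linarith
  \<comment> \<open>The exponent is 1/4 - 1/6, the gap between the saving obtained and the one
    demanded by the second term of \<open>Delta\<close>.\<close>
  define P where "P = (Q / X) powr (1 / 12)"
  have "T_sum q a b X = (\<Sum>n\<in>{0<..nat \<lfloor>X\<rfloor>}. mangoldt n * kT a b n)"
    unfolding T_sum_def
    by (rule sum.mono_neutral_cong_left) (use Xpos in \<open>auto simp: kT_def iv_def le_nat_iff le_floor_iff\<close>)
  also have "norm \<dots> \<le> 80 * (l\<^sup>2 * sqrt l * t * X * saving X)"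
    unfolding l_def t_def using cop q3 XQ by (intro sum_mangoldt_kT_le) (auto simp: Q_def)
  also have "\<dots> \<le> 160 * (X * Delta q X)"
  proof -
    let ?A = "Q powr (- (1 / 4))"
    let ?B = "(Q / X) powr (1 / 4)"
    have sav: "saving X = ?A + ?B"
    proof -
      have "sqrt (1 / sqrt Q) = (1 / Q) powr (1 / 4)"
        using Q by (simp add: powr_powr powr_divide real_sqrt_divide flip: powr_half_sqrt)
      also have "\<dots> = ?A"
      proof -
        have inv: "1 / Q = Q powr (- 1)" using Q by (simp add: powr_minus_divide)
        show ?thesis unfolding inv powr_powr by simp
      qed
      finally show ?thesis
        using Q Xpos by (simp add: powr_powr Q_def flip: powr_half_sqrt)
    qed
    have l52: "l powr (5 / 2) = l\<^sup>2 * sqrt l"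
      using l lQ powr_add[of l 2 "1 / 2"] by (simp add: powr_half_sqrt)
    have Delta: "Delta q X = l\<^sup>2 * sqrt l * ?A * t + (Q / X) powr (1 / 6) * l\<^sup>2 * t powr (2 / 3)"
      unfolding Delta_def l_def[symmetric] Q_def[symmetric] t_def[symmetric] l52
      by (simp add: powr_minus_divide)
    have nonneg: "l\<^sup>2 * sqrt l * t \<ge> 0" using l lQ t by simp
    have conclude: ?thesis if "X * (l\<^sup>2 * sqrt l * t * (?A + ?B)) \<le> X * (2 * Delta q X)"
    proof -
      have e: "l\<^sup>2 * sqrt l * t * X * (?A + ?B) = X * (l\<^sup>2 * sqrt l * t * (?A + ?B))"
        "X * (2 * Delta q X) = 2 * (X * Delta q X)"
        by (simp_all only: mult_ac)
      show ?thesis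
        unfolding sav e(1) using that unfolding e(2) by linarith
    qed
    have second: "(Q / X) powr (1 / 6) * l\<^sup>2 * t powr (2 / 3) \<ge> 0" by simp
    show ?thesis
    proof (cases "X \<ge> Q\<^sup>2")
      case True
      then have "Q / X \<le> Q powr (-1)"
        using Q Xpos by (simp add: field_simps power2_eq_square powr_minus)
      then have "?B \<le> (Q powr (-1)) powr (1 / 4)"
        using Q Xpos by (intro powr_mono2) auto
      then have "?A + ?B \<le> 2 * ?A" unfolding powr_powr by simp
      then have "l\<^sup>2 * sqrt l * t * (?A + ?B) \<le> l\<^sup>2 * sqrt l * t * (2 * ?A)"
        using nonneg by (rule mult_left_mono)
      also have "\<dots> \<le> 2 * Delta q X"
        unfolding Delta using second by (simp add: mult_ac)
      finally have "X * (l\<^sup>2 * sqrt l * t * (?A + ?B)) \<le> X * (2 * Delta q X)"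
        using Xpos by (intro mult_left_mono) auto
      then show ?thesis by (rule conclude)
    next
      case False
      have l2: "l \<le> 2 * ln Q"
      proof -
        have "X \<le> Q\<^sup>2" using False by simp
        then have "l \<le> ln (Q\<^sup>2)" unfolding l_def using Xpos by (rule ln_mono)
        then show ?thesis using Q by (simp add: ln_realpow)
      qed
      have P: "P * (t powr (1 / 3) * ln Q) \<le> 1"
      proof -
        have "Q / X * (t ^ 4 * ln Q ^ 12) \<le> 1"
          using X Xpos by (simp add: Q_def t_def field_simps)
        then have "(Q / X * (t ^ 4 * ln Q ^ 12)) powr (1 / 12) \<le> 1 powr (1 / 12)"
          using Q Xpos t lQ by (intro powr_mono2) auto
        moreover have "(t ^ 4) powr (1 / 12) = t powr (1 / 3)"
        proof -
          have "t ^ 4 = t powr 4" using t by simp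
          then show ?thesis by (simp only: powr_powr) simp
        qed
        moreover have "(ln Q ^ 12) powr (1 / 12) = ln Q"
        proof -
          have "ln Q ^ 12 = ln Q powr 12" using lQ by simp
          then show ?thesis using lQ by (simp only: powr_powr) simp
        qed
        moreover have "(Q / X * (t ^ 4 * ln Q ^ 12)) powr (1 / 12)
            = P * ((t ^ 4) powr (1 / 12) * (ln Q ^ 12) powr (1 / 12))"
          by (simp only: P_def powr_mult)
        ultimately show ?thesis by (simp only: powr_one_eq_one)
      qed
      have B: "?B = P * (Q / X) powr (1 / 6)"
        unfolding P_def by (simp flip: powr_add)
      have combine: "e \<le> 2 * (x + z)" if "y \<le> 2 * z" "e = x + y" "0 \<le> x" for e x y z :: real
        using that by simp
      have t13: "t = t powr (1 / 3) * t powr (2 / 3)"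
        using t by (simp flip: powr_add)
      \<comment> \<open>Compared with l^2 t^(2/3) in \<open>Delta\<close>, the estimate has the
        surplus t^(1/3) sqrt l, which P has to absorb. As X < Q^2, sqrt l <= l <= 2 ln Q, and the
        hypothesis on X says exactly that P t^(1/3) ln Q <= 1.\<close>
      have "P * t powr (1 / 3) * sqrt l \<le> 2"
      proof -
        have "sqrt l \<le> l" using l lQ by (intro real_le_lsqrt) (auto simp: power2_eq_square)
        then have "sqrt l \<le> 2 * ln Q" using l2 by linarith
        then have "P * t powr (1 / 3) * sqrt l \<le> P * t powr (1 / 3) * (2 * ln Q)"
          by (intro mult_left_mono) (auto simp: P_def)
        then show ?thesis using P by (simp add: mult_ac)
      qed
      then have "(P * t powr (1 / 3) * sqrt l) * ((Q / X) powr (1 / 6) * l\<^sup>2 * t powr (2 / 3))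
        \<le> 2 * ((Q / X) powr (1 / 6) * l\<^sup>2 * t powr (2 / 3))"
        using second by (rule mult_right_mono)
      moreover have "l\<^sup>2 * sqrt l * t * ?B = (P * t powr (1 / 3) * sqrt l) * ((Q / X) powr (1 / 6) * l\<^sup>2 * t powr (2 / 3))"
        unfolding B by (subst t13) (simp only: mult_ac)
      ultimately have "l\<^sup>2 * sqrt l * t * ?B \<le> 2 * ((Q / X) powr (1 / 6) * l\<^sup>2 * t powr (2 / 3))"
        by (simp only:)
      moreover have "l\<^sup>2 * sqrt l * t * (?A + ?B) = l\<^sup>2 * sqrt l * ?A * t + l\<^sup>2 * sqrt l * t * ?B"
        by (simp add: algebra_simps)
      moreover have "l\<^sup>2 * sqrt l * ?A * t \<ge> 0"
        using l lQ t by simp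
      ultimately have "l\<^sup>2 * sqrt l * t * (?A + ?B) \<le> 2 * Delta q X"
        unfolding Delta by (rule combine)
      then have "X * (l\<^sup>2 * sqrt l * t * (?A + ?B)) \<le> X * (2 * Delta q X)"
        using Xpos by (intro mult_left_mono) auto
      then show ?thesis by (rule conclude)
    qed
  qed
  finally show "norm (T_sum q a b X) \<le> 160 * (X * Delta q X)" .
qed simp

end
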